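(* For a triangulated closed connected orientable piecewise-linear four-dimensional manifold $M$ with the vertices of its universal cover placed in $\mathbb R^4$ as described in the context, the image of the map taking edge deviations to differentials of two-dimensional face areas is contained in the kernel of the map taking differentials of face areas to differentials of the edge deficit angles: $$\operatorname{Im}\left(\frac{\partial S_i}{\partial \vec v_a}\right)\subset \operatorname{Ker}\left(\frac{\partial\Omega_a}{\partial S_i}\right).$$
   Context: Setting. The vertices of the universal cover of the triangulation of $M$ are mapped to Euclidean space $\mathbb R^4$ generically and compatibly with the deck group, i.e. equivariantly with respect to a homomorphism from $\pi_1(M)$ to the group of motions of $\mathbb R^4$, so that all 4-simplices are nondegenerate and the metric quantities below are well defined for the simplices of $M$. The index $a$ runs over the edges and $i$ over the two-dimensional faces of the triangulation of $M$. $L_a$ is the squared length of edge $a$, and $S_i$ is the area of face $i$. Fix an orientation of $M$; each 4-simplex gets the sign $+$ or $-$ according to whether its image in $\mathbb R^4$ has the orientation induced from $M$ or the opposite one. Deficit angles around faces. $\omega_i$ is minus the algebraic sum (modulo $2\pi$) of the dihedral angles at the two-dimensional face $i$ of all 4-simplices containing it, each dihedral angle being taken with the sign of its 4-simplex and regarded as a function of the squared edge lengths of that 4-simplex. The matrix $(\partial\omega_i/\partial L_a)$ is computed at the values given by the placement in $\mathbb R^4$, all $L_a$ being regarded as independent variables. The map $(\partial\Omega_a/\partial S_i)$. It takes columns $(dS_i)$ of independent area differentials to columns $(d\Omega_a)$ of differentials of deficit angles around edges. Its matrix is the transpose of the matrix $(\partial\omega_i/\partial L_a)$: $\partial\Omega_a/\partial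 S_i=\partial\omega_i/\partial L_a$; equivalently $d\Omega_a=\sum_i(\partial\omega_i/\partial L_a)\,dS_i$. Edge deviations and the map $(\partial S_i/\partial\vec v_a)$. A deviation of an edge $AB$ is an infinitesimal vector $d\vec v_{AB}\in\mathbb R^4$ orthogonal to $AB$, imagined as starting at the midpoint of $AB$ (using a lift of the edge and its neighbouring simplices to the universal cover). For a triangle $ABC$ with edge deviations $d\vec v_{AB},d\vec v_{BC},d\vec v_{CA}$, let $C',A',B'$ be the endpoints of these vectors drawn from the midpoints of $AB,BC,CA$ respectively; the generated area differential is, to first order, $dS_{ABC}=4S_{A'B'C'}-S_{ABC}$. The resulting linear map from all edge deviations $(d\vec v_a)$ to $(dS_i)$ is denoted $(\partial S_i/\partial\vec v_a)$. *)

theory Defs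
  imports
    "HOL-Analysis.Analysis"
    "HOL-Algebra.Bij"
    "HOL-Combinatorics.Permutations"
begin

text \<open>
  A compact polyhedron is the union of a finite geometric simplicial complex in some Euclidean
  space.  A triangulated closed PL manifold is such a complex \<open>K\<close>, the manifold being \<open>\<Union>K\<close>.
\<close>

subsection \<open>Closed piecewise-linear 4-manifolds\<close>

definition pl_on :: "'a::euclidean_space set \<Rightarrow> ('a \<Rightarrow> 'b::euclidean_space) \<Rightarrow> bool" where
  "pl_on P h \<longleftrightarrow> (\<exists>T. simplicial_complex T \<and> \<Union>T = P \<and>
     (\<forall>S\<in>T. \<forall>x\<in>S. \<forall>y\<in>S. \<forall>u\<in>{0..1}.
        h ((1 - u) *\<^sub>R x + u *\<^sub>R y) = (1 - u) *\<^sub>R h x + u *\<^sub>R h y))"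

text \<open>
  Charts are taken on compact neighbourhoods, with values in a cube; that the centre of the chart
  goes to the interior of the cube excludes boundary points.
\<close>

definition closed_pl_4_manifold :: "'a::euclidean_space set \<Rightarrow> bool" where
  "closed_pl_4_manifold P \<longleftrightarrow>
     (\<exists>T. simplicial_complex T \<and> \<Union>T = P) \<and>
     (\<forall>x\<in>P. \<exists>U N h k. openin (top_of_set P) U \<and> x \<in> U \<and> U \<subseteq> N \<and> N \<subseteq> P \<and>
        homeomorphism N (cbox 0 (1 :: real^4)) h k \<and> pl_on N h \<and> h x \<in> box 0 1)"

subsection \<open>Simplices and orientations\<close>

definition simplices :: "'a::euclidean_space set set \<Rightarrow> nat \<Rightarrow> 'a set set" where
  "simplices K n = {s \<in> K. int n simplex s}"

definition vertices :: "'a::euclidean_space set \<Rightarrow> 'a set" where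
  "vertices s = {v. v extreme_point_of s}"

definition is_listing :: "'a list \<Rightarrow> 'a set \<Rightarrow> bool" where
  "is_listing xs A \<longleftrightarrow> distinct xs \<and> set xs = A"

text \<open>
  An arbitrarily chosen listing.  It is only used to write down quantities that do not depend on
  the order in which the vertices are listed.
\<close>

definition listing :: "'a set \<Rightarrow> 'a list" where
  "listing A = (SOME xs. is_listing xs A)"

text \<open>
  An orientation tells for every ordering of the vertices of a 4-simplex whether it is positive
  (\<open>1\<close>) or negative (\<open>-1\<close>); adjacent 4-simplices induce opposite orientations on their
  common 3-face.
\<close>

definition orientation :: "'a::euclidean_space set set \<Rightarrow> ('a list \<Rightarrow> int) \<Rightarrow> bool" where
  "orientation K orient \<longleftrightarrow>
     (\<forall>s\<in>simplices K 4. \<forall>xs. is_listing xs (vertices s) \<longrightarrow>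
        orient xs \<in> {1, -1} \<and>
        (\<forall>\<pi>. \<pi> permutes {..<length xs} \<longrightarrow> orient (permute_list \<pi> xs) = sign \<pi> * orient xs)) \<and>
     (\<forall>s\<in>simplices K 4. \<forall>s'\<in>simplices K 4. \<forall>x x' ys.
        s \<noteq> s' \<and> is_listing (x # ys) (vertices s) \<and> is_listing (x' # ys) (vertices s') \<longrightarrow>
        orient (x # ys) = - orient (x' # ys))"

subsection \<open>The universal cover and the deck group\<close>

definition universal_cover ::
    "'e::real_normed_vector set \<Rightarrow> ('e \<Rightarrow> 'a::euclidean_space) \<Rightarrow> 'a set \<Rightarrow> bool" where
  "universal_cover E p M \<longleftrightarrow> covering_space E p M \<and> simply_connected E"

definition deck_group ::
    "'e::real_normed_vector set \<Rightarrow> ('e \<Rightarrow> 'a::euclidean_space) \<Rightarrow> ('e \<Rightarrow> 'e) monoid" where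
  "deck_group E p = (BijGroup E)
     \<lparr>carrier := {g \<in> Bij E. (\<exists>h. homeomorphism E E g h) \<and> (\<forall>x\<in>E. p (g x) = p x)}\<rparr>"

text \<open>
  Motions are orientation-preserving: otherwise the sign of a 4-simplex of the manifold would
  depend on the lift.
\<close>

definition motion_group :: "(real^4 \<Rightarrow> real^4) monoid" where
  "motion_group =
     \<lparr>carrier = {T. \<exists>A b. rotation_matrix A \<and> T = (\<lambda>x. A *v x + b)},
      mult = (\<circ>), one = id\<rparr>"

text \<open>The simplices of the universal cover lying over \<open>s\<close>.\<close>

definition lifts ::
    "'e::real_normed_vector set \<Rightarrow> ('e \<Rightarrow> 'a::euclidean_space) \<Rightarrow> 'a set \<Rightarrow> 'e set set" where
  "lifts E p s = components (E \<inter> p -` s)"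

definition some_lift ::
    "'e::real_normed_vector set \<Rightarrow> ('e \<Rightarrow> 'a::euclidean_space) \<Rightarrow> 'a set \<Rightarrow> 'e set" where
  "some_lift E p s = (SOME c. c \<in> lifts E p s)"

subsection \<open>Placements in four-dimensional Euclidean space\<close>

text \<open>
  If \<open>f\<close> places the vertices of the universal cover and \<open>c\<close> is a lift of the simplex \<open>s\<close>, then
  \<open>placed p f c\<close> gives the positions of the vertices of \<open>s\<close> as seen through that lift.
\<close>

definition placed :: "('e \<Rightarrow> 'a) \<Rightarrow> ('e \<Rightarrow> real^4) \<Rightarrow> 'e set \<Rightarrow> 'a \<Rightarrow> real^4" where
  "placed p f c u = f (the_inv_into c p u)"

definition placement ::
    "'a::euclidean_space set set \<Rightarrow> 'e::real_normed_vector set \<Rightarrow> ('e \<Rightarrow> 'a)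
     \<Rightarrow> (('e \<Rightarrow> 'e) \<Rightarrow> real^4 \<Rightarrow> real^4) \<Rightarrow> ('e \<Rightarrow> real^4) \<Rightarrow> bool" where
  "placement K E p \<rho> f \<longleftrightarrow>
     \<rho> \<in> hom (deck_group E p) motion_group \<and>
     (\<forall>g\<in>carrier (deck_group E p). \<forall>x\<in>E. {p x} \<in> K \<longrightarrow> f (g x) = \<rho> g (f x)) \<and>
     (\<forall>s\<in>simplices K 4. \<forall>c\<in>lifts E p s.
        inj_on (placed p f c) (vertices s) \<and> \<not> affine_dependent (placed p f c ` vertices s))"

definition squared_length ::
    "'e::real_normed_vector set \<Rightarrow> ('e \<Rightarrow> 'a::euclidean_space) \<Rightarrow> ('e \<Rightarrow> real^4) \<Rightarrow> 'a set \<Rightarrow> real" where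
  "squared_length E p f a =
     (let q = placed p f (some_lift E p a); xs = listing (vertices a)
      in (dist (q (xs ! 0)) (q (xs ! 1)))\<^sup>2)"

definition simplex_sign ::
    "('a list \<Rightarrow> int) \<Rightarrow> 'e::real_normed_vector set \<Rightarrow> ('e \<Rightarrow> 'a::euclidean_space)
     \<Rightarrow> ('e \<Rightarrow> real^4) \<Rightarrow> 'a set \<Rightarrow> real" where
  "simplex_sign orient E p f s =
     (let q = placed p f (some_lift E p s); xs = listing (vertices s)
      in of_int (orient xs) *
         sgn (det (vector [q (xs ! 1) - q (xs ! 0), q (xs ! 2) - q (xs ! 0),
                           q (xs ! 3) - q (xs ! 0), q (xs ! 4) - q (xs ! 0)] :: real^4^4)))"

subsection \<open>Dihedral angles and deficit angles around two-dimensional faces\<close>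

definition vector_angle :: "'b::real_inner \<Rightarrow> 'b \<Rightarrow> real" where
  "vector_angle u w = arccos (u \<bullet> w / (norm u * norm w))"

definition dihedral_angle ::
    "('a::euclidean_space \<Rightarrow> real^4) \<Rightarrow> 'a set \<Rightarrow> 'a set \<Rightarrow> real" where
  "dihedral_angle q s i =
     (let F = affine hull (q ` vertices i); xs = listing (vertices s - vertices i);
          x = q (xs ! 0); y = q (xs ! 1)
      in vector_angle (x - closest_point F x) (y - closest_point F y))"

text \<open>
  Edges of a simplex of \<open>K\<close> are segments, so a function \<open>L\<close> of squared edge lengths has the edges
  themselves as arguments.
\<close>

definition realizes :: "('a::euclidean_space \<Rightarrow> real^4) \<Rightarrow> 'a set \<Rightarrow> ('a set \<Rightarrow> real) \<Rightarrow> bool" where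
  "realizes q s L \<longleftrightarrow>
     (\<forall>u\<in>vertices s. \<forall>w\<in>vertices s. u \<noteq> w \<longrightarrow> (dist (q u) (q w))\<^sup>2 = L (closed_segment u w))"

definition dihedral_of_lengths ::
    "'a::euclidean_space set \<Rightarrow> 'a set \<Rightarrow> ('a set \<Rightarrow> real) \<Rightarrow> real" where
  "dihedral_of_lengths s i L = dihedral_angle (SOME q. realizes q s L) s i"

text \<open>
  This is the real number representing the class modulo \<open>2\<pi>\<close>; only its derivatives matter.
  The signs stay those of the given placement.
\<close>

definition deficit_angle ::
    "'a::euclidean_space set set \<Rightarrow> ('a list \<Rightarrow> int) \<Rightarrow> 'e::real_normed_vector set \<Rightarrow> ('e \<Rightarrow> 'a)
     \<Rightarrow> ('e \<Rightarrow> real^4) \<Rightarrow> 'a set \<Rightarrow> ('a set \<Rightarrow> real) \<Rightarrow> real" where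
  "deficit_angle K orient E p f i L =
     - (\<Sum>s\<in>{s \<in> simplices K 4. i \<subseteq> s}.
          simplex_sign orient E p f s * dihedral_of_lengths s i L)"

definition deficit_matrix ::
    "'a::euclidean_space set set \<Rightarrow> ('a list \<Rightarrow> int) \<Rightarrow> 'e::real_normed_vector set \<Rightarrow> ('e \<Rightarrow> 'a)
     \<Rightarrow> ('e \<Rightarrow> real^4) \<Rightarrow> 'a set \<Rightarrow> 'a set \<Rightarrow> real" where
  "deficit_matrix K orient E p f i a =
     (let L = squared_length E p f
      in deriv (\<lambda>l. deficit_angle K orient E p f i (L(a := l))) (L a))"

subsection \<open>The two linear maps\<close>

text \<open>Columns indexed by the \<open>n\<close>-simplices, extended by zero.\<close>

definition face_columns :: "'a::euclidean_space set set \<Rightarrow> nat \<Rightarrow> ('a set \<Rightarrow> real) set" where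
  "face_columns K n = {x. \<forall>s. s \<notin> simplices K n \<longrightarrow> x s = 0}"

definition edge_deficit_map ::
    "'a::euclidean_space set set \<Rightarrow> ('a list \<Rightarrow> int) \<Rightarrow> 'e::real_normed_vector set \<Rightarrow> ('e \<Rightarrow> 'a)
     \<Rightarrow> ('e \<Rightarrow> real^4) \<Rightarrow> ('a set \<Rightarrow> real) \<Rightarrow> 'a set \<Rightarrow> real" where
  "edge_deficit_map K orient E p f dS a =
     (if a \<in> simplices K 1
      then \<Sum>i\<in>simplices K 2. deficit_matrix K orient E p f i a * dS i else 0)"

text \<open>
  A deviation vector of an edge of the manifold is attached to a lift of that edge and is carried
  along by the deck group; so a system of deviations is an equivariant family of vectors on the
  edges of the universal cover.  It is determined by one vector, orthogonal to the edge, on one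
  lift of each edge.
\<close>

definition edge_deviations ::
    "'a::euclidean_space set set \<Rightarrow> 'e::real_normed_vector set \<Rightarrow> ('e \<Rightarrow> 'a)
     \<Rightarrow> (('e \<Rightarrow> 'e) \<Rightarrow> real^4 \<Rightarrow> real^4) \<Rightarrow> ('e \<Rightarrow> real^4) \<Rightarrow> ('e set \<Rightarrow> real^4) set" where
  "edge_deviations K E p \<rho> f =
     {dv. \<forall>a\<in>simplices K 1. \<forall>c\<in>lifts E p a.
        (\<forall>u\<in>vertices a. \<forall>w\<in>vertices a. dv c \<bullet> (placed p f c u - placed p f c w) = 0) \<and>
        (\<forall>g\<in>carrier (deck_group E p). dv (g ` c) = \<rho> g (dv c) - \<rho> g 0)}"

definition triangle_area :: "'b::real_inner \<Rightarrow> 'b \<Rightarrow> 'b \<Rightarrow> real" where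
  "triangle_area A B C =
     sqrt ((norm (B - A))\<^sup>2 * (norm (C - A))\<^sup>2 - ((B - A) \<bullet> (C - A))\<^sup>2) / 2"

definition area_map ::
    "'a::euclidean_space set set \<Rightarrow> 'e::real_normed_vector set \<Rightarrow> ('e \<Rightarrow> 'a)
     \<Rightarrow> ('e \<Rightarrow> real^4) \<Rightarrow> ('e set \<Rightarrow> real^4) \<Rightarrow> 'a set \<Rightarrow> real" where
  "area_map K E p f dv i =
     (if i \<in> simplices K 2
      then let c = some_lift E p i; q = placed p f c; xs = listing (vertices i);
               A = q (xs ! 0); B = q (xs ! 1); C = q (xs ! 2);
               edge = (\<lambda>j k. c \<inter> p -` closed_segment (xs ! j) (xs ! k))
           in frechet_derivative
                (\<lambda>(x, y, z). 4 * triangle_area (midpoint B C + x) (midpoint C A + y) (midpoint A B + z)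
                             - triangle_area A B C)
                (at 0)
                (dv (edge 1 2), dv (edge 2 0), dv (edge 0 1))
      else 0)"

end

theory Submission
  imports Defs
begin

text \<open>The identity inside one 4-simplex is an equation between vectors of a three-dimensional
  space, so it is tested against the three vectors \<open>e\<close>. Two of the three normals are
  orthogonal to a given \<open>e\<close>; what remains is one scalar equation, namely the derivative
  of the dual cosine law divided by the sine of the angle singled out in that law. All angles are
  computed from Gram entries, which are linear in the squared lengths. Hence the angles of the
  tetrahedra at an edge are defined without realizing the varied lengths in space, and they visibly
  involve one tetrahedron only. For the 4-simplices more is required:
  \<open>dihedral_of_lengths\<close> selects a realization by \<open>SOME\<close>, so it has to be
  shown that a 4-simplex with one slightly changed edge length still exists in four-dimensional
  space. For the cancellation, topology supplies that a tetrahedron of a 4-simplex also lies in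
  another one (invariance of domain); the orientation makes any two such terms cancel, and if there
  were three or more of them, each would vanish.\<close>

text \<open>
  Fix an edge \<open>a\<close> and differentiate with respect to \<open>L\<^sub>a\<close>.  The area differential of a triangle is
  the sum over its edges \<open>b\<close> of \<open>- |b| e\<^sub>b \<bullet> dv\<^sub>b\<close>, where \<open>e\<^sub>b\<close> is the unit vector orthogonal to \<open>b\<close>
  pointing into the triangle.  In a single 4-simplex \<open>s\<close>, the three triangles at \<open>b\<close> give the vertices \<open>e\<close> of a
  spherical triangle in the orthogonal complement of \<open>b\<close>; its angles \<open>\<theta>\<close> are the dihedral angles of \<open>s\<close>,
  and its sides \<open>\<phi>\<close> are the dihedral angles at \<open>b\<close> of the three tetrahedra of \<open>s\<close> containing \<open>b\<close>.
  Differentiating the dual spherical cosine law gives \<open>\<Sum> \<theta>' e = \<Sum> \<phi>' n\<close>, where \<open>n\<close> is the unit normal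
  in \<open>s\<close> of a tetrahedron.  As \<open>\<phi>'\<close> depends on the tetrahedron only, summing over all 4-simplices
  with their signs makes the right-hand sides cancel: every tetrahedron lies in two 4-simplices, on
  which \<open>sign * n\<close> takes opposite values.  Since the group of the cover acts by motions, all terms can be
  computed in whichever lift is convenient, in particular in two 4-simplices sharing a lifted tetrahedron.
\<close>

subsection \<open>Gram matrices and spherical triangles\<close>

text \<open>The Schur complement of the entry \<open>k z z\<close>. If \<open>k\<close> is the Gram
  matrix of a family of vectors, this is the Gram matrix of their components orthogonal to the
  vector with index \<open>z\<close>, as \<open>orth_inner_orth\<close> shows; by
  \<open>x / 0 = 0\<close> this includes a zero vector.\<close>

definition schur :: "'i \<Rightarrow> ('i \<Rightarrow> 'i \<Rightarrow> real) \<Rightarrow> 'i \<Rightarrow> 'i \<Rightarrow> real" where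
  "schur z k x y = k x y - k x z * k y z / k z z"

definition gram_angle :: "('i \<Rightarrow> 'i \<Rightarrow> real) \<Rightarrow> 'i \<Rightarrow> 'i \<Rightarrow> real" where
  "gram_angle k x y = arccos (k x y / (sqrt (k x x) * sqrt (k y y)))"

definition orth :: "'b::real_inner \<Rightarrow> 'b \<Rightarrow> 'b" where
  "orth z u = u - (u \<bullet> z / (z \<bullet> z)) *\<^sub>R z"

lemma inner_orth [simp]: "orth z u \<bullet> z = 0"
  by (cases "z = 0") (auto simp: orth_def inner_diff_left)

lemma orth_inner_orth: "orth z u \<bullet> orth z w = u \<bullet> w - (u \<bullet> z) * (w \<bullet> z) / (z \<bullet> z)"
proof -
  have "orth z u \<bullet> orth z w = orth z u \<bullet> w"
    by (subst (2) orth_def) (simp add: inner_diff_right)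
  also have "\<dots> = u \<bullet> w - (u \<bullet> z) * (w \<bullet> z) / (z \<bullet> z)"
    by (simp add: orth_def inner_diff_left inner_diff_right inner_commute)
  finally show ?thesis .
qed

lemma gram_angle_commute: "(k x y :: real) = k y x \<Longrightarrow> gram_angle k x y = gram_angle k y x"
  by (simp add: gram_angle_def mult.commute)

text \<open>The difference of the two sides vanishes on a neighbourhood of \<open>l\<close>, so its
  derivative is zero. All coefficients, on both sides, will turn out to contain the factor
  \<open>sin (\<theta>1 l)\<close>, which is divided out later.\<close>

lemma dual_cosine_law_derivative:
  fixes \<theta>1 \<theta>2 \<theta>3 \<phi> :: "real \<Rightarrow> real"
  assumes d: "(\<theta>1 has_real_derivative d1) (at l)" "(\<theta>2 has_real_derivative d2) (at l)"
      "(\<theta>3 has_real_derivative d3) (at l)" "(\<phi> has_real_derivative e) (at l)"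
    and law: "\<forall>\<^sub>F t in nhds l. cos (\<theta>1 t) + cos (\<theta>2 t) * cos (\<theta>3 t) = sin (\<theta>2 t) * sin (\<theta>3 t) * cos (\<phi> t)"
  shows "sin (\<theta>1 l) * d1 + (sin (\<theta>2 l) * cos (\<theta>3 l) + cos (\<theta>2 l) * sin (\<theta>3 l) * cos (\<phi> l)) * d2
      + (sin (\<theta>3 l) * cos (\<theta>2 l) + cos (\<theta>3 l) * sin (\<theta>2 l) * cos (\<phi> l)) * d3
      = sin (\<theta>2 l) * sin (\<theta>3 l) * sin (\<phi> l) * e"
proof -
  let ?f = "\<lambda>t. cos (\<theta>1 t) + cos (\<theta>2 t) * cos (\<theta>3 t) - sin (\<theta>2 t) * sin (\<theta>3 t) * cos (\<phi> t)"
  have "(?f has_real_derivative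
     (- sin (\<theta>1 l) * d1 - sin (\<theta>2 l) * d2 * cos (\<theta>3 l) - cos (\<theta>2 l) * (sin (\<theta>3 l) * d3)
     - (cos (\<theta>2 l) * d2 * sin (\<theta>3 l) * cos (\<phi> l) + sin (\<theta>2 l) * (cos (\<theta>3 l) * d3) * cos (\<phi> l)
        - sin (\<theta>2 l) * sin (\<theta>3 l) * (sin (\<phi> l) * e)))) (at l)" (is "(_ has_real_derivative ?D) _")
    by (auto intro!: derivative_eq_intros d simp: algebra_simps)
  moreover have "\<forall>\<^sub>F t in nhds l. ?f t = 0"
    using law by eventually_elim simp
  then have "(?f has_real_derivative 0) (at l)"
    by (subst DERIV_cong_ev[OF refl _ refl, where g="\<lambda>_. 0"]) auto
  ultimately have "?D = 0" by (rule DERIV_unique)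
  then show ?thesis by (simp add: algebra_simps)
qed

text \<open>Think of \<open>p\<close>, \<open>q\<close> as squared norms and of \<open>a\<close> as
  an inner product. Then \<open>r\<close> is the Gram determinant, and \<open>r / (p * q)\<close> is
  the squared sine of the angle; \<open>r > 0\<close> keeps the argument inside the open interval
  where \<open>arccos\<close> is differentiable.\<close>

lemma arccos_quotient:
  fixes a p q r :: real
  assumes "p > 0" "q > 0" "r > 0" "p * q = a\<^sup>2 + r"
  shows "\<bar>a / (sqrt p * sqrt q)\<bar> < 1"
    and "cos (arccos (a / (sqrt p * sqrt q))) = a / (sqrt p * sqrt q)"
    and "sin (arccos (a / (sqrt p * sqrt q))) = sqrt r / (sqrt p * sqrt q)"
proof -
  have "a\<^sup>2 < p * q" using assms by simp
  then have "\<bar>a\<bar> < sqrt (p * q)"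
    by (metis real_sqrt_abs real_sqrt_less_iff)
  then show 1: "\<bar>a / (sqrt p * sqrt q)\<bar> < 1"
    using assms(1,2) by (simp only: real_sqrt_mult) (simp add: abs_mult)
  show "cos (arccos (a / (sqrt p * sqrt q))) = a / (sqrt p * sqrt q)"
    using 1 by (intro cos_arccos) (auto simp only: abs_less_iff abs_le_iff)
  have "sin (arccos (a / (sqrt p * sqrt q))) = sqrt (1 - (a / (sqrt p * sqrt q))\<^sup>2)"
    using 1 by (intro sin_arccos) (auto simp only: abs_less_iff)
  also have "1 - (a / (sqrt p * sqrt q))\<^sup>2 = r / (p * q)"
    using assms(1-3) by (simp add: power_divide power_mult_distrib diff_divide_eq_iff) (simp add: assms(4))
  finally show "sin (arccos (a / (sqrt p * sqrt q))) = sqrt r / (sqrt p * sqrt q)"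
    by (simp add: real_sqrt_divide real_sqrt_mult)
qed

lemma differentiable_gram_angle:
  fixes k :: "real \<Rightarrow> 'i \<Rightarrow> 'i \<Rightarrow> real"
  assumes "(\<lambda>t. k t x y) field_differentiable at l" "(\<lambda>t. k t x x) field_differentiable at l"
     "(\<lambda>t. k t y y) field_differentiable at l"
   and pos: "k l x x > 0" "k l y y > 0" "(k l x y)\<^sup>2 < k l x x * k l y y"
  shows "(\<lambda>t. gram_angle (k t) x y) field_differentiable at l"
proof -
  obtain a b c where d: "((\<lambda>t. k t x y) has_real_derivative a) (at l)"
     "((\<lambda>t. k t x x) has_real_derivative b) (at l)" "((\<lambda>t. k t y y) has_real_derivative c) (at l)"
    using assms(1-3) by (auto simp: field_differentiable_def)
  have lt: "\<bar>k l x y / (sqrt (k l x x) * sqrt (k l y y))\<bar> < 1"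
    using arccos_quotient(1)[of "k l x x" "k l y y" "k l x x * k l y y - (k l x y)\<^sup>2" "k l x y"] pos by simp
  have "\<exists>D. ((\<lambda>t. k t x y / (sqrt (k t x x) * sqrt (k t y y))) has_real_derivative D) (at l)"
    using pos by (auto intro!: exI derivative_eq_intros d)
  then obtain D where "((\<lambda>t. k t x y / (sqrt (k t x x) * sqrt (k t y y))) has_real_derivative D) (at l)" ..
  from DERIV_chain2[OF DERIV_arccos this] lt show ?thesis
    unfolding gram_angle_def field_differentiable_def abs_less_iff by force
qed

lemma differentiable_schur:
  fixes k :: "real \<Rightarrow> 'i \<Rightarrow> 'i \<Rightarrow> real"
  assumes "(\<lambda>t. k t x y) field_differentiable at l" "(\<lambda>t. k t x z) field_differentiable at l"
     "(\<lambda>t. k t y z) field_differentiable at l" "(\<lambda>t. k t z z) field_differentiable at l"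
   and "k l z z \<noteq> 0"
 shows "(\<lambda>t. schur z (k t) x y) field_differentiable at l"
  unfolding schur_def using assms by (intro derivative_intros)

text \<open>This and the next four lemmas clear denominators with opaque letters, so that no square
  root is expanded. In the applications \<open>a\<close>, \<open>b\<close>, \<open>c\<close> are
  roots of the 2 by 2 principal Gram minors, \<open>w\<close>, \<open>u\<close>, \<open>v\<close>
  are norms (or \<open>w\<close> is 1), and \<open>G\<close> is the root of the 3 by 3 Gram
  determinant.\<close>

lemma common_denominator1:
  fixes a b c u v w G P Q R y :: real
  assumes "a > 0" "b > 0" "c > 0" "u > 0" "v > 0" "G > 0" "w > 0"
  shows "(u\<^sup>2 * P + Q * y) * G / (a * b\<^sup>2 * c * u) = u * G / (a * b) * (P / (c * b)) + Q / (a * b) * (v * G / (c * b)) * (y / (u * v))"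
  using assms by (simp add: field_simps power2_eq_square)

lemma common_denominator2:
  fixes a b c u v w G P Q R y :: real
  assumes "a > 0" "b > 0" "c > 0" "u > 0" "v > 0" "G > 0" "w > 0"
  shows "(P * b\<^sup>2 + Q * R) / (a * c * b\<^sup>2) = P / (a * c) + Q / (a * b) * (R / (c * b))"
  using assms by (simp add: field_simps power2_eq_square)

lemma common_denominator3:
  fixes a b c u v w G P Q R y :: real
  assumes "a > 0" "b > 0" "c > 0" "u > 0" "v > 0" "G > 0" "w > 0"
  shows "G\<^sup>2 * y / (a * c * b\<^sup>2) = u * G / (a * b) * (v * G / (c * b)) * (y / (u * v))"
  using assms by (simp add: field_simps power2_eq_square)

lemma common_denominator4:
  fixes a b c u v w G P Q R y :: real
  assumes "a > 0" "b > 0" "c > 0" "u > 0" "v > 0" "G > 0" "w > 0"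
  shows "y * b\<^sup>2 * G / (a * b\<^sup>2 * c * u) = w * G / (a * c) * (y / (w * u))"
  using assms by (simp add: field_simps power2_eq_square)

lemma common_denominator5:
  fixes a b c u v w G :: real
  assumes "a > 0" "b > 0" "c > 0" "u > 0" "v > 0" "G > 0" "w > 0"
  shows "(u * G / (a * b)) * (v * G / (c * b)) * (b / (u * v)) = (w * G / (a * c)) * (G / (w * b))"
  using assms by (simp add: field_simps power2_eq_square)

section \<open>Trigonometry of a spherical triangle in terms of Gram minors\<close>

definition det3 :: "('i \<Rightarrow> 'i \<Rightarrow> real) \<Rightarrow> 'i \<Rightarrow> 'i \<Rightarrow> 'i \<Rightarrow> real" where
  "det3 k x y z = k x x * k y y * k z z + 2 * k x y * k y z * k x z
     - k x x * (k y z)\<^sup>2 - k y y * (k x z)\<^sup>2 - k z z * (k x y)\<^sup>2"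

definition det2 :: "('i \<Rightarrow> 'i \<Rightarrow> real) \<Rightarrow> 'i \<Rightarrow> 'i \<Rightarrow> real" where
  "det2 k x y = k x x * k y y - (k x y)\<^sup>2"

text \<open>Positive definiteness with all principal minors listed: the condition is visibly
  symmetric in the three indices, and the positivity of each denominator in the angle formulas can
  be read off.\<close>

definition posdef3 :: "('i \<Rightarrow> 'i \<Rightarrow> real) \<Rightarrow> 'i \<Rightarrow> 'i \<Rightarrow> 'i \<Rightarrow> bool" where
  "posdef3 k x y z \<longleftrightarrow> k x x > 0 \<and> k y y > 0 \<and> k z z > 0 \<and>
     det2 k x y > 0 \<and> det2 k y z > 0 \<and> det2 k x z > 0 \<and> det3 k x y z > 0"

context
  fixes k :: "'i \<Rightarrow> 'i \<Rightarrow> real" and x y z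
  assumes sym: "\<And>a b. k a b = k b a" and pos: "posdef3 k x y z"
begin

lemma schur_diag: "k a a > 0 \<Longrightarrow> schur a k b b = det2 k a b / k a a"
  by (simp add: schur_def det2_def diff_divide_distrib power2_eq_square sym[of b a])

text \<open>If \<open>k\<close> is the Gram matrix of three directions,
  \<open>gram_angle (schur x k) y z\<close> is the angle at the vertex \<open>x\<close> of the
  spherical triangle, and \<open>gram_angle k y z\<close> is the opposite side. The sine comes from
  Sylvester's determinant identity, which expresses \<open>det2 k x y * det2 k x z\<close> by the
  square of the numerator of the cosine and \<open>k x x * det3 k x y z\<close>.\<close>

lemma vertex_angle_cos_sin:
  "cos (gram_angle (schur x k) y z) = (k x x * k y z - k x y * k x z) / (sqrt (det2 k x y) * sqrt (det2 k x z))"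
  "sin (gram_angle (schur x k) y z) = sqrt (k x x * det3 k x y z) / (sqrt (det2 k x y) * sqrt (det2 k x z))"
proof -
  let ?a = "k x x * k y z - k x y * k x z"
  have xx: "k x x > 0" using pos by (simp add: posdef3_def)
  have e1: "sqrt (schur x k y y) * sqrt (schur x k z z) = sqrt (det2 k x y) * sqrt (det2 k x z) / k x x"
    using xx by (simp add: schur_diag real_sqrt_divide)
  have e2: "schur x k y z = ?a / k x x"
    using xx by (simp add: schur_def diff_divide_distrib sym[of z x] sym[of y x])
  have g: "gram_angle (schur x k) y z = arccos (?a / (sqrt (det2 k x y) * sqrt (det2 k x z)))"
    unfolding gram_angle_def e1 e2 using xx by simp
  have "det2 k x y * det2 k x z = ?a\<^sup>2 + k x x * det3 k x y z"
    by (simp add: det2_def det3_def algebra_simps power2_eq_square)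
  then have "cos (arccos (?a / (sqrt (det2 k x y) * sqrt (det2 k x z)))) = ?a / (sqrt (det2 k x y) * sqrt (det2 k x z))"
    "sin (arccos (?a / (sqrt (det2 k x y) * sqrt (det2 k x z)))) = sqrt (k x x * det3 k x y z) / (sqrt (det2 k x y) * sqrt (det2 k x z))"
    using pos xx by (intro arccos_quotient(2,3); simp add: posdef3_def)+
  then show "cos (gram_angle (schur x k) y z) = (k x x * k y z - k x y * k x z) / (sqrt (det2 k x y) * sqrt (det2 k x z))"
  "sin (gram_angle (schur x k) y z) = sqrt (k x x * det3 k x y z) / (sqrt (det2 k x y) * sqrt (det2 k x z))"
    by (simp_all only: g)
qed

lemma side_cos_sin:
  "cos (gram_angle k y z) = k y z / (sqrt (k y y) * sqrt (k z z))"
  "sin (gram_angle k y z) = sqrt (det2 k y z) / (sqrt (k y y) * sqrt (k z z))"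
proof -
  have p: "k y y > 0" "k z z > 0" "det2 k y z > 0" using pos by (simp_all add: posdef3_def)
  have "k y y * k z z = (k y z)\<^sup>2 + det2 k y z" by (simp add: det2_def)
  note q = arccos_quotient(2,3)[OF p this]
  show "cos (gram_angle k y z) = k y z / (sqrt (k y y) * sqrt (k z z))"
    "sin (gram_angle k y z) = sqrt (det2 k y z) / (sqrt (k y y) * sqrt (k z z))"
    unfolding gram_angle_def by (rule q)+
qed

end

lemma posdef3_permute:
  assumes sym: "\<And>a b. k a b = k b a" and pos: "posdef3 k x y z"
  shows "posdef3 k y z x" "posdef3 k z x y" "posdef3 k y x z" "posdef3 k x z y" "posdef3 k z y x"
proof -
  have "det3 k y z x = det3 k x y z" "det3 k z x y = det3 k x y z" "det3 k y x z = det3 k x y z"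
    "det3 k x z y = det3 k x y z" "det3 k z y x = det3 k x y z"
    by (simp_all add: det3_def sym[of y x] sym[of z x] sym[of z y])
  moreover have "det2 k y x = det2 k x y" "det2 k z x = det2 k x z" "det2 k z y = det2 k y z"
    by (simp_all add: det2_def sym[of y x] sym[of z x] sym[of z y])
  ultimately show "posdef3 k y z x" "posdef3 k z x y" "posdef3 k y x z" "posdef3 k x z y" "posdef3 k z y x"
    using pos by (simp_all add: posdef3_def)
qed

context
  fixes k :: "'i \<Rightarrow> 'i \<Rightarrow> real" and x y z
  assumes sym: "\<And>a b. k a b = k b a" and pos: "posdef3 k x y z"
begin

lemma dual_cosine_law:
  "cos (gram_angle (schur x k) y z) + cos (gram_angle (schur y k) x z) * cos (gram_angle (schur z k) x y)
   = sin (gram_angle (schur y k) x z) * sin (gram_angle (schur z k) x y) * cos (gram_angle k y z)"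
proof -
  note p = posdef3_permute[OF sym pos]
  define a b c where abc: "a = sqrt (det2 k x y)" "b = sqrt (det2 k y z)" "c = sqrt (det2 k x z)"
  define u v G where uvG: "u = sqrt (k y y)" "v = sqrt (k z z)" "G = sqrt (det3 k x y z)"
  have G3: "det3 k y x z = det3 k x y z" "det3 k z x y = det3 k x y z"
    by (simp_all add: det3_def sym[of y x] sym[of z x] sym[of z y])
  have D2: "det2 k y x = det2 k x y" "det2 k z x = det2 k x z" "det2 k z y = det2 k y z"
    by (simp_all add: det2_def sym[of y x] sym[of z x] sym[of z y])
  have nz: "a > 0" "b > 0" "c > 0" "u > 0" "v > 0" "G > 0"
    using pos by (auto simp: abc uvG posdef3_def)
  have sq: "a\<^sup>2 = det2 k x y" "b\<^sup>2 = det2 k y z" "c\<^sup>2 = det2 k x z" "u\<^sup>2 = k y y" "v\<^sup>2 = k z z" "G\<^sup>2 = det3 k x y z"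
    using pos by (auto simp: abc uvG posdef3_def)
  \<comment> \<open>An off-diagonal entry of the identity adj (adj k) = (det k) k for 3 by 3
    matrices: the bracketed expressions are cofactors up to sign, and \<open>b\<^sup>2\<close> is a
    diagonal cofactor.\<close>
  have "(k x x * k y z - k x y * k x z) * b\<^sup>2 + (k y y * k x z - k x y * k y z) * (k z z * k x y - k x z * k y z) = G\<^sup>2 * k y z"
    unfolding sq det2_def det3_def by (simp add: algebra_simps power2_eq_square)
  then have e1: "((k x x * k y z - k x y * k x z) * b\<^sup>2 + (k y y * k x z - k x y * k y z) * (k z z * k x y - k x z * k y z)) / (a * c * b\<^sup>2)
      = G\<^sup>2 * k y z / (a * c * b\<^sup>2)" by (rule arg_cong)
  have e2: "((k x x * k y z - k x y * k x z) * b\<^sup>2 + (k y y * k x z - k x y * k y z) * (k z z * k x y - k x z * k y z)) / (a * c * b\<^sup>2)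
    = (k x x * k y z - k x y * k x z) / (a * c) +
     (k y y * k x z - k x y * k y z) / (a * b) * ((k z z * k x y - k x z * k y z) / (c * b))"
    by (rule common_denominator2[OF nz zero_less_one])
  have e3: "G\<^sup>2 * k y z / (a * c * b\<^sup>2) = u * G / (a * b) * (v * G / (c * b)) * (k y z / (u * v))"
    by (rule common_denominator3[OF nz zero_less_one])
  have "(k x x * k y z - k x y * k x z) / (a * c) +
     (k y y * k x z - k x y * k y z) / (a * b) * ((k z z * k x y - k x z * k y z) / (c * b))
     = u * G / (a * b) * (v * G / (c * b)) * (k y z / (u * v))" using e1 unfolding e2 e3 .
  then show ?thesis
    unfolding vertex_angle_cos_sin[OF sym pos] vertex_angle_cos_sin[OF sym p(3)] vertex_angle_cos_sin[OF sym p(2)]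
    side_cos_sin[OF sym pos] real_sqrt_mult G3 D2 abc[symmetric] uvG[symmetric]
    by (simp only: sym[of y x] sym[of z x] sym[of z y])
qed

text \<open>The polar five-part formula of spherical trigonometry. It exhibits the sine of the angle
  at \<open>x\<close> in a coefficient of the differentiated dual cosine law, leaving the cosine of
  a side.\<close>

lemma spherical_coefficient:
  "sin (gram_angle (schur y k) x z) * cos (gram_angle (schur z k) x y)
   + cos (gram_angle (schur y k) x z) * sin (gram_angle (schur z k) x y) * cos (gram_angle k y z)
   = sin (gram_angle (schur x k) y z) * cos (gram_angle k x y)"
proof -
  note p = posdef3_permute[OF sym pos]
  define a b c where abc: "a = sqrt (det2 k x y)" "b = sqrt (det2 k y z)" "c = sqrt (det2 k x z)"
  define w u v G where uvG: "w = sqrt (k x x)" "u = sqrt (k y y)" "v = sqrt (k z z)" "G = sqrt (det3 k x y z)"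
  have G3: "det3 k y x z = det3 k x y z" "det3 k z x y = det3 k x y z"
    by (simp_all add: det3_def sym[of y x] sym[of z x] sym[of z y])
  have D2: "det2 k y x = det2 k x y" "det2 k z x = det2 k x z" "det2 k z y = det2 k y z"
    by (simp_all add: det2_def sym[of y x] sym[of z x] sym[of z y])
  have nz: "a > 0" "b > 0" "c > 0" "u > 0" "v > 0" "G > 0" "w > 0"
    using pos by (auto simp: abc uvG posdef3_def)
  have sq: "a\<^sup>2 = det2 k x y" "b\<^sup>2 = det2 k y z" "c\<^sup>2 = det2 k x z" "u\<^sup>2 = k y y" "v\<^sup>2 = k z z" "G\<^sup>2 = det3 k x y z"
    using pos by (auto simp: abc uvG posdef3_def)
  have "u\<^sup>2 * (k z z * k x y - k x z * k y z) + (k y y * k x z - k x y * k y z) * k y z = k x y * b\<^sup>2"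
    unfolding sq det2_def by (simp add: algebra_simps power2_eq_square)
  then have e1: "(u\<^sup>2 * (k z z * k x y - k x z * k y z) + (k y y * k x z - k x y * k y z) * k y z) * G / (a * b\<^sup>2 * c * u) = k x y * b\<^sup>2 * G / (a * b\<^sup>2 * c * u)"
    by (simp only:)
  have e2: "(u\<^sup>2 * (k z z * k x y - k x z * k y z) + (k y y * k x z - k x y * k y z) * k y z) * G / (a * b\<^sup>2 * c * u)
    = u * G / (a * b) * ((k z z * k x y - k x z * k y z) / (c * b)) +
     (k y y * k x z - k x y * k y z) / (a * b) * (v * G / (c * b)) * (k y z / (u * v))"
    by (rule common_denominator1[OF nz])
  have e3: "k x y * b\<^sup>2 * G / (a * b\<^sup>2 * c * u) = w * G / (a * c) * (k x y / (w * u))"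
    by (rule common_denominator4[OF nz])
  have "u * G / (a * b) * ((k z z * k x y - k x z * k y z) / (c * b)) +
     (k y y * k x z - k x y * k y z) / (a * b) * (v * G / (c * b)) * (k y z / (u * v))
     = w * G / (a * c) * (k x y / (w * u))" using e1 unfolding e2 e3 .
  then show ?thesis
    unfolding vertex_angle_cos_sin[OF sym pos] vertex_angle_cos_sin[OF sym p(3)] vertex_angle_cos_sin[OF sym p(2)]
    side_cos_sin[OF sym pos] side_cos_sin[OF sym p(2)] real_sqrt_mult G3 D2 abc[symmetric] uvG[symmetric]
    by (simp only: sym[of y x] sym[of z x] sym[of z y])
qed

text \<open>The last quotient is the sine of the altitude from \<open>x\<close>, that is, the
  distance of the vector \<open>x\<close> from the plane of \<open>y\<close> and \<open>z\<close>,
  divided by its norm. By the sine law and the right triangle cut off by the altitude, both sides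
  are equal.\<close>

lemma spherical_altitude:
  "sin (gram_angle (schur y k) x z) * sin (gram_angle (schur z k) x y) * sin (gram_angle k y z)
   = sin (gram_angle (schur x k) y z) * (sqrt (det3 k x y z) / (sqrt (k x x) * sqrt (det2 k y z)))"
proof -
  note p = posdef3_permute[OF sym pos]
  have G3: "det3 k y x z = det3 k x y z" "det3 k z x y = det3 k x y z"
    by (simp_all add: det3_def sym[of y x] sym[of z x] sym[of z y])
  have D2: "det2 k y x = det2 k x y" "det2 k z x = det2 k x z" "det2 k z y = det2 k y z"
    by (simp_all add: det2_def sym[of y x] sym[of z x] sym[of z y])
  show ?thesis
    unfolding vertex_angle_cos_sin[OF sym pos] vertex_angle_cos_sin[OF sym p(3)] vertex_angle_cos_sin[OF sym p(2)]
      side_cos_sin[OF sym pos] real_sqrt_mult G3 D2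
    by (rule common_denominator5) (use pos in \<open>simp_all add: posdef3_def\<close>)
qed

end

section \<open>Derivatives along a one-parameter family of Gram matrices\<close>

context
  fixes k :: "real \<Rightarrow> 'i \<Rightarrow> 'i \<Rightarrow> real" and l :: real
  assumes sym: "\<And>t a b. k t a b = k t b a"
    and diff: "\<And>a b. (\<lambda>t. k t a b) field_differentiable at l"
begin

lemma isCont_entry [continuous_intros]: "isCont (\<lambda>t. k t a b) l"
  by (rule field_differentiable_imp_continuous_at[OF diff])

lemma eventually_posdef3:
  assumes "posdef3 (k l) x y z"
  shows "\<forall>\<^sub>F t in nhds l. posdef3 (k t) x y z"
proof -
  have ev: "\<forall>\<^sub>F t in nhds l. f t > 0" if "isCont f l" "f l > 0" for f :: "real \<Rightarrow> real"
    using that by (auto simp: isCont_def tendsto_at_iff_tendsto_nhds dest: order_tendstoD)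
  show ?thesis
    unfolding posdef3_def using assms[unfolded posdef3_def]
    by (intro eventually_conj ev; (simp; fail)?) (unfold det2_def det3_def, (intro continuous_intros)+)
qed

lemma differentiable_vertex_angle:
  assumes pd: "posdef3 (k l) a b c"
  shows "(\<lambda>t. gram_angle (schur a (k t)) b c) field_differentiable at l"
proof (rule differentiable_gram_angle)
  have q: "k l a a > 0" "det2 (k l) a b > 0" "det2 (k l) a c > 0" "det3 (k l) a b c > 0"
    using pd by (auto simp: posdef3_def)
  show "(\<lambda>t. schur a (k t) b c) field_differentiable at l" "(\<lambda>t. schur a (k t) b b) field_differentiable at l"
    "(\<lambda>t. schur a (k t) c c) field_differentiable at l"
    using q by (auto intro!: differentiable_schur diff)
  have e: "schur a (k l) b b = det2 (k l) a b / k l a a" "schur a (k l) c c = det2 (k l) a c / k l a a"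
    using q(1) by (simp_all add: schur_def det2_def field_simps power2_eq_square sym)
  then show "schur a (k l) b b > 0" "schur a (k l) c c > 0" using q by auto
  have "schur a (k l) b c = (k l a a * k l b c - k l a b * k l a c) / k l a a"
    using q by (simp add: schur_def diff_divide_distrib sym)
  moreover have "(k l a a * k l b c - k l a b * k l a c)\<^sup>2 + k l a a * det3 (k l) a b c = det2 (k l) a b * det2 (k l) a c"
    by (simp add: det2_def det3_def sym algebra_simps power2_eq_square)
  then have "(k l a a * k l b c - k l a b * k l a c)\<^sup>2 < det2 (k l) a b * det2 (k l) a c"
    using q by (smt (verit) mult_pos_pos)
  ultimately show "(schur a (k l) b c)\<^sup>2 < schur a (k l) b b * schur a (k l) c c"
    unfolding e using q by (simp add: power_divide divide_strict_right_mono power2_eq_square)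
qed

text \<open>The differentiated dual cosine law, simplified by \<open>spherical_coefficient\<close>
  and \<open>spherical_altitude\<close> and divided by the sine of the angle at \<open>x\<close>,
  which is nonzero because the Gram determinant is positive. For the coefficient of the third angle,
  \<open>y\<close> and \<open>z\<close> change roles.\<close>

lemma spherical_derivative_step:
  assumes pd: "posdef3 (k l) x y z"
  shows "deriv (\<lambda>t. gram_angle (schur x (k t)) y z) l
     + cos (gram_angle (k l) x y) * deriv (\<lambda>t. gram_angle (schur y (k t)) x z) l
     + cos (gram_angle (k l) x z) * deriv (\<lambda>t. gram_angle (schur z (k t)) x y) l
     = sqrt (det3 (k l) x y z) / (sqrt (k l x x) * sqrt (det2 (k l) y z)) * deriv (\<lambda>t. gram_angle (k t) y z) l"
proof -
  note p = posdef3_permute[OF sym pd]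
  have posk: "k l x x > 0" "k l y y > 0" "k l z z > 0" "det2 (k l) x y > 0" "det2 (k l) y z > 0" "det2 (k l) x z > 0"
    "det2 (k l) y x > 0" "det2 (k l) z y > 0" "det2 (k l) z x > 0" "det3 (k l) x y z > 0"
    using p pd by (auto simp: posdef3_def)
  note ds = differentiable_vertex_angle
  have dphi: "(\<lambda>t. gram_angle (k t) y z) field_differentiable at l"
    by (rule differentiable_gram_angle) (use diff posk in \<open>auto simp: det2_def\<close>)
  have law0: "\<forall>\<^sub>F t in nhds l. cos (gram_angle (schur x (k t)) y z) + cos (gram_angle (schur y (k t)) x z) * cos (gram_angle (schur z (k t)) x y)
     = sin (gram_angle (schur y (k t)) x z) * sin (gram_angle (schur z (k t)) x y) * cos (gram_angle (k t) y z)"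
    using eventually_posdef3[OF pd] by eventually_elim (rule dual_cosine_law[OF sym])
  have "schur x (k l) z y = schur x (k l) y z" by (simp add: schur_def sym mult.commute)
  then have c: "gram_angle (schur x (k l)) z y = gram_angle (schur x (k l)) y z" "gram_angle (k l) z y = gram_angle (k l) y z"
    by (auto intro: gram_angle_commute sym)
  note law = dual_cosine_law_derivative[OF DERIV_deriv_iff_field_differentiable[THEN iffD2, OF ds[OF pd]]
    DERIV_deriv_iff_field_differentiable[THEN iffD2, OF ds[OF p(3)]]
    DERIV_deriv_iff_field_differentiable[THEN iffD2, OF ds[OF p(2)]]
    DERIV_deriv_iff_field_differentiable[THEN iffD2, OF dphi] law0]
  have *: "sin (gram_angle (schur x (k l)) y z) * deriv (\<lambda>t. gram_angle (schur x (k t)) y z) l +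
      sin (gram_angle (schur x (k l)) y z) * cos (gram_angle (k l) x y) * deriv (\<lambda>t. gram_angle (schur y (k t)) x z) l +
      sin (gram_angle (schur x (k l)) y z) * cos (gram_angle (k l) x z) * deriv (\<lambda>t. gram_angle (schur z (k t)) x y) l
      = sin (gram_angle (schur x (k l)) y z) * (sqrt (det3 (k l) x y z) / (sqrt (k l x x) * sqrt (det2 (k l) y z))) * deriv (\<lambda>t. gram_angle (k t) y z) l"
    using law
    unfolding spherical_coefficient[OF sym pd] spherical_coefficient[OF sym p(4), unfolded c] spherical_altitude[OF sym pd] .
  have nz: "sin (gram_angle (schur x (k l)) y z) \<noteq> 0"
    using vertex_angle_cos_sin(2)[OF sym pd] posk by simp
  have cancel: "S * d1 + S * c2 * d2 + S * c3 * d3 = S * R * e \<Longrightarrow> S \<noteq> 0 \<Longrightarrow> d1 + c2 * d2 + c3 * d3 = R * e"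
    for S d1 c2 d2 c3 d3 R e :: real
    by (metis distrib_left mult.assoc mult_cancel_left)
  show ?thesis by (rule cancel[OF * nz])
qed

end

subsection \<open>Vector form of the spherical identity\<close>

definition indep3 :: "'b::real_vector \<Rightarrow> 'b \<Rightarrow> 'b \<Rightarrow> bool" where
  "indep3 u v w \<longleftrightarrow> (\<forall>a b c. a *\<^sub>R u + b *\<^sub>R v + c *\<^sub>R w = 0 \<longrightarrow> a = 0 \<and> b = 0 \<and> c = 0)"

lemma indep3_permute:
  assumes "indep3 u v w"
  shows "indep3 v w u" "indep3 u w v"
proof -
  have ind: "a = 0 \<and> b = 0 \<and> c = 0" if "a *\<^sub>R u + b *\<^sub>R v + c *\<^sub>R w = 0" for a b c
    using assms that by (auto simp: indep3_def)
  show "indep3 v w u" unfolding indep3_def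
  proof (intro allI impI)
    fix a b c assume "a *\<^sub>R v + b *\<^sub>R w + c *\<^sub>R u = 0"
    then have "c *\<^sub>R u + a *\<^sub>R v + b *\<^sub>R w = 0" by (simp add: add_ac)
    from ind[OF this] show "a = 0 \<and> b = 0 \<and> c = 0" by simp
  qed
  show "indep3 u w v" unfolding indep3_def
  proof (intro allI impI)
    fix a b c assume "a *\<^sub>R u + b *\<^sub>R w + c *\<^sub>R v = 0"
    then have "a *\<^sub>R u + c *\<^sub>R v + b *\<^sub>R w = 0" by (simp add: add_ac)
    from ind[OF this] show "a = 0 \<and> b = 0 \<and> c = 0" by simp
  qed
qed

text \<open>The component of \<open>w\<close> orthogonal to \<open>u\<close> and \<open>v\<close>, scaled so as to avoid division.\<close>

definition cross_inner :: "'b::real_inner \<Rightarrow> 'b \<Rightarrow> 'b \<Rightarrow> 'b" where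
  "cross_inner u v w = ((u \<bullet> u) * (v \<bullet> v) - (u \<bullet> v)\<^sup>2) *\<^sub>R w
     + ((u \<bullet> v) * (v \<bullet> w) - (v \<bullet> v) * (u \<bullet> w)) *\<^sub>R u + ((u \<bullet> v) * (u \<bullet> w) - (u \<bullet> u) * (v \<bullet> w)) *\<^sub>R v"

lemma cross_inner_simps:
  fixes u v w :: "'b::real_inner" and f :: "'i \<Rightarrow> 'b"
  shows
  "cross_inner u v w \<bullet> u = 0" "cross_inner u v w \<bullet> v = 0"
  "cross_inner (f x) (f y) (f z) \<bullet> f z = det3 (\<lambda>a b. f a \<bullet> f b) x y z"
  "cross_inner (f x) (f y) (f z) \<bullet> cross_inner (f x) (f y) (f z)
    = det2 (\<lambda>a b. f a \<bullet> f b) x y * det3 (\<lambda>a b. f a \<bullet> f b) x y z"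
proof -
  show 1: "cross_inner u v w \<bullet> u = 0" "cross_inner u v w \<bullet> v = 0" for u v w :: 'b
    by (simp_all add: cross_inner_def inner_add_left inner_commute[of w] inner_commute[of v u] power2_eq_square algebra_simps)
  show 2: "cross_inner (f x) (f y) (f z) \<bullet> f z = det3 (\<lambda>a b. f a \<bullet> f b) x y z"
    by (simp add: cross_inner_def det3_def inner_add_left power2_eq_square algebra_simps)
  have "cross_inner (f x) (f y) (f z) \<bullet> cross_inner (f x) (f y) (f z)
     = det2 (\<lambda>a b. f a \<bullet> f b) x y * (cross_inner (f x) (f y) (f z) \<bullet> f z)"
    by (subst (2) cross_inner_def) (simp add: inner_add_right 1 det2_def)
  then show "cross_inner (f x) (f y) (f z) \<bullet> cross_inner (f x) (f y) (f z)
    = det2 (\<lambda>a b. f a \<bullet> f b) x y * det3 (\<lambda>a b. f a \<bullet> f b) x y z" by (simp only: 2)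
qed

text \<open>Each determinant is the squared norm of a nonzero vector up to a positive factor: for
  two vectors of the unnormalized Gram-Schmidt vector \<open>?w\<close>, for three of
  \<open>cross_inner\<close>.\<close>

lemma posdef3_inner:
  fixes f :: "'i \<Rightarrow> 'b::real_inner"
  assumes ind: "indep3 (f x) (f y) (f z)"
  shows "posdef3 (\<lambda>a b. f a \<bullet> f b) x y z"
proof -
  have ind: "a = 0 \<and> b = 0 \<and> c = 0" if "a *\<^sub>R f x + b *\<^sub>R f y + c *\<^sub>R f z = 0" for a b c
    using ind that by (auto simp: indep3_def)
  have nz: "f x \<noteq> 0" "f y \<noteq> 0" "f z \<noteq> 0"
    using ind[of 1 0 0] ind[of 0 1 0] ind[of 0 0 1] by auto
  have d2: "det2 (\<lambda>a b. f a \<bullet> f b) p q > 0"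
    if "f p \<noteq> 0" and "\<And>a b. a *\<^sub>R f p + b *\<^sub>R f q = 0 \<Longrightarrow> b = 0" for p q
  proof -
    let ?w = "(f p \<bullet> f p) *\<^sub>R f q + (- (f p \<bullet> f q)) *\<^sub>R f p"
    have "?w \<noteq> 0" using that(2)[of "- (f p \<bullet> f q)" "f p \<bullet> f p"] that(1) by (auto simp: add.commute)
    then have "0 < ?w \<bullet> ?w" by simp
    also have "?w \<bullet> ?w = (f p \<bullet> f p) * det2 (\<lambda>a b. f a \<bullet> f b) p q"
      by (simp add: det2_def inner_add_left inner_add_right inner_commute[of "f q" "f p"] power2_eq_square algebra_simps)
    finally show ?thesis using that(1) by (auto elim: zero_less_mult_pos)
  qed
  have dxy: "det2 (\<lambda>a b. f a \<bullet> f b) x y > 0"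
    by (rule d2) (use nz ind[of _ _ 0] in auto)
  have "cross_inner (f x) (f y) (f z) \<noteq> 0"
  proof
    assume "cross_inner (f x) (f y) (f z) = 0"
    then have "((f x \<bullet> f y) * (f y \<bullet> f z) - (f y \<bullet> f y) * (f x \<bullet> f z)) *\<^sub>R f x
      + ((f x \<bullet> f y) * (f x \<bullet> f z) - (f x \<bullet> f x) * (f y \<bullet> f z)) *\<^sub>R f y
      + ((f x \<bullet> f x) * (f y \<bullet> f y) - (f x \<bullet> f y)\<^sup>2) *\<^sub>R f z = 0"
      by (simp add: cross_inner_def add_ac)
    from ind[OF this] dxy show False by (simp add: det2_def)
  qed
  then have "det2 (\<lambda>a b. f a \<bullet> f b) x y * det3 (\<lambda>a b. f a \<bullet> f b) x y z > 0"
    by (subst cross_inner_simps(4)[symmetric]) simp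
  then have "det3 (\<lambda>a b. f a \<bullet> f b) x y z > 0" using dxy by (simp add: zero_less_mult_iff)
  moreover have "det2 (\<lambda>a b. f a \<bullet> f b) y z > 0"
    by (rule d2) (use nz ind[of 0] in auto)
  moreover have "det2 (\<lambda>a b. f a \<bullet> f b) x z > 0"
    by (rule d2) (use nz ind[of _ 0] in auto)
  ultimately show ?thesis using nz dxy by (simp add: posdef3_def)
qed

definition indep4 :: "'b::real_vector \<Rightarrow> 'b \<Rightarrow> 'b \<Rightarrow> 'b \<Rightarrow> bool" where
  "indep4 t u v w \<longleftrightarrow> (\<forall>a b c d. a *\<^sub>R t + b *\<^sub>R u + c *\<^sub>R v + d *\<^sub>R w = 0 \<longrightarrow> a = 0 \<and> b = 0 \<and> c = 0 \<and> d = 0)"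

text \<open>Spanning is phrased as triviality of the orthogonal complement, since it serves to prove
  vectors equal by comparing their inner products with four given ones.\<close>

definition spanning4 :: "'b::real_inner \<Rightarrow> 'b \<Rightarrow> 'b \<Rightarrow> 'b \<Rightarrow> bool" where
  "spanning4 t u v w \<longleftrightarrow> (\<forall>n. n \<bullet> t = 0 \<and> n \<bullet> u = 0 \<and> n \<bullet> v = 0 \<and> n \<bullet> w = 0 \<longrightarrow> n = 0)"

lemma spanning4D:
  "spanning4 t u v w \<Longrightarrow> n \<bullet> t = 0 \<Longrightarrow> n \<bullet> u = 0 \<Longrightarrow> n \<bullet> v = 0 \<Longrightarrow> n \<bullet> w = 0 \<Longrightarrow> n = 0"
  by (simp add: spanning4_def)

lemma indep3_orth:
  assumes "indep4 z u v w"
  shows "indep3 (orth z u) (orth z v) (orth z w)"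
  unfolding indep3_def
proof (intro allI impI)
  fix a b c assume *: "a *\<^sub>R orth z u + b *\<^sub>R orth z v + c *\<^sub>R orth z w = 0"
  have "(- (a * (u \<bullet> z / (z \<bullet> z)) + b * (v \<bullet> z / (z \<bullet> z)) + c * (w \<bullet> z / (z \<bullet> z)))) *\<^sub>R z
    + a *\<^sub>R u + b *\<^sub>R v + c *\<^sub>R w = a *\<^sub>R orth z u + b *\<^sub>R orth z v + c *\<^sub>R orth z w"
    by (simp only: orth_def scaleR_add_left scaleR_minus_left scaleR_diff_right scaleR_scaleR) simp
  then have **: "(- (a * (u \<bullet> z / (z \<bullet> z)) + b * (v \<bullet> z / (z \<bullet> z)) + c * (w \<bullet> z / (z \<bullet> z)))) *\<^sub>R z + a *\<^sub>R u + b *\<^sub>R v + c *\<^sub>R w = 0" using * by (rule trans)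
  from assms[unfolded indep4_def, rule_format, OF **] show "a = 0 \<and> b = 0 \<and> c = 0" by simp
qed

text \<open>Both \<open>n\<close> and \<open>cross_inner (f x) (f y) (f z)\<close> are orthogonal to
  \<open>e\<close>, \<open>f x\<close> and \<open>f y\<close>, so they are proportional. The value
  is the height of \<open>f z\<close> over the plane of \<open>f x\<close> and \<open>f y\<close>:
  volume divided by base area.\<close>

lemma unit_normal_inner:
  fixes f :: "'i \<Rightarrow> 'b::real_inner"
  assumes ind: "indep3 (f x) (f y) (f z)"
    and sp: "spanning4 e (f x) (f y) (f z)" and e: "f x \<bullet> e = 0" "f y \<bullet> e = 0" "f z \<bullet> e = 0"
    and n: "norm n = 1" "n \<bullet> e = 0" "n \<bullet> f x = 0" "n \<bullet> f y = 0" "n \<bullet> f z > 0"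
  shows "n \<bullet> f z = sqrt (det3 (\<lambda>a b. f a \<bullet> f b) x y z) / sqrt (det2 (\<lambda>a b. f a \<bullet> f b) x y)"
proof -
  let ?k = "\<lambda>a b. f a \<bullet> f b"
  let ?w = "cross_inner (f x) (f y) (f z)"
  have pd: "det2 ?k x y > 0" "det3 ?k x y z > 0"
    using posdef3_inner[of f x y z] ind by (auto simp: posdef3_def)
  have we: "?w \<bullet> e = 0" by (simp add: cross_inner_def inner_add_left e)
  have "det3 ?k x y z *\<^sub>R n - (n \<bullet> f z) *\<^sub>R ?w = 0"
    by (rule spanning4D[OF sp]) (simp_all add: inner_diff_left cross_inner_simps n we)
  then have "norm (det3 ?k x y z *\<^sub>R n) = norm ((n \<bullet> f z) *\<^sub>R ?w)" by simp
  then have "det3 ?k x y z = (n \<bullet> f z) * norm ?w"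
    using n pd by simp
  moreover have "norm ?w = sqrt (det2 ?k x y) * sqrt (det3 ?k x y z)"
    by (simp add: norm_eq_sqrt_inner cross_inner_simps(4) real_sqrt_mult)
  moreover have "det3 ?k x y z = sqrt (det3 ?k x y z) * sqrt (det3 ?k x y z)" using pd by simp
  ultimately have "sqrt (det3 ?k x y z) * sqrt (det3 ?k x y z) = ((n \<bullet> f z) * sqrt (det2 ?k x y)) * sqrt (det3 ?k x y z)" by (metis mult.assoc)
  moreover have "sqrt (det3 ?k x y z) \<noteq> 0" using pd by simp
  ultimately have "sqrt (det3 ?k x y z) = (n \<bullet> f z) * sqrt (det2 ?k x y)" by (metis mult_right_cancel)
  then show ?thesis using pd by (simp add: eq_divide_eq)
qed

text \<open>Both sides are orthogonal to \<open>e\<close>, so it is enough to compare inner products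
  with \<open>f x\<close>, \<open>f y\<close>, \<open>f z\<close>. Against \<open>f x\<close> only
  the term with \<open>nx\<close> survives on the right, with a factor that
  \<open>unit_normal_inner\<close> identifies as norm times sine of the altitude; this is
  \<open>spherical_derivative_step\<close>.\<close>

lemma spherical_derivative:
  fixes k :: "real \<Rightarrow> 'i \<Rightarrow> 'i \<Rightarrow> real" and f :: "'i \<Rightarrow> 'b::real_inner"
  assumes sym: "\<And>t a b. k t a b = k t b a"
    and diff: "\<And>a b. (\<lambda>t. k t a b) field_differentiable at l"
    and kl: "k l = (\<lambda>a b. f a \<bullet> f b)"
    and ind: "indep3 (f x) (f y) (f z)"
    and sp: "spanning4 e (f x) (f y) (f z)" and e: "f x \<bullet> e = 0" "f y \<bullet> e = 0" "f z \<bullet> e = 0"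
    and nx: "norm nx = 1" "nx \<bullet> e = 0" "nx \<bullet> f y = 0" "nx \<bullet> f z = 0" "nx \<bullet> f x > 0"
    and ny: "norm ny = 1" "ny \<bullet> e = 0" "ny \<bullet> f x = 0" "ny \<bullet> f z = 0" "ny \<bullet> f y > 0"
    and nz: "norm nz = 1" "nz \<bullet> e = 0" "nz \<bullet> f x = 0" "nz \<bullet> f y = 0" "nz \<bullet> f z > 0"
  shows "deriv (\<lambda>t. gram_angle (schur x (k t)) y z) l *\<^sub>R sgn (f x)
       + deriv (\<lambda>t. gram_angle (schur y (k t)) x z) l *\<^sub>R sgn (f y)
       + deriv (\<lambda>t. gram_angle (schur z (k t)) x y) l *\<^sub>R sgn (f z)
     = deriv (\<lambda>t. gram_angle (k t) y z) l *\<^sub>R nx + deriv (\<lambda>t. gram_angle (k t) x z) l *\<^sub>R ny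
       + deriv (\<lambda>t. gram_angle (k t) x y) l *\<^sub>R nz" (is "?L = ?R")
proof -
  have pd: "posdef3 (k l) x y z" unfolding kl by (rule posdef3_inner[where f=f, OF ind])
  note p = posdef3_permute[OF sym pd]
  have swap: "(\<lambda>t. gram_angle (schur a (k t)) b c) = (\<lambda>t. gram_angle (schur a (k t)) c b)"
    "(\<lambda>t. gram_angle (k t) b c) = (\<lambda>t. gram_angle (k t) c b)" for a b c
    by (auto intro!: ext gram_angle_commute sym simp: schur_def sym mult.commute)
  have step: "(deriv (\<lambda>t. gram_angle (schur a (k t)) b c) l *\<^sub>R sgn (f a)
     + deriv (\<lambda>t. gram_angle (schur b (k t)) a c) l *\<^sub>R sgn (f b)
     + deriv (\<lambda>t. gram_angle (schur c (k t)) a b) l *\<^sub>R sgn (f c)) \<bullet> f a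
     = (deriv (\<lambda>t. gram_angle (k t) b c) l *\<^sub>R n) \<bullet> f a"
    if pda: "posdef3 (k l) a b c" and ind: "indep3 (f b) (f c) (f a)"
      and sp: "spanning4 e (f b) (f c) (f a)" and e: "f a \<bullet> e = 0" "f b \<bullet> e = 0" "f c \<bullet> e = 0"
      and n: "norm n = 1" "n \<bullet> e = 0" "n \<bullet> f b = 0" "n \<bullet> f c = 0" "n \<bullet> f a > 0" for a b c n
  proof -
    note q = posdef3_permute[OF sym pda]
    have pos: "norm (f a) > 0" using pda by (simp add: posdef3_def kl)
    have sq: "sqrt (k l u u) = norm (f u)" for u by (simp add: kl norm_eq_sqrt_inner)
    have c: "cos (gram_angle (k l) a b) = (f b \<bullet> f a) / (norm (f a) * norm (f b))"
      "cos (gram_angle (k l) a c) = (f c \<bullet> f a) / (norm (f a) * norm (f c))"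
      using side_cos_sin(1)[OF sym q(2)] side_cos_sin(1)[OF sym q(3)]
      by (simp_all only: sq) (simp_all only: kl inner_commute)
    have n': "sqrt (det3 (k l) a b c) / sqrt (det2 (k l) b c) = n \<bullet> f a"
    proof -
      have "det3 (k l) b c a = det3 (k l) a b c"
        by (simp add: det3_def sym[of l b a] sym[of l c a])
      then show ?thesis
        using unit_normal_inner[where f=f and x=b and y=c and z=a, OF ind sp e(2,3,1) n, folded kl] by simp
    qed
    have s: "sgn (f u) \<bullet> v = (f u \<bullet> v) / norm (f u)" for u v
      by (simp add: sgn_div_norm divide_inverse mult.commute)
    define d1 d2 d3 e1 where de: "d1 = deriv (\<lambda>t. gram_angle (schur a (k t)) b c) l"
      "d2 = deriv (\<lambda>t. gram_angle (schur b (k t)) a c) l" "d3 = deriv (\<lambda>t. gram_angle (schur c (k t)) a b) l"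
      "e1 = deriv (\<lambda>t. gram_angle (k t) b c) l"
    have eq: "d1 + (f b \<bullet> f a) / (norm (f a) * norm (f b)) * d2 + (f c \<bullet> f a) / (norm (f a) * norm (f c)) * d3
       = (n \<bullet> f a) / norm (f a) * e1"
      using spherical_derivative_step[of k l a b c, OF sym diff pda]
      unfolding c sq de[symmetric] n'[symmetric] by (simp only: divide_divide_eq_left mult.commute)
    have "(d1 *\<^sub>R sgn (f a) + d2 *\<^sub>R sgn (f b) + d3 *\<^sub>R sgn (f c)) \<bullet> f a
      = norm (f a) * (d1 + (f b \<bullet> f a) / (norm (f a) * norm (f b)) * d2 + (f c \<bullet> f a) / (norm (f a) * norm (f c)) * d3)"
      using pos by (simp add: inner_add_left s distrib_left power2_norm_eq_inner[symmetric] power2_eq_square mult.commute)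
    also have "\<dots> = e1 * (n \<bullet> f a)" unfolding eq using pos by simp
    finally show ?thesis unfolding de by simp
  qed
  have i: "indep3 (f y) (f z) (f x)" "indep3 (f x) (f z) (f y)"
    using indep3_permute[OF ind] by auto
  have sps: "spanning4 e (f y) (f z) (f x)" "spanning4 e (f x) (f z) (f y)"
    using sp by (auto simp: spanning4_def)
  have "?L - ?R = 0"
  proof (rule spanning4D[OF sp])
    have "sgn (f u) \<bullet> e = 0" if "f u \<bullet> e = 0" for u
      using that by (simp add: sgn_div_norm)
    then show "(?L - ?R) \<bullet> e = 0"
      by (simp add: inner_diff_left inner_add_left nx ny nz e)
    show "(?L - ?R) \<bullet> f x = 0"
      unfolding inner_diff_left step[OF pd i(1) sps(1) e nx] by (simp add: inner_add_left ny nz)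
    \<comment> \<open>\<open>step\<close> expects the tested vector in first position, hence the
      reordering here and below; \<open>swap\<close> adapts the order of the two indices in an
      angle.\<close>
    have "?L = deriv (\<lambda>t. gram_angle (schur y (k t)) x z) l *\<^sub>R sgn (f y) + deriv (\<lambda>t. gram_angle (schur x (k t)) y z) l *\<^sub>R sgn (f x)
       + deriv (\<lambda>t. gram_angle (schur z (k t)) y x) l *\<^sub>R sgn (f z)"
      by (subst swap(1)[of z y x]) (simp add: add_ac)
    then show "(?L - ?R) \<bullet> f y = 0"
      using step[OF p(3) i(2) sps(2) e(2,1,3) ny] by (simp only: inner_diff_left) (simp add: inner_add_left nx nz)
    have "?L = deriv (\<lambda>t. gram_angle (schur z (k t)) x y) l *\<^sub>R sgn (f z) + deriv (\<lambda>t. gram_angle (schur x (k t)) z y) l *\<^sub>R sgn (f x)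
       + deriv (\<lambda>t. gram_angle (schur y (k t)) z x) l *\<^sub>R sgn (f y)"
      by (subst swap(1)[of x z y], subst swap(1)[of y z x]) (simp add: add_ac)
    then show "(?L - ?R) \<bullet> f z = 0"
      using step[OF p(2) ind sp e(3,1,2) nz] by (simp only: inner_diff_left) (simp add: inner_add_left nx ny)
  qed
  then show ?thesis by simp
qed

subsection \<open>Changing one edge length of a simplex\<close>

lemma orth_eq_0_imp: "orth z u = 0 \<Longrightarrow> \<exists>a. u = a *\<^sub>R z"
  by (auto simp: orth_def)

text \<open>The point \<open>w'\<close> is obtained by rotating \<open>w\<close> about the plane through \<open>x\<close>, \<open>y\<close>, \<open>z\<close>.\<close>

lemma realize_one_length:
  fixes x y z u w :: "'b::real_inner"
  assumes ind: "indep4 (y - x) (z - x) (u - x) (w - x)"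
  shows "\<forall>\<^sub>F l in nhds ((dist u w)\<^sup>2). \<exists>w'. dist w' x = dist w x \<and> dist w' y = dist w y \<and> dist w' z = dist w z \<and> (dist u w')\<^sup>2 = l"
proof -
  \<comment> \<open>Two Gram-Schmidt steps: the projection to the orthogonal complement of
    \<open>y - x\<close> and \<open>z - x\<close>.\<close>
  define pr where "pr t = orth (orth (y - x) (z - x)) (orth (y - x) t)" for t
  have Oy: "pr t \<bullet> (y - x) = 0" for t
  proof -
    have "pr t \<bullet> (y - x) = orth (y - x) t \<bullet> (y - x) - (orth (y - x) t \<bullet> orth (y - x) (z - x) / (orth (y - x) (z - x) \<bullet> orth (y - x) (z - x))) * (orth (y - x) (z - x) \<bullet> (y - x))"
      unfolding pr_def by (subst orth_def[of "orth (y - x) (z - x)"]) (simp only: inner_diff_left inner_scaleR_left)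
    then show ?thesis by simp
  qed
  have "z - x = orth (y - x) (z - x) + ((z - x) \<bullet> (y - x) / ((y - x) \<bullet> (y - x))) *\<^sub>R (y - x)"
    by (simp add: orth_def)
  moreover have "pr t \<bullet> orth (y - x) (z - x) = 0" for t by (simp add: pr_def)
  ultimately have Oz: "pr t \<bullet> (z - x) = 0" for t
    by (metis Oy add.right_neutral inner_add_right inner_scaleR_right mult_zero_right)
  have dec: "\<exists>a b. t = pr t + a *\<^sub>R (y - x) + b *\<^sub>R (z - x)" for t
  proof -
    have ex: "\<exists>c. v = orth q v + c *\<^sub>R q" for q v :: 'b
      by (rule exI[of _ "v \<bullet> q / (q \<bullet> q)"]) (simp add: orth_def)
    obtain b where b: "orth (y - x) t = pr t + b *\<^sub>R orth (y - x) (z - x)"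
      using ex unfolding pr_def by blast
    obtain a where a: "t = orth (y - x) t + a *\<^sub>R (y - x)"
      using ex by blast
    obtain c where "z - x = orth (y - x) (z - x) + c *\<^sub>R (y - x)"
      using ex by blast
    then have c: "orth (y - x) (z - x) = (z - x) - c *\<^sub>R (y - x)" by (simp add: algebra_simps)
    have "t = pr t + (a - b * c) *\<^sub>R (y - x) + b *\<^sub>R (z - x)"
      by (subst a, subst b, subst c) (simp add: algebra_simps)
    then show ?thesis by blast
  qed
  define pu where "pu = pr (u - x)"
  define pw where "pw = pr (w - x)"
  define r where "r = orth pu pw"
  obtain au bu where u: "u - x = pu + au *\<^sub>R (y - x) + bu *\<^sub>R (z - x)" using dec unfolding pu_def by blast
  obtain aw bw where w: "w - x = pw + aw *\<^sub>R (y - x) + bw *\<^sub>R (z - x)" using dec unfolding pw_def by blast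
  have pu0: "pu \<noteq> 0"
  proof
    assume "pu = 0"
    then have "(- au) *\<^sub>R (y - x) + (- bu) *\<^sub>R (z - x) + 1 *\<^sub>R (u - x) + 0 *\<^sub>R (w - x) = 0"
      by (subst u) simp
    from ind[unfolded indep4_def, rule_format, OF this] show False by simp
  qed
  have r0: "r \<noteq> 0"
  proof
    assume "r = 0"
    then obtain c where c: "pw = c *\<^sub>R pu" using orth_eq_0_imp unfolding r_def by blast
    have "(c * au - aw) *\<^sub>R (y - x) + (c * bu - bw) *\<^sub>R (z - x) + (- c) *\<^sub>R (u - x) + 1 *\<^sub>R (w - x) = 0"
      by (subst u, subst w, subst c) (simp add: algebra_simps)
    from ind[unfolded indep4_def, rule_format, OF this] show False by simp
  qed
  define P where "P = pu \<bullet> pu"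
  define R where "R = r \<bullet> r"
  define c0 where "c0 = pw \<bullet> pu / (pu \<bullet> pu)"
  have PR: "P > 0" "R > 0" using pu0 r0 by (auto simp: P_def R_def)
  have pw_eq: "pw = c0 *\<^sub>R pu + 1 *\<^sub>R r" by (simp add: r_def orth_def c0_def)
  have rpu: "r \<bullet> pu = 0" by (simp add: r_def)
  have puF: "pu \<bullet> (y - x) = 0" "pu \<bullet> (z - x) = 0" by (simp_all add: pu_def Oy Oz)
  have pwF: "pw \<bullet> (y - x) = 0" "pw \<bullet> (z - x) = 0" by (simp_all add: pw_def Oy Oz)
  have rF: "r \<bullet> (y - x) = 0" "r \<bullet> (z - x) = 0"
    using pwF puF by (simp_all add: pw_eq inner_add_left)
  \<comment> \<open>The projection \<open>pw\<close> of \<open>w - x\<close> equals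
    \<open>c0 *\<^sub>R pu + r\<close> with \<open>r\<close> orthogonal to \<open>pu\<close>;
    \<open>W\<close> replaces these two coordinates by \<open>c\<close> and
    \<open>e\<close>.\<close>
  define W where "W c e = w - pw + c *\<^sub>R pu + e *\<^sub>R r" for c e
  have pyth: "(norm (v + c *\<^sub>R pu + e *\<^sub>R r))\<^sup>2 = (norm v)\<^sup>2 + c\<^sup>2 * P + e\<^sup>2 * R"
    if "v \<bullet> pu = 0" "v \<bullet> r = 0" for v c e
  proof -
    have "pu \<bullet> v = 0" "r \<bullet> v = 0" "pu \<bullet> r = 0" using that rpu by (simp_all add: inner_commute)
    then show ?thesis
      unfolding power2_norm_eq_inner using that rpu by (simp add: P_def R_def inner_add_left inner_add_right power2_eq_square)
  qed
  have wx: "w - pw = x + aw *\<^sub>R (y - x) + bw *\<^sub>R (z - x)" using w by (simp add: algebra_simps)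
  have ux: "u = x + pu + au *\<^sub>R (y - x) + bu *\<^sub>R (z - x)" using u by (simp add: algebra_simps)
  have d_f: "(dist (W c e) g)\<^sup>2 = (norm (w - pw - g))\<^sup>2 + c\<^sup>2 * P + e\<^sup>2 * R"
    if g: "g = x + a *\<^sub>R (y - x) + b *\<^sub>R (z - x)" for g a b c e
  proof -
    have eq: "w - pw - g = (aw - a) *\<^sub>R (y - x) + (bw - b) *\<^sub>R (z - x)"
      unfolding wx g by (simp add: algebra_simps)
    have "(w - pw - g) \<bullet> pu = 0" "(w - pw - g) \<bullet> r = 0"
      unfolding eq inner_add_left inner_scaleR_left inner_commute[of "y - x"] inner_commute[of "z - x"] puF rF by simp_all
    from pyth[OF this, of c e] show ?thesis by (simp add: dist_norm W_def algebra_simps)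
  qed
  have d_u: "(dist (W c e) u)\<^sup>2 = (norm (w - pw - (u - pu)))\<^sup>2 + (c - 1)\<^sup>2 * P + e\<^sup>2 * R" for c e
  proof -
    have eq: "w - pw - (u - pu) = (aw - au) *\<^sub>R (y - x) + (bw - bu) *\<^sub>R (z - x)"
      unfolding wx by (subst ux) (simp add: algebra_simps)
    have "(w - pw - (u - pu)) \<bullet> pu = 0" "(w - pw - (u - pu)) \<bullet> r = 0"
      unfolding eq inner_add_left inner_scaleR_left inner_commute[of "y - x"] inner_commute[of "z - x"] puF rF by simp_all
    from pyth[OF this, of "c - 1" e] show ?thesis by (simp add: dist_norm W_def algebra_simps)
  qed
  have W0: "W c0 1 = w" using pw_eq by (simp add: W_def)
  define \<rho> where "\<rho> = c0\<^sup>2 * P + R"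
  define l0 where "l0 = (dist u w)\<^sup>2"
  \<comment> \<open>Distances to \<open>x\<close>, \<open>y\<close>, \<open>z\<close> are kept if
    \<open>c\<^sup>2 * P + e\<^sup>2 * R\<close> retains its value \<open>\<rho>\<close>. Under this
    constraint the squared distance to \<open>u\<close> is \<open>l0 + 2 * P * (c0 - c)\<close>, and
    equating it with \<open>l\<close> gives \<open>c\<close>. The constraint is then solvable for
    \<open>e\<close> as long as \<open>c\<^sup>2 * P\<close> stays below
    \<open>\<rho>\<close>.\<close>
  define c where "c l = c0 - (l - l0) / (2 * P)" for l
  have "((\<lambda>l. \<rho> - (c l)\<^sup>2 * P) \<longlongrightarrow> \<rho> - (c l0)\<^sup>2 * P) (nhds l0)"
    unfolding c_def by (intro tendsto_intros filterlim_ident) (use PR in auto)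
  moreover have "\<rho> - (c l0)\<^sup>2 * P > 0" using PR by (simp add: c_def \<rho>_def)
  ultimately have "\<forall>\<^sub>F l in nhds l0. \<rho> - (c l)\<^sup>2 * P > 0" by (rule order_tendstoD)
  then show ?thesis unfolding l0_def[symmetric]
  proof eventually_elim
    case (elim l)
    define e where "e = sqrt ((\<rho> - (c l)\<^sup>2 * P) / R)"
    have e2: "e\<^sup>2 * R = \<rho> - (c l)\<^sup>2 * P" using elim PR by (simp add: e_def)
    have "(dist (W (c l) e) g)\<^sup>2 = (dist w g)\<^sup>2" if "g = x + a *\<^sub>R (y - x) + b *\<^sub>R (z - x)" for g a b
      using d_f[OF that, of "c l" e] d_f[OF that, of c0 1] e2 W0 by (simp add: \<rho>_def)
    then have deq: "dist (W (c l) e) g = dist w g" if "g = x + a *\<^sub>R (y - x) + b *\<^sub>R (z - x)" for g a b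
      using that by (metis power2_eq_imp_eq zero_le_dist)
    have "dist (W (c l) e) x = dist w x" by (rule deq[of _ 0 0]) simp
    moreover have "dist (W (c l) e) y = dist w y" by (rule deq[of _ 1 0]) simp
    moreover have "dist (W (c l) e) z = dist w z" by (rule deq[of _ 0 1]) simp
    moreover have "(dist (W (c l) e) u)\<^sup>2 - l0 = ((c l - 1)\<^sup>2 - (c0 - 1)\<^sup>2) * P + (e\<^sup>2 - 1) * R"
      using d_u[of "c l" e] d_u[of c0 1] W0 by (simp add: l0_def dist_commute algebra_simps)
    then have "(dist (W (c l) e) u)\<^sup>2 = l0 + 2 * P * (c0 - c l)"
      using e2 by (simp add: \<rho>_def power2_eq_square algebra_simps)
    then have "(dist u (W (c l) e))\<^sup>2 = l" using PR by (simp add: c_def dist_commute)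
    ultimately show ?case by blast
  qed
qed

subsection \<open>Area differentials\<close>

lemma norm_orth:
  assumes "z \<noteq> 0"
  shows "norm (orth z u) = sqrt ((u \<bullet> u) * (z \<bullet> z) - (u \<bullet> z)\<^sup>2) / norm z"
proof -
  have "orth z u \<bullet> orth z u = ((u \<bullet> u) * (z \<bullet> z) - (u \<bullet> z)\<^sup>2) / (z \<bullet> z)"
    using assms by (simp add: orth_inner_orth diff_divide_distrib power2_eq_square)
  then show ?thesis by (simp add: norm_eq_sqrt_inner real_sqrt_divide)
qed

text \<open>
  The vector \<open>sgn (orth (C - B) (A - B))\<close> is the unit normal of the edge \<open>BC\<close> pointing into the triangle,
  hence the minus sign in the area differential.
\<close>

definition edge_term :: "'b::real_inner \<Rightarrow> 'b \<Rightarrow> 'b \<Rightarrow> 'b \<Rightarrow> real" where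
  "edge_term A B C d = dist B C * (sgn (orth (C - B) (A - B)) \<bullet> d)"

lemma edge_term_eq:
  assumes "B \<noteq> C" "d \<bullet> (C - B) = 0"
  shows "edge_term A B C d = ((C - B) \<bullet> (C - B)) * ((A - B) \<bullet> d)
     / sqrt (((A - B) \<bullet> (A - B)) * ((C - B) \<bullet> (C - B)) - ((A - B) \<bullet> (C - B))\<^sup>2)"
proof -
  have "orth (C - B) (A - B) \<bullet> d = (A - B) \<bullet> d"
    using assms(2) by (simp add: orth_def inner_diff_left[of _ "_ *\<^sub>R _"] inner_commute[of "C - B" d])
  moreover have "dist B C = norm (C - B)" by (simp add: dist_norm norm_minus_commute)
  moreover have "(C - B) \<bullet> (C - B) = norm (C - B) * norm (C - B)"
    by (simp add: power2_norm_eq_inner[symmetric] power2_eq_square)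
  ultimately show ?thesis
    using assms(1) norm_orth[of "C - B" "A - B"] unfolding edge_term_def sgn_div_norm
    by (simp add: divide_inverse mult_ac)
qed

text \<open>The triangle of midpoints has a side parallel to \<open>BC\<close> of half its length,
  and the opposite vertex is the midpoint of \<open>BC\<close>. Moving that vertex towards
  \<open>A\<close> lowers the height, so the area falls at the rate \<open>dist B C / 4\<close> per
  unit; the factor 4 turns this into \<open>- edge_term\<close>.\<close>

lemma area_derivative:
  fixes A B C :: "'b::real_inner"
  assumes G: "((B - A) \<bullet> (B - A)) * ((C - A) \<bullet> (C - A)) - ((B - A) \<bullet> (C - A))\<^sup>2 > 0"
    and d: "dx \<bullet> (C - B) = 0" "dy \<bullet> (A - C) = 0" "dz \<bullet> (B - A) = 0"
  shows "frechet_derivative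
     (\<lambda>(x, y, z). 4 * triangle_area (midpoint B C + x) (midpoint C A + y) (midpoint A B + z)
         - triangle_area A B C) (at 0) (dx, dy, dz)
     = - (edge_term A B C dx + edge_term B C A dy + edge_term C A B dz)"
proof -
  \<comment> \<open>The side vectors of the midpoint triangle that start at the midpoint of
    \<open>BC\<close>; below, \<open>u\<close> and \<open>v\<close> are these sides after the
    deviations, and \<open>g\<close> is their Gram determinant, four times the squared area.\<close>
  define a b where ab: "a = (1/2) *\<^sub>R (A - B)" "b = (1/2) *\<^sub>R (A - C)"
  define G where "G = ((B - A) \<bullet> (B - A)) * ((C - A) \<bullet> (C - A)) - ((B - A) \<bullet> (C - A))\<^sup>2"
  have Gpos: "G > 0" using G by (simp add: G_def)
  have ne: "B \<noteq> C" "C \<noteq> A" "A \<noteq> B" using G by (auto simp: power2_eq_square)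
  define u v where uv: "u p = a + (fst (snd p) - fst p)" "v p = b + (snd (snd p) - fst p)" for p :: "'b \<times> 'b \<times> 'b"
  define g where "g p = (u p \<bullet> u p) * (v p \<bullet> v p) - (u p \<bullet> v p)\<^sup>2" for p
  have g0: "g 0 = G / 16"
    by (simp add: g_def uv ab G_def inner_diff_left inner_diff_right inner_commute power2_eq_square algebra_simps)
  have m: "midpoint C A + y - (midpoint B C + x) = a + (y - x)" "midpoint A B + z - (midpoint B C + x) = b + (z - x)" for x y z
    by (simp_all add: midpoint_def ab algebra_simps)
  have area: "triangle_area (midpoint B C + x) (midpoint C A + y) (midpoint A B + z) = sqrt (g (x, y, z)) / 2" for x y z
    unfolding triangle_area_def m g_def uv power2_norm_eq_inner by simp
  define du dv where duv: "du p = fst (snd p) - fst p" "dv p = snd (snd p) - fst p" for p :: "'b \<times> 'b \<times> 'b"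
  have hu: "(u has_derivative du) (at 0)" and hv: "(v has_derivative dv) (at 0)"
    unfolding uv duv by (auto intro!: derivative_eq_intros)
  have u0: "u 0 = a" "v 0 = b" by (simp_all add: uv)
  have hg: "(g has_derivative (\<lambda>h. 2 * (a \<bullet> du h) * (b \<bullet> b) + (a \<bullet> a) * (2 * (b \<bullet> dv h))
      - 2 * (a \<bullet> b) * (a \<bullet> dv h + b \<bullet> du h))) (at 0)"
    unfolding g_def power2_eq_square
    by (rule derivative_eq_intros hu hv refl)+ (simp add: u0 inner_commute algebra_simps)
  have "((\<lambda>p. 4 * (sqrt (g p) / 2) - triangle_area A B C) has_derivative
     (\<lambda>h. (2 * (a \<bullet> du h) * (b \<bullet> b) + (a \<bullet> a) * (2 * (b \<bullet> dv h)) - 2 * (a \<bullet> b) * (a \<bullet> dv h + b \<bullet> du h)) / sqrt (g 0))) (at 0)"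
    using Gpos by (auto intro!: derivative_eq_intros hg simp: g0 inverse_eq_divide field_simps)
  moreover have "(\<lambda>(x, y, z). 4 * triangle_area (midpoint B C + x) (midpoint C A + y) (midpoint A B + z) - triangle_area A B C)
     = (\<lambda>p. 4 * (sqrt (g p) / 2) - triangle_area A B C)"
    by (auto simp: area)
  ultimately have fd: "frechet_derivative
     (\<lambda>(x, y, z). 4 * triangle_area (midpoint B C + x) (midpoint C A + y) (midpoint A B + z)
         - triangle_area A B C) (at 0) (dx, dy, dz) =
     (2 * (a \<bullet> du (dx,dy,dz)) * (b \<bullet> b) + (a \<bullet> a) * (2 * (b \<bullet> dv (dx,dy,dz))) - 2 * (a \<bullet> b) * (a \<bullet> dv (dx,dy,dz) + b \<bullet> du (dx,dy,dz))) / sqrt (g 0)"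
    by (simp add: frechet_derivative_at[symmetric])
  have sg: "sqrt (g 0) = sqrt G / 4"
  proof -
    have "sqrt 16 = (4::real)" by (rule real_sqrt_unique) auto
    then show ?thesis unfolding g0 real_sqrt_divide by simp
  qed
  have sG: "((A - B) \<bullet> (A - B)) * ((C - B) \<bullet> (C - B)) - ((A - B) \<bullet> (C - B))\<^sup>2 = G"
      "((B - C) \<bullet> (B - C)) * ((A - C) \<bullet> (A - C)) - ((B - C) \<bullet> (A - C))\<^sup>2 = G"
      "((C - A) \<bullet> (C - A)) * ((B - A) \<bullet> (B - A)) - ((C - A) \<bullet> (B - A))\<^sup>2 = G"
    unfolding G_def by (simp_all add: inner_diff_left inner_diff_right inner_commute power2_eq_square algebra_simps)
  have et: "edge_term A B C dx = ((C - B) \<bullet> (C - B)) * ((A - B) \<bullet> dx) / sqrt G"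
    "edge_term B C A dy = ((A - C) \<bullet> (A - C)) * ((B - C) \<bullet> dy) / sqrt G"
    "edge_term C A B dz = ((B - A) \<bullet> (B - A)) * ((C - A) \<bullet> dz) / sqrt G"
    using edge_term_eq[OF ne(1) d(1), of A] edge_term_eq[OF ne(2) d(2), of B] edge_term_eq[OF ne(3) d(3), of C]
    unfolding sG by simp_all
  have dxyz: "C \<bullet> dx = B \<bullet> dx" "A \<bullet> dy = C \<bullet> dy" "B \<bullet> dz = A \<bullet> dz"
    using d by (simp_all add: inner_diff_right inner_commute)
  have bdx: "(A - B) \<bullet> dx = 2 * (a \<bullet> dx)" "b \<bullet> dx = a \<bullet> dx"
    by (simp_all add: ab inner_diff_left dxyz)
  have bdy: "(B - C) \<bullet> dy = - (2 * (a \<bullet> dy))" "b \<bullet> dy = 0"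
    by (simp_all add: ab inner_diff_left dxyz field_simps)
  have adz: "(C - A) \<bullet> dz = - (2 * (b \<bullet> dz))" "a \<bullet> dz = 0"
    by (simp_all add: ab inner_diff_left dxyz field_simps)
  have CB: "(C - B) \<bullet> (C - B) = 4 * (a \<bullet> a + b \<bullet> b - 2 * (a \<bullet> b))" "(A - C) \<bullet> (A - C) = 4 * (b \<bullet> b)" "(B - A) \<bullet> (B - A) = 4 * (a \<bullet> a)"
    by (simp_all add: ab inner_diff_left inner_diff_right inner_commute algebra_simps)
  have "2 * (a \<bullet> du (dx,dy,dz)) * (b \<bullet> b) + (a \<bullet> a) * (2 * (b \<bullet> dv (dx,dy,dz))) - 2 * (a \<bullet> b) * (a \<bullet> dv (dx,dy,dz) + b \<bullet> du (dx,dy,dz))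
     = - (1/4) * (((C - B) \<bullet> (C - B)) * ((A - B) \<bullet> dx) + ((A - C) \<bullet> (A - C)) * ((B - C) \<bullet> dy) + ((B - A) \<bullet> (B - A)) * ((C - A) \<bullet> dz))"
    unfolding CB bdx(1) bdy(1) adz(1) by (simp add: duv inner_diff_right bdx(2) bdy(2) adz(2) algebra_simps)
  then show ?thesis unfolding fd et sg by (simp add: add_divide_distrib diff_divide_distrib)
qed

subsection \<open>Lifts of simplices\<close>

text \<open>The lifting criterion for covering maps, on which the transitivity of the deck group
  rests, asks for local path connectedness. It is inherited from the cube, but since chart domains
  \<open>N\<close> are not open, one passes to the relatively open
  \<open>U \<inter> W\<close>.\<close>

lemma locally_path_connected_if_charts:
  fixes P :: "'a::euclidean_space set"
  assumes "closed_pl_4_manifold P"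
  shows "locally path_connected P"
proof (rule locallyI)
  fix W x assume W: "openin (top_of_set P) W" "x \<in> W"
  then have "x \<in> P" using openin_imp_subset by blast
  then obtain U N h k where U: "openin (top_of_set P) U" "x \<in> U" "U \<subseteq> N" "N \<subseteq> P"
    and h: "homeomorphism N (cbox 0 (1 :: real^4)) h k"
    using assms unfolding closed_pl_4_manifold_def by metis
  have "locally path_connected (cbox 0 (1 :: real^4))"
    by (simp add: convex_imp_locally_path_connected)
  then have "locally path_connected N"
    using homeomorphic_locally[of N "cbox 0 (1 :: real^4)" path_connected path_connected] h homeomorphic_path_connectedness
    unfolding homeomorphic_def by blast
  moreover have "openin (top_of_set N) (U \<inter> W)"
    using U W by (meson openin_Int openin_subset_trans inf.coboundedI1)
  ultimately have "locally path_connected (U \<inter> W)" by (rule locally_open_subset)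
  moreover have "x \<in> U \<inter> W" using U W by simp
  moreover have "openin (top_of_set (U \<inter> W)) (U \<inter> W)" by simp
  ultimately obtain A B where A: "openin (top_of_set (U \<inter> W)) A" "path_connected B" "x \<in> A" "A \<subseteq> B" "B \<subseteq> U \<inter> W"
    by (elim locallyE) blast+
  have "openin (top_of_set P) A"
    using A(1) U W by (meson openin_Int openin_trans)
  then show "\<exists>A B. openin (top_of_set P) A \<and> path_connected B \<and> x \<in> A \<and> A \<subseteq> B \<and> B \<subseteq> W"
    using A by blast
qed

context
  fixes E :: "'e::real_normed_vector set" and p :: "'e \<Rightarrow> 'a::euclidean_space" and M :: "'a set"
  assumes cov: "covering_space E p M"
begin

lemma cont_p: "continuous_on E p" and p_image: "p ` E = M"
  using cov by (simp_all add: covering_space_def)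

text \<open>As \<open>E\<close> is simply connected, \<open>p\<close> lifts through itself to a map
  taking \<open>e\<close> to \<open>e'\<close>, and to another one taking \<open>e'\<close> to
  \<open>e\<close>. Their compositions are lifts of \<open>p\<close> that fix a point, hence equal
  the identity by uniqueness of lifts.\<close>

lemma deck_group_transitive:
  assumes "simply_connected E" "locally path_connected M" "e \<in> E" "e' \<in> E" "p e = p e'"
  obtains g where "g \<in> carrier (deck_group E p)" "g e = e'"
proof -
  have lpc: "locally path_connected E"
    using assms covering_space_locally_path_connected_eq[OF cov] by simp
  have conn: "connected E"
    using assms simply_connected_imp_connected by blast
  have pE: "p \<in> E \<rightarrow> M" using p_image by auto
  obtain g where g: "continuous_on E g" "g \<in> E \<rightarrow> E" "g e = e'" "\<And>y. y \<in> E \<Longrightarrow> p (g y) = p y"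
    using covering_space_lift_strong[OF cov assms(4,3,1) lpc cont_p pE assms(5)] by blast
  obtain h where h: "continuous_on E h" "h \<in> E \<rightarrow> E" "h e' = e" "\<And>y. y \<in> E \<Longrightarrow> p (h y) = p y"
    using covering_space_lift_strong[OF cov assms(3,4,1) lpc cont_p pE assms(5)[symmetric]] by blast
  have inv: "b (a x) = x" if "x \<in> E" "continuous_on E a" "a \<in> E \<rightarrow> E" "\<And>y. y \<in> E \<Longrightarrow> p (a y) = p y"
     "continuous_on E b" "b \<in> E \<rightarrow> E" "\<And>y. y \<in> E \<Longrightarrow> p (b y) = p y" "b (a z) = z" "z \<in> E" for a b x z
  proof -
    have aE: "a ` E \<subseteq> E" using that(3) by blast
    have m1: "continuous_on E (b \<circ> a)"
      by (rule continuous_on_compose[OF that(2) continuous_on_subset[OF that(5) aE]])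
    have m2: "b \<circ> a \<in> E \<rightarrow> E" using that(3,6) by auto
    have m3: "p y = p ((b \<circ> a) y)" if "y \<in> E" for y
    proof -
      have "a y \<in> E" using aE that by blast
      then show ?thesis using \<open>\<And>y. y \<in> E \<Longrightarrow> p (b y) = p y\<close> \<open>\<And>y. y \<in> E \<Longrightarrow> p (a y) = p y\<close> that by simp
    qed
    have m4: "(b \<circ> a) z = id z" using that(8) by simp
    have "(b \<circ> a) x = id x"
      by (rule covering_space_lift_unique[OF cov m4 cont_p pE m1 m2 m3 continuous_on_id' _ _ conn that(9,1)]) simp_all
    then show ?thesis by simp
  qed
  have hg: "h (g x) = x" if "x \<in> E" for x
    using inv[OF that g(1,2,4) h(1,2,4), of e] g(3) h(3) assms(3) by simp
  have gh: "g (h x) = x" if "x \<in> E" for x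
    using inv[OF that h(1,2,4) g(1,2,4), of e'] g(3) h(3) assms(4) by simp
  \<comment> \<open>Elements of \<open>Bij E\<close> are extensional, so the lift must be made
    \<open>undefined\<close> outside \<open>E\<close>.\<close>
  let ?g = "restrict g E"
  have bij: "bij_betw g E E"
    using hg gh g(2) h(2) by (intro bij_betw_byWitness[where f'=h]) (simp_all add: image_subset_iff Pi_iff)
  have "homeomorphism E E ?g h"
  proof (rule homeomorphismI)
    show "continuous_on E ?g" by (rule continuous_on_eq[OF g(1)]) simp
    show "?g ` E \<subseteq> E" "h ` E \<subseteq> E" using g(2) h(2) by auto
    show "?g (h y) = y" if "y \<in> E" for y using gh[OF that] h(2) that by (simp add: Pi_iff)
  qed (use h hg in simp_all)
  moreover have "bij_betw ?g E E" using bij by (simp cong: bij_betw_cong)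
  ultimately have "?g \<in> carrier (deck_group E p)"
    using g unfolding deck_group_def Bij_def by auto
  then show ?thesis using that[of ?g] g(3) assms(3) by simp
qed

lemma deck_groupD:
  assumes "g \<in> carrier (deck_group E p)"
  shows "continuous_on E g" "g ` E = E" "\<And>x. x \<in> E \<Longrightarrow> p (g x) = p x" "inj_on g E"
  using assms unfolding deck_group_def by (auto simp: homeomorphism_def Bij_def bij_betw_def)

text \<open>A convex set is simply connected, so its inclusion lifts to a section
  \<open>\<sigma>\<close> through a given point of \<open>c\<close>. The image of
  \<open>\<sigma>\<close> is connected and thus inside the component \<open>c\<close>; uniqueness of
  lifts on the connected set \<open>c\<close> makes \<open>\<sigma>\<close> inverse to
  \<open>p\<close> there.\<close>

lemma lift_section:
  assumes s: "convex s" "s \<subseteq> M" and c: "c \<in> lifts E p s"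
  shows "inj_on p c" "p ` c = s" "continuous_on s (the_inv_into c p)"
proof -
  have cs: "c \<subseteq> E \<inter> p -` s" "connected c" "c \<noteq> {}"
    using c in_components_subset in_components_connected in_components_nonempty unfolding lifts_def by blast+
  then obtain e where e: "e \<in> c" by blast
  then have eE: "e \<in> E" "p e \<in> s" using cs by auto
  obtain \<sigma> where \<sigma>: "continuous_on s \<sigma>" "\<sigma> \<in> s \<rightarrow> E" "\<sigma> (p e) = e" "\<And>y. y \<in> s \<Longrightarrow> p (\<sigma> y) = y"
    using covering_space_lift_strong[OF cov eE(1,2) convex_imp_simply_connected[OF s(1)] convex_imp_locally_path_connected[OF s(1)] continuous_on_id]
     s(2) by (auto simp: Pi_iff)
  have "\<sigma> ` s \<subseteq> c"
  proof (rule components_maximal)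
    show "c \<in> components (E \<inter> p -` s)" using c by (simp add: lifts_def)
    show "connected (\<sigma> ` s)" using \<sigma>(1) s(1) by (intro connected_continuous_image convex_connected)
    show "\<sigma> ` s \<subseteq> E \<inter> p -` s" using \<sigma> by auto
    show "c \<inter> \<sigma> ` s \<noteq> {}" using e eE(2) \<sigma>(3) by (metis IntI empty_iff imageI)
  qed
  have contc: "continuous_on c p" using cont_p cs(1) by (auto intro: continuous_on_subset)
  have inv: "\<sigma> (p x) = x" if "x \<in> c" for x
  proof -
    have ps: "p ` c \<subseteq> s" using cs(1) by auto
    have m1: "continuous_on c (\<sigma> \<circ> p)"
      by (rule continuous_on_compose[OF contc continuous_on_subset[OF \<sigma>(1) ps]])
    have m2: "\<sigma> \<circ> p \<in> c \<rightarrow> E"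
    proof
      fix y assume "y \<in> c"
      then have "p y \<in> s" using ps by blast
      then show "(\<sigma> \<circ> p) y \<in> E" using funcset_mem[OF \<sigma>(2)] by simp
    qed
    have m3: "p y = p ((\<sigma> \<circ> p) y)" if "y \<in> c" for y
      using \<sigma>(4)[of "p y"] ps that by auto
    have m4: "(\<sigma> \<circ> p) e = id e" using \<sigma>(3) by simp
    have m5: "p \<in> c \<rightarrow> M" using ps s(2) by blast
    have m6: "id \<in> c \<rightarrow> E" using cs(1) by auto
    have "(\<sigma> \<circ> p) x = id x"
      by (rule covering_space_lift_unique[OF cov m4 contc m5 m1 m2 m3 continuous_on_id' m6 _ cs(2) e that]) simp_all
    then show ?thesis by simp
  qed
  show inj: "inj_on p c" by (rule inj_on_inverseI[of _ \<sigma>]) (rule inv)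
  show im: "p ` c = s" using cs(1) \<open>\<sigma> ` s \<subseteq> c\<close> \<sigma>(4) by force
  have "the_inv_into c p y = \<sigma> y" if "y \<in> s" for y
    using \<open>\<sigma> ` s \<subseteq> c\<close> \<sigma>(4) that by (intro the_inv_into_f_eq inj) auto
  then show "continuous_on s (the_inv_into c p)" using \<sigma>(1) by (simp cong: continuous_on_cong)
qed

lemma ex_lift:
  assumes "e \<in> E" "p e \<in> s"
  obtains c where "c \<in> lifts E p s" "e \<in> c"
proof (rule that)
  have e: "e \<in> E \<inter> p -` s" using assms by simp
  show "connected_component_set (E \<inter> p -` s) e \<in> lifts E p s" unfolding lifts_def components_def using e by blast
  show "e \<in> connected_component_set (E \<inter> p -` s) e" using e by simp
qed

lemma some_lift_in_lifts:
  assumes "s \<subseteq> M" "s \<noteq> {}"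
  shows "some_lift E p s \<in> lifts E p s"
proof -
  obtain u where "u \<in> s" using assms by blast
  then obtain e where "e \<in> E" "p e \<in> s" using assms p_image by blast
  then obtain c where "c \<in> lifts E p s" using ex_lift by metis
  then show ?thesis unfolding some_lift_def by (rule someI)
qed

lemma lifts_subset: "c \<in> lifts E p s \<Longrightarrow> c \<subseteq> E \<inter> p -` s"
  unfolding lifts_def by (rule in_components_subset)

lemma lifts_eq: "c \<in> lifts E p s \<Longrightarrow> c' \<in> lifts E p s \<Longrightarrow> e \<in> c \<Longrightarrow> e \<in> c' \<Longrightarrow> c = c'"
  unfolding lifts_def by (meson components_eq disjoint_iff)

text \<open>The inverse of \<open>p\<close> on \<open>c\<close> is continuous, so the part of
  \<open>c\<close> over \<open>t\<close> is connected. Maximality of components, applied over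
  \<open>t\<close> and over \<open>s\<close>, gives the two inclusions.\<close>

lemma lift_face:
  assumes s: "convex s" "s \<subseteq> M" and c: "c \<in> lifts E p s" and t: "t \<subseteq> s" "convex t" "t \<noteq> {}"
  shows "c \<inter> p -` t \<in> lifts E p t"
proof -
  note S = lift_section[OF s c]
  have im: "the_inv_into c p ` t = c \<inter> p -` t"
  proof
    show "the_inv_into c p ` t \<subseteq> c \<inter> p -` t"
      using t S by (auto simp: the_inv_into_into[OF S(1)] f_the_inv_into_f[OF S(1)] subset_iff)
    show "c \<inter> p -` t \<subseteq> the_inv_into c p ` t"
      using S(1) by (auto simp: image_iff intro!: bexI[of _ "p _"] the_inv_into_f_f[symmetric])
  qed
  then have con: "connected (c \<inter> p -` t)"
    using S(3) t by (metis connected_continuous_image continuous_on_subset convex_connected)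
  obtain e where e: "e \<in> c \<inter> p -` t" using im t(3) by blast
  then have eE: "e \<in> E" "p e \<in> t" using lifts_subset[OF c] by auto
  obtain d where d: "d \<in> lifts E p t" "e \<in> d" using ex_lift[OF eE] by blast
  have "c \<inter> p -` t \<subseteq> d"
    by (rule components_maximal[of d "E \<inter> p -` t"]) (use d con e lifts_subset[OF c] in \<open>auto simp: lifts_def\<close>)
  moreover have "d \<subseteq> c"
    by (rule components_maximal[of c "E \<inter> p -` s"])
      (use d c e t lifts_subset[OF d(1)] in_components_connected[of d "E \<inter> p -` t"] in \<open>auto simp: lifts_def\<close>)
  moreover have "d \<subseteq> p -` t" using lifts_subset[OF d(1)] by blast
  ultimately have "d = c \<inter> p -` t" by blast
  then show ?thesis using d by simp
qed

text \<open>This provides lifts of two adjacent 4-simplices that share a prescribed lift of their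
  common tetrahedron.\<close>

lemma lift_coface:
  assumes s: "convex s" "s \<subseteq> M" and t: "t \<subseteq> s" "convex t" "t \<noteq> {}" and d: "d \<in> lifts E p t"
  obtains c where "c \<in> lifts E p s" "c \<inter> p -` t = d"
proof -
  have "d \<noteq> {}" using d in_components_nonempty unfolding lifts_def by blast
  then obtain e where e: "e \<in> d" by blast
  then have eE: "e \<in> E" "p e \<in> s" "p e \<in> t" using lifts_subset[OF d] t by auto
  obtain c where c: "c \<in> lifts E p s" "e \<in> c" using ex_lift[OF eE(1,2)] by blast
  have "c \<inter> p -` t = d"
    by (rule lifts_eq[OF lift_face[OF s c(1) t] d]) (use c e eE in auto)
  then show ?thesis using that c by blast
qed

text \<open>Transitivity gives a deck transformation matching the two lifts at one point. It maps
  the connected set \<open>c\<close> into the component \<open>c'\<close>, and injectivity of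
  \<open>p\<close> on \<open>c'\<close> forces it onto \<open>c'\<close>.\<close>

lemma lifts_related:
  assumes "simply_connected E" "locally path_connected M" and s: "convex s" "s \<subseteq> M"
    and c: "c \<in> lifts E p s" "c' \<in> lifts E p s"
  obtains g where "g \<in> carrier (deck_group E p)" "c' = g ` c"
    "\<And>u. u \<in> s \<Longrightarrow> the_inv_into c' p u = g (the_inv_into c p u)"
proof -
  note S = lift_section[OF s c(1)] and S' = lift_section[OF s c(2)]
  obtain e where e: "e \<in> c" using c in_components_nonempty unfolding lifts_def by blast
  then have eE: "e \<in> E" "p e \<in> s" using lifts_subset[OF c(1)] by auto
  have "p e \<in> p ` c'" using eE(2) S'(2) by simp
  then obtain e' where e': "e' \<in> c'" "p e' = p e" by (metis imageE)
  then have "e' \<in> E" using lifts_subset[OF c(2)] by auto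
  then obtain g where g: "g \<in> carrier (deck_group E p)" "g e = e'"
    by (rule deck_group_transitive[OF assms(1,2) eE(1) _ e'(2)[symmetric]])
  note G = deck_groupD[OF g(1)]
  have cE: "c \<subseteq> E" "c \<subseteq> p -` s" using lifts_subset[OF c(1)] by auto
  have pg: "p (g x) = p x" if "x \<in> c" for x using G(3) cE(1) that by blast
  have "connected c" using c in_components_connected unfolding lifts_def by blast
  then have "connected (g ` c)" by (rule connected_continuous_image[OF continuous_on_subset[OF G(1) cE(1)]])
  then have sub: "g ` c \<subseteq> c'"
  proof (intro components_maximal[of c' "E \<inter> p -` s"])
    show "c' \<in> components (E \<inter> p -` s)" using c(2) by (simp add: lifts_def)
    show "g ` c \<subseteq> E \<inter> p -` s" using G(2) cE pg by auto
    show "c' \<inter> g ` c \<noteq> {}" using e e'(1) g(2) by blast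
  qed
  have "y \<in> g ` c" if "y \<in> c'" for y
  proof -
    have "p y \<in> s" using S'(2) that by blast
    then obtain x where x: "x \<in> c" "p x = p y" using S(2) by force
    then have "p (g x) = p y" "g x \<in> c'" using pg sub by auto
    then have "g x = y" using S'(1) that by (auto dest: inj_onD)
    then show ?thesis using x by blast
  qed
  then have eq: "c' = g ` c" using sub by blast
  have "the_inv_into c' p u = g (the_inv_into c p u)" if "u \<in> s" for u
  proof (rule the_inv_into_f_eq[OF S'(1)])
    have v: "the_inv_into c p u \<in> c" "p (the_inv_into c p u) = u"
      using S that by (auto intro: the_inv_into_into f_the_inv_into_f)
    then show "p (g (the_inv_into c p u)) = u" using pg by simp
    show "g (the_inv_into c p u) \<in> c'" using v sub by blast
  qed
  then show ?thesis using that g(1) eq by blast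
qed

lemma the_inv_into_face:
  assumes s: "convex s" "s \<subseteq> M" and c: "c \<in> lifts E p s" and t: "t \<subseteq> s" "u \<in> t"
  shows "the_inv_into (c \<inter> p -` t) p u = the_inv_into c p u"
proof -
  note S = lift_section[OF s c]
  have v: "the_inv_into c p u \<in> c" "p (the_inv_into c p u) = u"
    using S t by (auto intro: the_inv_into_into f_the_inv_into_f)
  show ?thesis
    by (rule the_inv_into_f_eq) (use S(1) v t in \<open>auto intro: inj_on_subset\<close>)
qed

end

subsection \<open>Simplicial complexes\<close>

lemma vertices_convex_hull: "\<not> affine_dependent C \<Longrightarrow> vertices (convex hull C) = C"
  unfolding vertices_def using extreme_point_of_convex_hull_affine_independent by blast

lemma simplexD:
  assumes "int n simplex s"
  shows "\<not> affine_dependent (vertices s)" "finite (vertices s)" "card (vertices s) = Suc n"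
    "convex hull (vertices s) = s"
proof -
  obtain C where C: "\<not> affine_dependent C" "int (card C) = int n + 1" "s = convex hull C" "finite C"
    using assms unfolding simplex by blast
  have "vertices s = C" using C vertices_convex_hull by blast
  then show "\<not> affine_dependent (vertices s)" "finite (vertices s)" "card (vertices s) = Suc n"
    "convex hull (vertices s) = s" using C by auto
qed

lemma vertices_subset: "vertices s \<subseteq> s"
  by (auto simp: vertices_def extreme_point_of_def)

context
  fixes K :: "'a::euclidean_space set set"
  assumes K: "simplicial_complex K"
begin

lemma finite_simplices: "finite (simplices K n)"
  using K by (simp add: simplicial_complex_def simplices_def)

lemma simplicesD:
  assumes "s \<in> simplices K n"
  shows "s \<in> K" "\<not> affine_dependent (vertices s)" "finite (vertices s)" "card (vertices s) = Suc n"
    "convex hull (vertices s) = s" "convex s" "s \<subseteq> \<Union>K" "s \<noteq> {}"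
proof -
  show "s \<in> K" using assms by (simp add: simplices_def)
  have "int n simplex s" using assms by (simp add: simplices_def)
  note D = simplexD[OF this]
  show "\<not> affine_dependent (vertices s)" "finite (vertices s)" "card (vertices s) = Suc n"
    "convex hull (vertices s) = s" by (rule D)+
  show "convex s" by (metis D(4) convex_convex_hull)
  show "s \<subseteq> \<Union>K" using \<open>s \<in> K\<close> by blast
  have "vertices s \<noteq> {}" using D(3) by auto
  then show "s \<noteq> {}" using vertices_subset by blast
qed

lemma convex_hull_in_simplices:
  assumes "s \<in> simplices K n" "A \<subseteq> vertices s" "card A = Suc m"
  shows "convex hull A \<in> simplices K m" "vertices (convex hull A) = A" "convex hull A \<subseteq> s"
proof -
  note S = simplicesD[OF assms(1)]
  have A: "\<not> affine_dependent A" using S(2) assms(2) affine_independent_subset by blast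
  have "convex hull A face_of s"
    using S(5) face_of_convex_hull_affine_independent[OF S(2)] assms(2) by metis
  then have "convex hull A \<in> K" using K S(1) unfolding simplicial_complex_def by blast
  moreover have "int m simplex convex hull A" by (rule simplex_convex_hull) (use A assms in auto)
  ultimately show "convex hull A \<in> simplices K m" by (simp add: simplices_def)
  show "vertices (convex hull A) = A" by (rule vertices_convex_hull[OF A])
  show "convex hull A \<subseteq> s" using hull_mono[OF assms(2), of convex] S(5) by simp
qed

lemma vertex_in_complex:
  assumes "s \<in> simplices K n" "v \<in> vertices s"
  shows "{v} \<in> K"
  using convex_hull_in_simplices(1)[OF assms(1), of "{v}" 0] assms(2) by (simp add: simplices_def)

lemma face_of_simplices:
  assumes "s \<in> K" "t \<in> K" "t \<subseteq> s"
  shows "t face_of s"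
  using K assms unfolding simplicial_complex_def by (metis inf.absorb_iff2)

lemma vertices_mono:
  assumes "s \<in> simplices K n" "t \<in> K" "t \<subseteq> s"
  shows "vertices t \<subseteq> vertices s"
proof -
  note S = simplicesD[OF assms(1)]
  obtain c where "c \<subseteq> vertices s" "t = convex hull c"
    using face_of_simplices[OF S(1) assms(2,3)] face_of_convex_hull_affine_independent[OF S(2)] S(5) by metis
  moreover from this have "vertices t = c" using S(2) vertices_convex_hull affine_independent_subset by metis
  ultimately show ?thesis by simp
qed

lemma subset_iff_vertices:
  assumes "s \<in> simplices K n" "t \<in> simplices K m"
  shows "t \<subseteq> s \<longleftrightarrow> vertices t \<subseteq> vertices s"
  using vertices_mono[OF assms(1)] simplicesD[OF assms(1)] simplicesD[OF assms(2)] hull_mono by metis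

text \<open>Take \<open>x\<close> in the relative interior of \<open>t\<close>. A simplex containing
  \<open>x\<close> contains \<open>t\<close>, and each of its further vertices spans a 4-simplex
  with \<open>t\<close>; if \<open>s\<close> is the only one, the simplex lies in \<open>s\<close>.
  So a neighbourhood of \<open>x\<close> in the manifold lies in \<open>s\<close>, and by invariance
  of domain it is open in the affine hull of \<open>s\<close>. Then \<open>x\<close> is in the
  relative interior of \<open>s\<close>, although it lies on a proper face.\<close>

lemma no_boundary_face:
  assumes man: "closed_pl_4_manifold (\<Union>K)" and t: "t \<in> simplices K 3" and s: "s \<in> simplices K 4" "t \<subseteq> s"
  shows "\<exists>s'\<in>simplices K 4. s' \<noteq> s \<and> t \<subseteq> s'"
proof (rule ccontr)
  assume "\<not> ?thesis"
  then have only: "s' = s" if "s' \<in> simplices K 4" "t \<subseteq> s'" for s' using that by blast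
  note T = simplicesD[OF t] and S = simplicesD[OF s(1)]
  obtain x where x: "x \<in> rel_interior t"
    using T(6,8) rel_interior_eq_empty by blast
  have star: "r \<subseteq> s" if r: "r \<in> K" "x \<in> r" for r
  proof -
    have "r \<inter> t face_of t" using K r(1) T(1) unfolding simplicial_complex_def by (metis inf_commute)
    then have "r \<inter> t = t" using face_of_disjoint_rel_interior x r(2) rel_interior_subset by blast
    then have tr: "t \<subseteq> r" by blast
    obtain n' where n': "n' simplex r" using K r(1) unfolding simplicial_complex_def by blast
    have "n' \<noteq> -1" using n' r(2) by auto
    then have "n' \<ge> 0" using simplex_dim_ge[OF n'] by simp
    then obtain n where n: "r \<in> simplices K n" using n' r(1) by (metis (mono_tags, lifting) mem_Collect_eq nonneg_int_cases simplices_def)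
    note R = simplicesD[OF n]
    have tv: "vertices t \<subseteq> vertices r" using vertices_mono[OF n T(1) tr] .
    have "v \<in> vertices s" if v: "v \<in> vertices r" for v
    proof (cases "v \<in> vertices t")
      case True
      then show ?thesis using vertices_mono[OF s(1) T(1) s(2)] by blast
    next
      case False
      have "card (insert v (vertices t)) = Suc 4" using False T(3,4) by simp
      note H = convex_hull_in_simplices[OF n _ this]
      have "t \<subseteq> convex hull (insert v (vertices t))" using T(5) by (metis hull_mono subset_insertI)
      then have "convex hull (insert v (vertices t)) = s" using only H(1) v tv by blast
      then show ?thesis using H(2) v tv by blast
    qed
    then show ?thesis using R(5) S(5) by (metis hull_mono subsetI)
  qed
  \<comment> \<open>Removing the finitely many closed simplices that miss \<open>x\<close> leaves an
    open neighbourhood of \<open>x\<close> that meets the complex only in the star of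
    \<open>x\<close>.\<close>
  define W where "W = - \<Union>{r \<in> K. x \<notin> r}"
  have "closed r" if "r \<in> K" for r
    using K that unfolding simplicial_complex_def by (metis closed_simplex)
  then have W: "open W" "x \<in> W" using K unfolding W_def simplicial_complex_def by (auto intro!: open_Compl closed_Union)
  have Ws: "W \<inter> \<Union>K \<subseteq> s" using star unfolding W_def by blast
  have xt: "x \<in> t" using x rel_interior_subset by blast
  then have "x \<in> \<Union>K" using T(1) by blast
  then obtain U N h k where U: "openin (top_of_set (\<Union>K)) U" "x \<in> U" "U \<subseteq> N" "N \<subseteq> \<Union>K"
    and h: "homeomorphism N (cbox 0 (1 :: real^4)) h k" "h x \<in> box 0 1"
    using man unfolding closed_pl_4_manifold_def by metis
  \<comment> \<open>The restriction to the interior of the cube makes the image of \<open>V\<close>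
    under \<open>h\<close> open in the whole space; \<open>x\<close> stays in \<open>V\<close>
    because the chart sends it to an interior point.\<close>
  define V where "V = U \<inter> h -` box 0 1 \<inter> W"
  have hc: "continuous_on N h" "continuous_on (cbox 0 1) k" using h(1) by (simp_all add: homeomorphism_def)
  have VN: "V \<subseteq> N" "x \<in> V" "V \<subseteq> s" using U h W Ws unfolding V_def by blast+
  have "openin (top_of_set N) V"
  proof -
    have "openin (top_of_set N) U" using U by (meson openin_subset_trans)
    moreover have "openin (top_of_set N) (N \<inter> h -` box 0 1)"
      using hc(1) by (intro continuous_openin_preimage_gen) auto
    ultimately have "openin (top_of_set N) (U \<inter> (N \<inter> h -` box 0 1))" by (rule openin_Int)
    then have "openin (top_of_set N) (U \<inter> (N \<inter> h -` box 0 1) \<inter> W)" using W(1) by (metis openin_Int_open)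
    moreover have "U \<inter> (N \<inter> h -` box 0 1) \<inter> W = V" using U(3) unfolding V_def by blast
    ultimately show ?thesis by simp
  qed
  then have "openin (top_of_set (cbox 0 1)) (h ` V)" using homeomorphism_imp_open_map[OF h(1)] by blast
  then obtain Q where Q: "open Q" "h ` V = cbox 0 1 \<inter> Q" by (auto simp: openin_open)
  have hVb: "h ` V \<subseteq> box 0 1" unfolding V_def by blast
  then have "h ` V = box 0 1 \<inter> Q" using Q(2) box_subset_cbox by blast
  then have op: "open (h ` V)" using Q(1) by auto
  have kh: "k (h y) = y" if "y \<in> V" for y
    by (rule homeomorphism_apply1[OF h(1)]) (use VN(1) that in blast)
  then have khV: "k ` h ` V = V" by (auto simp: image_image)
  have "openin (top_of_set (affine hull s)) (k ` h ` V)"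
  proof (rule invariance_of_domain_affine_sets)
    show "openin (top_of_set UNIV) (h ` V)" using op by simp
    show "affine (UNIV :: (real^4) set)" "affine (affine hull s)" by simp_all
    have "aff_dim s = 4" using aff_dim_simplex[of 4 s] s(1) by (simp add: simplices_def)
    then show "aff_dim (affine hull s) \<le> aff_dim (UNIV :: (real^4) set)" by simp
    show "continuous_on (h ` V) k" by (rule continuous_on_subset[OF hc(2) subset_trans[OF hVb box_subset_cbox]])
    have "V \<subseteq> affine hull s" using VN(3) hull_subset[of s affine] by blast
    then show "k \<in> h ` V \<rightarrow> affine hull s" using khV by blast
    show "inj_on k (h ` V)" by (rule inj_on_inverseI[of _ h]) (use kh in auto)
  qed
  then have "V \<subseteq> rel_interior s" using VN(3) unfolding khV by (intro rel_interior_maximal)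
  then have "x \<in> rel_interior s" using VN(2) by blast
  moreover have "t \<noteq> s" using T(4) S(4) by auto
  ultimately show False
    using face_of_disjoint_rel_interior[OF face_of_simplices[OF S(1) T(1) s(2)]] xt by blast
qed

end

subsection \<open>Orientation of a list of five points\<close>

definition edge_det :: "(nat \<Rightarrow> real^4) \<Rightarrow> real" where
  "edge_det r = det (vector [r 1 - r 0, r 2 - r 0, r 3 - r 0, r 4 - r 0] :: real^4^4)"

lemma vector_4_nth:
  "(vector [a, b, c, d] :: 'a::zero^4) $ 1 = a" "(vector [a, b, c, d] :: 'a::zero^4) $ 2 = b"
  "(vector [a, b, c, d] :: 'a::zero^4) $ 3 = c" "(vector [a, b, c, d] :: 'a::zero^4) $ 4 = d"
  by (simp_all add: vector_def)

lemma det_4: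
  fixes A :: "'a::comm_ring_1^4^4"
  shows "det A =
     A$1$1 * A$2$2 * A$3$3 * A$4$4 - A$1$1 * A$2$2 * A$3$4 * A$4$3
   + A$1$1 * A$2$3 * A$3$4 * A$4$2 - A$1$1 * A$2$3 * A$3$2 * A$4$4
   + A$1$1 * A$2$4 * A$3$2 * A$4$3 - A$1$1 * A$2$4 * A$3$3 * A$4$2
   - A$1$2 * A$2$1 * A$3$3 * A$4$4 + A$1$2 * A$2$1 * A$3$4 * A$4$3
   - A$1$2 * A$2$3 * A$3$4 * A$4$1 + A$1$2 * A$2$3 * A$3$1 * A$4$4
   - A$1$2 * A$2$4 * A$3$1 * A$4$3 + A$1$2 * A$2$4 * A$3$3 * A$4$1
   + A$1$3 * A$2$1 * A$3$2 * A$4$4 - A$1$3 * A$2$1 * A$3$4 * A$4$2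
   + A$1$3 * A$2$2 * A$3$4 * A$4$1 - A$1$3 * A$2$2 * A$3$1 * A$4$4
   + A$1$3 * A$2$4 * A$3$1 * A$4$2 - A$1$3 * A$2$4 * A$3$2 * A$4$1
   - A$1$4 * A$2$1 * A$3$2 * A$4$3 + A$1$4 * A$2$1 * A$3$3 * A$4$2
   - A$1$4 * A$2$2 * A$3$3 * A$4$1 + A$1$4 * A$2$2 * A$3$1 * A$4$3
   - A$1$4 * A$2$3 * A$3$1 * A$4$2 + A$1$4 * A$2$3 * A$3$2 * A$4$1"
proof -
  have f1: "finite {2::4, 3, 4}" "1 \<notin> {2::4, 3, 4}" by auto
  have f2: "finite {3::4, 4}" "2 \<notin> {3::4, 4}" by auto
  have f3: "finite {4::4}" "3 \<notin> {4::4}" by auto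
  show ?thesis
    unfolding det_def UNIV_4
    unfolding sum_over_permutations_insert[OF f1]
    unfolding sum_over_permutations_insert[OF f2]
    unfolding sum_over_permutations_insert[OF f3]
    unfolding permutes_sing
    by (simp add: sign_swap_id permutation_swap_id permutation_compose sign_compose sign_id swap_id_eq)
qed

abbreviation det_rows :: "real^4 \<Rightarrow> real^4 \<Rightarrow> real^4 \<Rightarrow> real^4 \<Rightarrow> real" where
  "det_rows a b c d \<equiv> det (vector [a, b, c, d] :: real^4^4)"

lemma det_rows_swap:
  "det_rows b a c d = - det_rows a b c d" "det_rows c b a d = - det_rows a b c d"
  "det_rows d b c a = - det_rows a b c d" "det_rows a c b d = - det_rows a b c d"
  "det_rows a d c b = - det_rows a b c d" "det_rows a b d c = - det_rows a b c d"
  unfolding det_4 vector_4_nth by (simp_all add: algebra_simps)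

lemma det_rows_equal:
  "det_rows a a c d = 0" "det_rows a b a d = 0" "det_rows a b c a = 0"
  unfolding det_4 vector_4_nth by (simp_all add: algebra_simps)

lemma det_rows_diff:
  "det_rows a (b - e) c d = det_rows a b c d - det_rows a e c d"
  "det_rows a b (c - e) d = det_rows a b c d - det_rows a b e d"
  "det_rows a b c (d - e) = det_rows a b c d - det_rows a b c e"
  "det_rows (- a) b c d = - det_rows a b c d"
  unfolding det_4 vector_4_nth by (simp_all add: algebra_simps)

lemma det_rows_rebase:
  "det_rows (s - t) (b - t) (c - t) (d - t) = - det_rows (t - s) (b - s) (c - s) (d - s)"
  "det_rows (b - t) (s - t) (c - t) (d - t) = - det_rows (b - s) (t - s) (c - s) (d - s)"
  "det_rows (b - t) (c - t) (s - t) (d - t) = - det_rows (b - s) (c - s) (t - s) (d - s)"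
  "det_rows (b - t) (c - t) (d - t) (s - t) = - det_rows (b - s) (c - s) (d - s) (t - s)"
proof -
  show *: "det_rows (s - t) (b - t) (c - t) (d - t) = - det_rows (t - s) (b - s) (c - s) (d - s)" for b c d
  proof -
    have "s - t = - (t - s)" "b - t = (b - s) - (t - s)" "c - t = (c - s) - (t - s)" "d - t = (d - s) - (t - s)"
      by simp_all
    then have "det_rows (s - t) (b - t) (c - t) (d - t)
       = det_rows (- (t - s)) ((b - s) - (t - s)) ((c - s) - (t - s)) ((d - s) - (t - s))" by (simp only:)
    also have "\<dots> = - det_rows (t - s) (b - s) (c - s) (d - s)"
      by (simp only: det_rows_diff(4) det_rows_diff(1-3)[of _ _ "t - s"] det_rows_diff(2)[of _ _ _ "t - s"] det_rows_diff(3)[of _ _ _ _ "t - s"] det_rows_equal diff_0_right)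
    finally show ?thesis .
  qed
  show "det_rows (b - t) (s - t) (c - t) (d - t) = - det_rows (b - s) (t - s) (c - s) (d - s)"
    using *[of b c d] by (simp only: det_rows_swap(1)[of "s - t" "b - t"] det_rows_swap(1)[of "t - s" "b - s"])
  show "det_rows (b - t) (c - t) (s - t) (d - t) = - det_rows (b - s) (c - s) (t - s) (d - s)"
    using *[of c b d] by (simp only: det_rows_swap(2)[of "s - t" _ "b - t"] det_rows_swap(2)[of "t - s" _ "b - s"])
  show "det_rows (b - t) (c - t) (d - t) (s - t) = - det_rows (b - s) (c - s) (d - s) (t - s)"
    using *[of c d b] by (simp only: det_rows_swap(3)[of "s - t" _ _ "b - t"] det_rows_swap(3)[of "t - s" _ _ "b - s"])
qed

text \<open>A transposition of positive indices exchanges two rows; one that involves the index 0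
  changes the base point of the difference vectors, which is the case of
  \<open>det_rows_rebase\<close>.\<close>

lemma edge_det_transpose:
  assumes "a < 5" "b < 5" "a \<noteq> b"
  shows "edge_det (r \<circ> Transposition.transpose a b) = - edge_det r"
proof -
  have *: "edge_det (r \<circ> Transposition.transpose a b) = - edge_det r" if "a < b" "b < 5" for a b
  proof -
    have "a = 0 \<and> b = 1 \<or> a = 0 \<and> b = 2 \<or> a = 0 \<and> b = 3 \<or> a = 0 \<and> b = 4 \<or> a = 1 \<and> b = 2
      \<or> a = 1 \<and> b = 3 \<or> a = 1 \<and> b = 4 \<or> a = 2 \<and> b = 3 \<or> a = 2 \<and> b = 4 \<or> a = 3 \<and> b = 4"
      using that by presburger
    then show ?thesis
      unfolding edge_det_def o_apply
      by - (elim disjE conjE, simp_all only: Transposition.transpose_def zero_neq_one one_neq_zero zero_neq_numeral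
          numeral_neq_zero one_eq_numeral_iff numeral_eq_one_iff numeral_eq_iff num.distinct num.inject if_True if_False refl,
         (rule det_rows_rebase det_rows_swap)+)
  qed
  show ?thesis
  proof (cases "a < b")
    case True
    then show ?thesis using * assms by simp
  next
    case False
    then show ?thesis using *[of b a] assms by (simp add: Transposition.transpose_commute)
  qed
qed

lemma edge_det_cong: "(\<And>i. i < 5 \<Longrightarrow> r i = r' i) \<Longrightarrow> edge_det r = edge_det r'"
  by (simp add: edge_det_def)

lemma edge_det_permute:
  assumes "\<pi> permutes {..<5}"
  shows "edge_det (r \<circ> \<pi>) = of_int (sign \<pi>) * edge_det r"
  using assms finite_lessThan
proof (induction \<pi> arbitrary: r rule: permutes_induct)
  case id then show ?case by simp
next
  case (swap a b p)
  have "edge_det (r \<circ> (Transposition.transpose a b \<circ> p)) = of_int (sign p) * edge_det (r \<circ> Transposition.transpose a b)"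
    using swap.IH[of "r \<circ> Transposition.transpose a b"] unfolding o_assoc .
  also have "edge_det (r \<circ> Transposition.transpose a b) = - edge_det r"
    using swap.hyps by (intro edge_det_transpose) auto
  also have "of_int (sign p) * - edge_det r = of_int (sign (Transposition.transpose a b \<circ> p)) * edge_det r"
  proof -
    have "permutation p" using \<open>p permutes {..<5}\<close> permutation_permutes by blast
    then have "sign (Transposition.transpose a b \<circ> p) = - sign p"
      using \<open>a \<noteq> b\<close> by (simp add: sign_compose permutation_swap_id sign_swap_id)
    then show ?thesis by simp
  qed
  finally show ?case .
qed

lemma edge_det_first:
  "edge_det r = - det (vector [r 0 - r 1, r 2 - r 1, r 3 - r 1, r 4 - r 1] :: real^4^4)"
  using edge_det_transpose[of 0 1 r] by (simp add: edge_det_def Transposition.transpose_def)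

lemma det_row_functional:
  fixes b c d :: "real^4"
  obtains n where "\<And>a. det (vector [a, b, c, d] :: real^4^4) = a \<bullet> n"
proof -
  let ?f = "\<lambda>a. det (vector [a, b, c, d] :: real^4^4)"
  have "linear ?f"
    unfolding det_4 vector_4_nth by (rule linearI) (simp_all add: algebra_simps)
  then have "?f a = a \<bullet> adjoint ?f 1" for a
    using adjoint_works[of ?f a 1] by simp
  then show ?thesis using that by blast
qed

lemma edge_det_motion:
  fixes A :: "real^4^4"
  assumes "det A = 1" and "\<And>i. i < 5 \<Longrightarrow> r' i = A *v r i + b"
  shows "edge_det r' = edge_det r"
proof -
  have "(vector [r' 1 - r' 0, r' 2 - r' 0, r' 3 - r' 0, r' 4 - r' 0] :: real^4^4)
     = (vector [r 1 - r 0, r 2 - r 0, r 3 - r 0, r 4 - r 0] :: real^4^4) ** transpose A"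
    unfolding vec_eq_iff forall_4 vector_4_nth
    by (simp add: assms(2) matrix_matrix_mult_def matrix_vector_mult_def Finite_Cartesian_Product.transpose_def vector_4_nth sum_4 algebra_simps)
  then show ?thesis unfolding edge_det_def by (simp add: det_mul det_transpose assms(1))
qed

subsection \<open>Dihedral angles as functions of the edge lengths\<close>

text \<open>A length function is arbitrary on the degenerate segment from a point to itself, hence
  the explicit zero.\<close>

definition sqd :: "('a::euclidean_space set \<Rightarrow> real) \<Rightarrow> 'a \<Rightarrow> 'a \<Rightarrow> real" where
  "sqd L x y = (if x = y then 0 else L (closed_segment x y))"

text \<open>Polarization: the inner product of the edge vectors from \<open>A\<close> to
  \<open>x\<close> and to \<open>y\<close>, read off from squared lengths. It makes sense for any
  \<open>L\<close>, realizable or not.\<close>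

definition gram :: "('a::euclidean_space set \<Rightarrow> real) \<Rightarrow> 'a \<Rightarrow> 'a \<Rightarrow> 'a \<Rightarrow> real" where
  "gram L A x y = (sqd L x A + sqd L y A - sqd L x y) / 2"

lemma sqd_commute: "sqd L x y = sqd L y x"
  by (simp add: sqd_def closed_segment_commute)

lemma gram_commute: "gram L A x y = gram L A y x"
  by (simp add: gram_def sqd_commute[of L x y])

lemma schur_commute: "(\<And>x y. k x y = k y x) \<Longrightarrow> schur z k x y = schur z k y x"
  by (simp add: schur_def mult.commute)

lemma gram_realizes:
  assumes "realizes q s L" "A \<in> vertices s" "x \<in> vertices s" "y \<in> vertices s"
  shows "gram L A x y = (q x - q A) \<bullet> (q y - q A)"
proof -
  have *: "sqd L u w = (q u - q w) \<bullet> (q u - q w)" if "u \<in> vertices s" "w \<in> vertices s" for u w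
    using assms(1) that by (auto simp: sqd_def realizes_def dist_norm power2_norm_eq_inner)
  show ?thesis
    unfolding gram_def using assms by (simp add: * inner_diff_left inner_diff_right inner_commute)
qed

lemma differentiable_gram: "(\<lambda>l. gram (L(a := l)) A x y) field_differentiable at l0"
proof -
  have *: "(\<lambda>l. sqd (L(a := l)) u w) field_differentiable at l0" for u w
    by (cases "u = w"; cases "closed_segment u w = a") (auto simp: sqd_def)
  show ?thesis unfolding gram_def by (intro derivative_intros *) auto
qed

text \<open>Gram-Schmidt yields the component orthogonal to both \<open>b - a\<close> and
  \<open>c - a\<close>. As \<open>orth 0\<close> is the identity, the formula also covers collinear
  or coinciding points.\<close>

lemma closest_point_affine_hull_3:
  fixes a b c x :: "'b::euclidean_space"
  shows "x - closest_point (affine hull {a, b, c}) x = orth (orth (b - a) (c - a)) (orth (b - a) (x - a))"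
proof -
  define w where "w = orth (b - a) (c - a)"
  define r where "r = orth w (orth (b - a) (x - a))"
  define y where "y = x - r"
  let ?F = "affine hull {a, b, c}"
  have ex: "\<exists>c. v = orth q v + c *\<^sub>R q" for q v :: 'b
    by (rule exI[of _ "v \<bullet> q / (q \<bullet> q)"]) (simp add: orth_def)
  obtain s1 where s1: "x - a = orth (b - a) (x - a) + s1 *\<^sub>R (b - a)" using ex by blast
  obtain s2 where s2: "orth (b - a) (x - a) = r + s2 *\<^sub>R w" using ex unfolding r_def by blast
  obtain s3 where "c - a = w + s3 *\<^sub>R (b - a)" using ex unfolding w_def by blast
  then have s3: "w = (c - a) - s3 *\<^sub>R (b - a)" by (simp add: algebra_simps)
  have wb: "w \<bullet> (b - a) = 0" by (simp add: w_def)
  have rw: "r \<bullet> w = 0" by (simp add: r_def)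
  have "r \<bullet> (b - a) = orth (b - a) (x - a) \<bullet> (b - a) - s2 * (w \<bullet> (b - a))"
    using s2 by (simp add: inner_add_left)
  then have rb: "r \<bullet> (b - a) = 0" using wb by simp
  have rc: "r \<bullet> (c - a) = 0" using rw rb s3 by (simp add: inner_diff_right)
  have F: "?F = {u *\<^sub>R a + v *\<^sub>R b + w *\<^sub>R c | u v w. u + v + w = 1}" by (rule affine_hull_3)
  have xa: "x = a + r + s2 *\<^sub>R w + s1 *\<^sub>R (b - a)" using s1 s2 by (simp add: algebra_simps)
  have "y = (1 - s2 - (s1 - s2 * s3)) *\<^sub>R a + (s1 - s2 * s3) *\<^sub>R b + s2 *\<^sub>R c"
    unfolding y_def by (subst xa, subst s3) (simp add: algebra_simps)
  then have yF: "y \<in> ?F" unfolding F by force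
  have "y = closest_point ?F x"
  proof (rule closest_point_unique)
    show "convex ?F" "closed ?F" by (simp_all add: affine_imp_convex closed_affine_hull)
    show "y \<in> ?F" by (rule yF)
    show "\<forall>z\<in>?F. dist x y \<le> dist x z"
    proof
      fix z assume "z \<in> ?F"
      have sub: "?F \<subseteq> {v. r \<bullet> v = r \<bullet> a}"
        by (rule hull_minimal) (use rb rc in \<open>auto simp: affine_hyperplane inner_diff_right\<close>)
      have "r \<bullet> y = r \<bullet> a" "r \<bullet> z = r \<bullet> a" using sub yF \<open>z \<in> ?F\<close> by blast+
      then have "r \<bullet> (y - z) = 0" by (simp add: inner_diff_right)
      then have "(norm (r + (y - z)))\<^sup>2 = (norm r)\<^sup>2 + (norm (y - z))\<^sup>2"
        unfolding power2_norm_eq_inner inner_add_left inner_add_right inner_commute[of "y - z" r] by simp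
      then have "(norm r)\<^sup>2 \<le> (norm (r + (y - z)))\<^sup>2" by simp
      then have "norm r \<le> norm (r + (y - z))" using power2_le_imp_le norm_ge_zero by blast
      moreover have "x - y = r" "x - z = r + (y - z)" by (simp_all add: y_def)
      ultimately show "dist x y \<le> dist x z" by (simp only: dist_norm)
    qed
  qed
  then show ?thesis unfolding r_def[symmetric, unfolded w_def] y_def by (metis add_diff_cancel_left' diff_add_cancel)
qed

lemma schur_gram_realizes:
  assumes "realizes q s L" "A \<in> vertices s" "B \<in> vertices s" "x \<in> vertices s" "y \<in> vertices s"
  shows "schur B (gram L A) x y = orth (q B - q A) (q x - q A) \<bullet> orth (q B - q A) (q y - q A)"
  using assms by (simp add: schur_def gram_realizes[OF assms(1)] orth_inner_orth)

lemma is_listing_listing: "finite A \<Longrightarrow> is_listing (listing A) A"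
  unfolding listing_def is_listing_def by (rule someI_ex) (metis finite_distinct_list)

lemma listing_doubleton:
  assumes "x \<noteq> y"
  shows "listing {x, y} = [x, y] \<or> listing {x, y} = [y, x]"
proof -
  have l: "distinct (listing {x, y})" "set (listing {x, y}) = {x, y}"
    using is_listing_listing[of "{x, y}"] by (auto simp: is_listing_def)
  then have "length (listing {x, y}) = 2" using assms distinct_card by fastforce
  then obtain u v where "listing {x, y} = [u, v]"
    by (metis (no_types, opaque_lifting) One_nat_def Suc_1 length_0_conv length_Suc_conv)
  with l show ?thesis by (auto simp: doubleton_eq_iff)
qed

text \<open>
  Because of \<open>x / 0 = 0\<close> this covers degenerate \<open>q\<close>, which matters for the realization that
  \<open>SOME\<close> selects in \<open>dihedral_of_lengths\<close>.
\<close>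

lemma dihedral_angle_gram:
  assumes r: "realizes q s L" and V: "vertices s = {A, B, C, x, y}" "distinct [A, B, C, x, y]"
    and i: "vertices i = {A, B, C}"
  shows "dihedral_angle q s i = gram_angle (schur C (schur B (gram L A))) x y"
proof -
  define p where "p u = orth (orth (q B - q A) (q C - q A)) (orth (q B - q A) (q u - q A))" for u
  have s: "schur C (schur B (gram L A)) u w = p u \<bullet> p w" if "u \<in> vertices s" "w \<in> vertices s" for u w
    unfolding p_def schur_def[of C] using that V by (simp add: schur_gram_realizes[OF r] orth_inner_orth inner_commute)
  have "vector_angle (p u) (p w) = gram_angle (schur C (schur B (gram L A))) u w"
    if "u \<in> vertices s" "w \<in> vertices s" for u w
    using that by (simp add: vector_angle_def gram_angle_def s norm_eq_sqrt_inner)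
  moreover have "vector_angle (p u) (p w) = vector_angle (p w) (p u)" for u w
    by (simp add: vector_angle_def inner_commute mult.commute)
  moreover have "vertices s - vertices i = {x, y}" using V i by auto
  moreover have "q ` vertices i = {q A, q B, q C}" using i by simp
  moreover have "listing {x, y} = [x, y] \<or> listing {x, y} = [y, x]" by (rule listing_doubleton) (use V in simp)
  ultimately show ?thesis
    unfolding dihedral_angle_def Let_def using V
    by (auto simp: closest_point_affine_hull_3 p_def[symmetric])
qed

lemma dihedral_of_lengths_gram:
  assumes "\<exists>q. realizes q s L" and V: "vertices s = {A, B, C, x, y}" "distinct [A, B, C, x, y]"
    and i: "vertices i = {A, B, C}"
  shows "dihedral_of_lengths s i L = gram_angle (schur C (schur B (gram L A))) x y"
  unfolding dihedral_of_lengths_def by (rule dihedral_angle_gram[OF someI_ex[OF assms(1)] V i])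

section \<open>Nondegenerate 4-simplices and small changes of one edge length\<close>

lemma indep4_differences:
  fixes a b c d e :: "'b::real_vector"
  assumes "\<not> affine_dependent {a, b, c, d, e}" "distinct [a, b, c, d, e]"
  shows "indep4 (b - a) (c - a) (d - a) (e - a)"
  unfolding indep4_def
proof (intro allI impI)
  fix s t u v assume *: "s *\<^sub>R (b - a) + t *\<^sub>R (c - a) + u *\<^sub>R (d - a) + v *\<^sub>R (e - a) = 0"
  define U where "U x = (if x = b then s else if x = c then t else if x = d then u else if x = e then v else - (s + t + u + v))" for x
  have U: "U a = - (s + t + u + v)" "U b = s" "U c = t" "U d = u" "U e = v"
    using assms(2) by (auto simp: U_def)
  have "sum U {a, b, c, d, e} = 0" using assms(2) U by simp
  moreover have "(\<Sum>x\<in>{a, b, c, d, e}. U x *\<^sub>R x) = s *\<^sub>R (b - a) + t *\<^sub>R (c - a) + u *\<^sub>R (d - a) + v *\<^sub>R (e - a)"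
    using assms(2) by (simp add: U algebra_simps)
  ultimately have "\<forall>x\<in>{a, b, c, d, e}. U x = 0"
    using assms(1) * affine_dependent_explicit_finite[of "{a, b, c, d, e}"] by auto
  then show "s = 0 \<and> t = 0 \<and> u = 0 \<and> v = 0" using U by simp
qed

lemma spanning4_differences:
  fixes a b c d e :: "real^4"
  assumes "\<not> affine_dependent {a, b, c, d, e}" "distinct [a, b, c, d, e]"
  shows "spanning4 (b - a) (c - a) (d - a) (e - a)"
  unfolding spanning4_def
proof (intro allI impI)
  fix n assume *: "n \<bullet> (b - a) = 0 \<and> n \<bullet> (c - a) = 0 \<and> n \<bullet> (d - a) = 0 \<and> n \<bullet> (e - a) = 0"
  have "aff_dim {a, b, c, d, e} = 4"
    using assms affine_independent_iff_card[of "{a, b, c, d, e}"] by simp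
  then have "affine hull {a, b, c, d, e} = UNIV"
    using aff_dim_eq_full[of "{a, b, c, d, e}"] by simp
  moreover have "affine hull {a, b, c, d, e} \<subseteq> {v. n \<bullet> v = n \<bullet> a}"
    by (rule hull_minimal) (use * in \<open>auto simp: affine_hyperplane inner_diff_right\<close>)
  ultimately have "n \<bullet> (a + n) = n \<bullet> a" by auto
  then show "n = 0" by (simp add: inner_add_right)
qed

definition nondegenerate :: "('a \<Rightarrow> real^4) \<Rightarrow> 'a set \<Rightarrow> bool" where
  "nondegenerate q V \<longleftrightarrow> inj_on q V \<and> \<not> affine_dependent (q ` V)"

lemma nondegenerate_frame:
  assumes "nondegenerate q {a, b, c, d, e}" "distinct [a, b, c, d, e]"
  shows "indep4 (q b - q a) (q c - q a) (q d - q a) (q e - q a)"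
    "spanning4 (q b - q a) (q c - q a) (q d - q a) (q e - q a)"
proof -
  have "\<not> affine_dependent {q a, q b, q c, q d, q e}" "distinct [q a, q b, q c, q d, q e]"
    using assms by (auto simp: nondegenerate_def inj_on_def)
  then show "indep4 (q b - q a) (q c - q a) (q d - q a) (q e - q a)"
    "spanning4 (q b - q a) (q c - q a) (q d - q a) (q e - q a)"
    by (rule indep4_differences spanning4_differences)+
qed

text \<open>This gives the \<open>SOME\<close> in \<open>dihedral_of_lengths\<close> a meaning near
  the placed lengths. If \<open>a\<close> is not an edge of \<open>s\<close>, then \<open>q\<close>
  itself still works; otherwise one end point of \<open>a\<close> is moved as in
  \<open>realize_one_length\<close>.\<close>

lemma eventually_realizes:
  assumes r: "realizes q s L" and nd: "nondegenerate q (vertices s)" and card: "card (vertices s) = 5"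
    and a: "a = closed_segment u0 w0"
  shows "\<forall>\<^sub>F l in nhds (L a). \<exists>q'. realizes q' s (L(a := l))"
proof (cases "\<exists>u w. u \<in> vertices s \<and> w \<in> vertices s \<and> u \<noteq> w \<and> a = closed_segment u w")
  case False
  then have "realizes q s (L(a := l))" for l
    using r unfolding realizes_def by (metis fun_upd_other)
  then show ?thesis by (intro always_eventually) blast
next
  case True
  then obtain u w where uw: "u \<in> vertices s" "w \<in> vertices s" "u \<noteq> w" "a = closed_segment u w" by blast
  have "finite (vertices s)" using card by (metis card.infinite zero_neq_numeral)
  then have "card (vertices s - {u, w}) = 3" using card uw by (simp add: card_Diff_subset)
  then obtain x y z where xyz: "vertices s - {u, w} = {x, y, z}" "x \<noteq> y" "y \<noteq> z" "x \<noteq> z"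
    by (auto simp: card_3_iff)
  have V: "vertices s = {x, y, z, u, w}" using xyz uw by auto
  have d: "distinct [x, y, z, u, w]" using xyz uw by auto
  have La: "L a = (dist (q u) (q w))\<^sup>2" using r uw by (simp add: realizes_def)
  have seg: "closed_segment u' w' = a \<longleftrightarrow> {u', w'} = {u, w}" for u' w'
    using uw(4) by (simp add: closed_segment_eq)
  have "indep4 (q y - q x) (q z - q x) (q u - q x) (q w - q x)"
    using nondegenerate_frame(1)[of q x y z u w] nd d unfolding V by blast
  from realize_one_length[OF this] show ?thesis unfolding La
  proof eventually_elim
    case (elim l)
    then obtain w' where w': "dist w' (q x) = dist (q w) (q x)" "dist w' (q y) = dist (q w) (q y)"
      "dist w' (q z) = dist (q w) (q z)" "(dist (q u) w')\<^sup>2 = l" by blast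
    have r': "(dist (q u') (q v'))\<^sup>2 = L (closed_segment u' v')" if "u' \<in> vertices s" "v' \<in> vertices s" "u' \<noteq> v'" for u' v'
      using r that by (simp add: realizes_def)
    have w'': "dist w' (q t) = dist (q w) (q t)" if "t \<in> vertices s" "t \<noteq> w" "t \<noteq> u" for t
      using that w' V by auto
    have "realizes (q(w := w')) s (L(a := l))"
      unfolding realizes_def
    proof (intro ballI impI)
      fix u' v' assume v: "u' \<in> vertices s" "v' \<in> vertices s" "u' \<noteq> v'"
      show "(dist ((q(w := w')) u') ((q(w := w')) v'))\<^sup>2 = (L(a := l)) (closed_segment u' v')"
      proof (cases "{u', v'} = {u, w}")
        case True
        then have "u' = u \<and> v' = w \<or> u' = w \<and> v' = u" by (auto simp: doubleton_eq_iff)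
        moreover have "closed_segment u' v' = a" using True seg by simp
        ultimately show ?thesis using w'(4) uw(3) by (auto simp: dist_commute)
      next
        case False
        then have "closed_segment u' v' \<noteq> a" using seg by simp
        moreover have "dist ((q(w := w')) u') ((q(w := w')) v') = dist (q u') (q v')"
        proof (cases "u' = w")
          case True
          then show ?thesis using w''[of v'] False v by auto
        next
          case u': False
          show ?thesis
          proof (cases "v' = w")
            case True
            then show ?thesis using w''[of u'] False v u' by (auto simp: dist_commute)
          qed (use u' in simp)
        qed
        ultimately show ?thesis using r' v by simp
      qed
    qed
    then show ?case by blast
  qed
qed

lemma nondegenerate_orth:
  assumes "nondegenerate q {A, B, x, y, z}" "distinct [A, B, x, y, z]"
  defines "f \<equiv> \<lambda>u. orth (q B - q A) (q u - q A)"
  shows "indep3 (f x) (f y) (f z)" "spanning4 (q B - q A) (f x) (f y) (f z)" "q B \<noteq> q A"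
proof -
  note fr = nondegenerate_frame[OF assms(1,2)]
  show "indep3 (f x) (f y) (f z)" unfolding f_def by (rule indep3_orth[OF fr(1)])
  have f: "n \<bullet> f u = n \<bullet> (q u - q A)" if "n \<bullet> (q B - q A) = 0" for n u
    using that by (simp add: f_def orth_def inner_diff_right[of n "q u - q A"])
  show "spanning4 (q B - q A) (f x) (f y) (f z)"
    using fr(2) f unfolding spanning4_def by metis
  show "q B \<noteq> q A" using assms(1,2) by (auto simp: nondegenerate_def inj_on_def)
qed

text \<open>Near the placed lengths a realization exists, so the dihedral angle agrees there with
  the Gram expression, and derivatives carry over. The two nested Schur complements present it as
  the angle at \<open>x\<close> in the spherical triangle around the edge \<open>AB\<close>.\<close>

lemma
  assumes r: "realizes q s L" and nd: "nondegenerate q (vertices s)"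
    and V: "vertices s = {A, B, x, y, z}" "distinct [A, B, x, y, z]" and a: "a = closed_segment u0 w0"
    and i: "vertices i = {A, B, x}"
  shows deriv_dihedral_of_lengths:
      "deriv (\<lambda>l. dihedral_of_lengths s i (L(a := l))) (L a)
       = deriv (\<lambda>l. gram_angle (schur x (schur B (gram (L(a := l)) A))) y z) (L a)"
    and differentiable_dihedral_of_lengths:
      "(\<lambda>l. dihedral_of_lengths s i (L(a := l))) field_differentiable at (L a)"
proof -
  have "card (vertices s) = 5" using V by simp
  note ev = eventually_realizes[OF r nd this a]
  have ev': "\<forall>\<^sub>F l in nhds (L a). dihedral_of_lengths s i (L(a := l))
      = gram_angle (schur x (schur B (gram (L(a := l)) A))) y z"
    using ev by eventually_elim (rule dihedral_of_lengths_gram[OF _ V i])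
  then show "deriv (\<lambda>l. dihedral_of_lengths s i (L(a := l))) (L a)
       = deriv (\<lambda>l. gram_angle (schur x (schur B (gram (L(a := l)) A))) y z) (L a)"
    by (rule deriv_cong_ev) simp
  let ?k = "\<lambda>l. schur B (gram (L(a := l)) A)"
  let ?f = "\<lambda>u. orth (q B - q A) (q u - q A)"
  note nd' = nondegenerate_orth[OF nd[unfolded V(1)] V(2)]
  have vs: "A \<in> vertices s" "B \<in> vertices s" "x \<in> vertices s" "y \<in> vertices s" "z \<in> vertices s"
    using V by auto
  have gBB: "gram L A B B \<noteq> 0" using gram_realizes[OF r vs(1,2,2)] nd'(3) by simp
  have k0: "schur B (gram L A) u w = ?f u \<bullet> ?f w" if "u \<in> vertices s" "w \<in> vertices s" for u w
    using schur_gram_realizes[OF r vs(1,2) that] by simp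
  have "posdef3 (\<lambda>u w. ?f u \<bullet> ?f w) x y z" using posdef3_inner[of ?f x y z] nd'(1) by simp
  then have "posdef3 (?k (L a)) x y z"
    using vs by (simp add: posdef3_def det2_def det3_def k0)
  then have "(\<lambda>l. gram_angle (schur x (?k l)) y z) field_differentiable at (L a)"
    by (intro differentiable_vertex_angle[where k="?k"] schur_commute gram_commute differentiable_schur differentiable_gram)
      (use gBB in simp_all)
  then show "(\<lambda>l. dihedral_of_lengths s i (L(a := l))) field_differentiable at (L a)"
    unfolding field_differentiable_def using ev' by (subst DERIV_cong_ev[OF refl _ refl]) simp_all
qed

text \<open>The case of \<open>spherical_derivative\<close> in which \<open>e\<close> is the edge
  vector and \<open>f\<close> projects along it. The normal \<open>nx\<close> belongs to the
  tetrahedron \<open>A\<close>, \<open>B\<close>, \<open>y\<close>, \<open>z\<close> and is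
  therefore paired with the angle between \<open>y\<close> and \<open>z\<close>, the dihedral angle
  of that tetrahedron at \<open>AB\<close>.\<close>

lemma edge_identity:
  assumes r: "realizes q s L" and nd: "nondegenerate q (vertices s)"
    and V: "vertices s = {A, B, x, y, z}" "distinct [A, B, x, y, z]" and a: "a = closed_segment u0 w0"
    and i: "vertices ix = {A, B, x}" "vertices iy = {A, B, y}" "vertices iz = {A, B, z}"
    and nx: "norm nx = 1" "nx \<bullet> (q B - q A) = 0" "nx \<bullet> (q y - q A) = 0" "nx \<bullet> (q z - q A) = 0" "nx \<bullet> (q x - q A) > 0"
    and ny: "norm ny = 1" "ny \<bullet> (q B - q A) = 0" "ny \<bullet> (q x - q A) = 0" "ny \<bullet> (q z - q A) = 0" "ny \<bullet> (q y - q A) > 0"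
    and nz: "norm nz = 1" "nz \<bullet> (q B - q A) = 0" "nz \<bullet> (q x - q A) = 0" "nz \<bullet> (q y - q A) = 0" "nz \<bullet> (q z - q A) > 0"
  shows "deriv (\<lambda>l. dihedral_of_lengths s ix (L(a := l))) (L a) *\<^sub>R sgn (orth (q B - q A) (q x - q A))
     + deriv (\<lambda>l. dihedral_of_lengths s iy (L(a := l))) (L a) *\<^sub>R sgn (orth (q B - q A) (q y - q A))
     + deriv (\<lambda>l. dihedral_of_lengths s iz (L(a := l))) (L a) *\<^sub>R sgn (orth (q B - q A) (q z - q A))
     = deriv (\<lambda>l. gram_angle (schur B (gram (L(a := l)) A)) y z) (L a) *\<^sub>R nx
     + deriv (\<lambda>l. gram_angle (schur B (gram (L(a := l)) A)) x z) (L a) *\<^sub>R ny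
     + deriv (\<lambda>l. gram_angle (schur B (gram (L(a := l)) A)) x y) (L a) *\<^sub>R nz"
proof -
  \<comment> \<open>the Gram matrix is only known at vertices of \<open>s\<close>; \<open>\<tau>\<close> redirects all other indices to a vertex\<close>
  define \<tau> where "\<tau> u = (if u \<in> {x, y, z} then u else x)" for u
  define k where "k l u w = schur B (gram (L(a := l)) A) (\<tau> u) (\<tau> w)" for l u w
  define f where "f u = orth (q B - q A) (q (\<tau> u) - q A)" for u
  have \<tau>: "\<tau> x = x" "\<tau> y = y" "\<tau> z = z" "\<tau> u \<in> vertices s" for u using V by (auto simp: \<tau>_def)
  note nd' = nondegenerate_orth[OF nd[unfolded V(1)] V(2)]
  have vs: "A \<in> vertices s" "B \<in> vertices s" using V by auto
  have gBB: "gram L A B B \<noteq> 0" using gram_realizes[OF r vs(1,2,2)] nd'(3) by simp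
  have k0: "k (L a) = (\<lambda>u w. f u \<bullet> f w)"
    by (intro ext) (simp add: k_def f_def schur_gram_realizes[OF r vs \<tau>(4,4)])
  have ksym: "k l u w = k l w u" for l u w
    unfolding k_def by (rule schur_commute) (rule gram_commute)
  have kdiff: "(\<lambda>l. k l u w) field_differentiable at (L a)" for u w
    unfolding k_def by (intro differentiable_schur differentiable_gram) (use gBB in simp)
  have nf: "n \<bullet> f u = n \<bullet> (q (\<tau> u) - q A)" if "n \<bullet> (q B - q A) = 0" for n u
    using that by (simp add: f_def orth_def inner_diff_right[of n "q (\<tau> u) - q A"])
  have fe: "f u \<bullet> (q B - q A) = 0" for u by (simp add: f_def)
  have f3: "f x = orth (q B - q A) (q x - q A)" "f y = orth (q B - q A) (q y - q A)" "f z = orth (q B - q A) (q z - q A)"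
    by (simp_all add: f_def \<tau>)
  have ind: "indep3 (f x) (f y) (f z)" and sp: "spanning4 (q B - q A) (f x) (f y) (f z)"
    using nd' by (simp_all add: f3)
  have V2: "vertices s = {A, B, y, x, z}" "distinct [A, B, y, x, z]" "vertices s = {A, B, z, x, y}" "distinct [A, B, z, x, y]"
    using V by auto
  have D: "deriv (\<lambda>l. dihedral_of_lengths s ix (L(a := l))) (L a) = deriv (\<lambda>l. gram_angle (schur x (k l)) y z) (L a)"
    "deriv (\<lambda>l. dihedral_of_lengths s iy (L(a := l))) (L a) = deriv (\<lambda>l. gram_angle (schur y (k l)) x z) (L a)"
    "deriv (\<lambda>l. dihedral_of_lengths s iz (L(a := l))) (L a) = deriv (\<lambda>l. gram_angle (schur z (k l)) x y) (L a)"
    unfolding deriv_dihedral_of_lengths[OF r nd V a i(1)] deriv_dihedral_of_lengths[OF r nd V2(1,2) a i(2)]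
      deriv_dihedral_of_lengths[OF r nd V2(3,4) a i(3)]
    by (simp_all add: gram_angle_def schur_def[of x] schur_def[of y] schur_def[of z] k_def \<tau>)
  have P: "gram_angle (schur B (gram (L(a := l)) A)) y z = gram_angle (k l) y z"
    "gram_angle (schur B (gram (L(a := l)) A)) x z = gram_angle (k l) x z"
    "gram_angle (schur B (gram (L(a := l)) A)) x y = gram_angle (k l) x y" for l
    by (simp_all add: gram_angle_def k_def \<tau>)
  show ?thesis
    unfolding D P f3[symmetric]
    by (rule spherical_derivative[OF ksym kdiff k0 ind sp fe fe fe]) (simp_all add: nx ny nz nf \<tau>)
qed

subsection \<open>Facet normals\<close>

lemma det_rows_nonzero:
  assumes "spanning4 a b c d"
  shows "det_rows a b c d \<noteq> 0"
proof -
  let ?M = "vector [a, b, c, d] :: real^4^4"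
  have "x = 0" if "?M *v x = 0" for x
  proof (rule spanning4D[OF assms])
    have "(?M *v x) $ i = ?M $ i \<bullet> x" for i by (simp add: matrix_vector_mul_component)
    then have *: "?M $ i \<bullet> x = 0" for i using that by simp
    show "x \<bullet> a = 0" "x \<bullet> b = 0" "x \<bullet> c = 0" "x \<bullet> d = 0"
      using *[of 1] *[of 2] *[of 3] *[of 4] unfolding vector_4_nth by (simp_all add: inner_commute)
  qed
  then have "invertible ?M"
    unfolding invertible_left_inverse matrix_left_invertible_ker by blast
  then show ?thesis by (simp add: invertible_det_nz)
qed

text \<open>The four-dimensional analogue of the cross product.\<close>

definition row_functional :: "real^4 \<Rightarrow> real^4 \<Rightarrow> real^4 \<Rightarrow> real^4" where
  "row_functional b c d = (SOME n. \<forall>a. det_rows a b c d = a \<bullet> n)"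

lemma row_functional: "det_rows a b c d = a \<bullet> row_functional b c d"
proof -
  have "\<exists>n. \<forall>a. det_rows a b c d = a \<bullet> n" using det_row_functional[of b c d] by metis
  then show ?thesis unfolding row_functional_def by (rule someI2_ex) blast
qed

lemma row_functional_orth: "row_functional b c d \<bullet> b = 0" "row_functional b c d \<bullet> c = 0" "row_functional b c d \<bullet> d = 0"
  using row_functional[of b b c d] row_functional[of c b c d] row_functional[of d b c d] det_rows_equal
  by (simp_all add: inner_commute)

text \<open>Here \<open>b\<close>, \<open>c\<close>, \<open>d\<close> will be edge vectors of a
  facet and \<open>e\<close> will lead to the opposite vertex. The inward normal times the
  orientation sign does not depend on \<open>e\<close>; this makes different 4-simplices at one
  facet comparable. The proof compares inner products with all four vectors.\<close>

lemma unit_normal_eq: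
  fixes e b c d :: "real^4"
  assumes sp: "spanning4 e b c d"
    and n: "norm n = 1" "n \<bullet> b = 0" "n \<bullet> c = 0" "n \<bullet> d = 0" "n \<bullet> e > 0"
  shows "sgn (det_rows e b c d) *\<^sub>R n = sgn (row_functional b c d)"
proof -
  define m where "m = row_functional b c d"
  define D where "D = det_rows e b c d"
  have D: "D = m \<bullet> e" "D \<noteq> 0" using row_functional[of e b c d] det_rows_nonzero[OF sp] by (simp_all add: m_def D_def inner_commute)
  have m: "m \<bullet> b = 0" "m \<bullet> c = 0" "m \<bullet> d = 0" by (simp_all add: m_def row_functional_orth)
  have "D *\<^sub>R n - (n \<bullet> e) *\<^sub>R m = 0"
    by (rule spanning4D[OF sp]) (simp_all add: inner_diff_left n m D(1))
  then have eq: "D *\<^sub>R n = (n \<bullet> e) *\<^sub>R m" by simp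
  have "sgn (D *\<^sub>R n) = sgn D *\<^sub>R n" using n(1) by (simp add: sgn_scaleR sgn_div_norm)
  moreover have "sgn ((n \<bullet> e) *\<^sub>R m) = sgn m" using n(5) by (simp add: sgn_scaleR)
  ultimately show ?thesis using eq by (simp add: m_def D_def)
qed

lemma ex_unit_normal:
  fixes e b c d :: "real^4"
  assumes sp: "spanning4 e b c d"
  shows "\<exists>n. norm n = 1 \<and> n \<bullet> b = 0 \<and> n \<bullet> c = 0 \<and> n \<bullet> d = 0 \<and> n \<bullet> e > 0"
proof -
  define m where "m = row_functional b c d"
  have D: "m \<bullet> e \<noteq> 0" using row_functional[of e b c d] det_rows_nonzero[OF sp] by (simp add: m_def inner_commute)
  then have m0: "m \<noteq> 0" by auto
  have m: "m \<bullet> b = 0" "m \<bullet> c = 0" "m \<bullet> d = 0" by (simp_all add: m_def row_functional_orth)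
  let ?n = "sgn (m \<bullet> e) *\<^sub>R sgn m"
  have "norm ?n = 1" using D m0 by (simp add: norm_sgn)
  moreover have "?n \<bullet> v = sgn (m \<bullet> e) * (m \<bullet> v) / norm m" for v
    by (simp add: sgn_div_norm[of m] divide_inverse)
  moreover have "sgn (m \<bullet> e) * (m \<bullet> e) > 0" using D by (simp add: sgn_if)
  ultimately show ?thesis using m m0 by (intro exI[of _ ?n]) simp
qed

definition is_facet_normal :: "('a::euclidean_space \<Rightarrow> real^4) \<Rightarrow> 'a set \<Rightarrow> 'a set \<Rightarrow> real^4 \<Rightarrow> bool" where
  "is_facet_normal q s t n \<longleftrightarrow> norm n = 1 \<and> (\<forall>u\<in>vertices t. \<forall>w\<in>vertices t. n \<bullet> (q u - q w) = 0)
     \<and> (\<forall>u\<in>vertices s - vertices t. \<forall>w\<in>vertices t. n \<bullet> (q u - q w) > 0)"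

definition facet_normal :: "('a::euclidean_space \<Rightarrow> real^4) \<Rightarrow> 'a set \<Rightarrow> 'a set \<Rightarrow> real^4" where
  "facet_normal q s t = (SOME n. is_facet_normal q s t n)"

lemma is_facet_normal_iff:
  assumes "vertices s = {x, y0, y1, y2, y3}" "distinct [x, y0, y1, y2, y3]" "vertices t = {y0, y1, y2, y3}"
  shows "is_facet_normal q s t n \<longleftrightarrow> norm n = 1 \<and> n \<bullet> (q y1 - q y0) = 0 \<and> n \<bullet> (q y2 - q y0) = 0 \<and> n \<bullet> (q y3 - q y0) = 0
     \<and> n \<bullet> (q x - q y0) > 0"
proof -
  have V: "vertices s - vertices t = {x}" using assms by auto
  show ?thesis (is "_ \<longleftrightarrow> ?R")
  proof
    show ?R if "is_facet_normal q s t n"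
      using that unfolding is_facet_normal_def V unfolding assms(3) by blast
    assume R: ?R
    then have *: "n \<bullet> q u = n \<bullet> q y0" if "u \<in> vertices t" for u
      using that unfolding assms(3) inner_diff_right by auto
    show "is_facet_normal q s t n"
      unfolding is_facet_normal_def V using R by (auto simp: inner_diff_right *)
  qed
qed

text \<open>\<open>edge_det\<close> is based at \<open>x\<close>, whereas
  \<open>row_functional\<close> uses the base vertex \<open>y0\<close> of the facet; exchanging the
  two accounts for the minus sign. The right-hand side depends on the placed facet alone.\<close>

lemma facet_normal_eq:
  assumes "vertices s = {x, y0, y1, y2, y3}" "distinct [x, y0, y1, y2, y3]" "vertices t = {y0, y1, y2, y3}"
    and nd: "nondegenerate q (vertices s)"
  shows "is_facet_normal q s t (facet_normal q s t)"
    and "is_facet_normal q s t n \<Longrightarrow> sgn (edge_det (\<lambda>i. q ([x, y0, y1, y2, y3] ! i))) *\<^sub>R n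
      = - sgn (row_functional (q y1 - q y0) (q y2 - q y0) (q y3 - q y0))"
    and "is_facet_normal q s t n \<Longrightarrow> facet_normal q s t = n"
proof -
  note iff = is_facet_normal_iff[OF assms(1-3)]
  have "nondegenerate q {y0, x, y1, y2, y3}" "distinct [y0, x, y1, y2, y3]"
    using nd assms(1,2) by (auto simp: insert_commute)
  then have sp: "spanning4 (q x - q y0) (q y1 - q y0) (q y2 - q y0) (q y3 - q y0)"
    by (rule nondegenerate_frame)
  let ?D = "det_rows (q x - q y0) (q y1 - q y0) (q y2 - q y0) (q y3 - q y0)"
  have ed: "edge_det (\<lambda>i. q ([x, y0, y1, y2, y3] ! i)) = - ?D"
    unfolding edge_det_first by simp
  have *: "sgn ?D *\<^sub>R n = sgn (row_functional (q y1 - q y0) (q y2 - q y0) (q y3 - q y0))" if "is_facet_normal q s t n" for n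
    using unit_normal_eq[OF sp, of n] that unfolding iff by blast
  show "sgn (edge_det (\<lambda>i. q ([x, y0, y1, y2, y3] ! i))) *\<^sub>R n
      = - sgn (row_functional (q y1 - q y0) (q y2 - q y0) (q y3 - q y0))" if "is_facet_normal q s t n"
    using *[OF that] unfolding ed by (simp add: sgn_minus)
  show ex: "is_facet_normal q s t (facet_normal q s t)"
    unfolding facet_normal_def using ex_unit_normal[OF sp] by (intro someI_ex[of "is_facet_normal q s t"]) (simp add: iff)
  show "facet_normal q s t = n" if "is_facet_normal q s t n"
  proof -
    have "sgn ?D *\<^sub>R n = sgn ?D *\<^sub>R facet_normal q s t" using *[OF that] *[OF ex] by simp
    moreover have "sgn ?D \<noteq> 0" using det_rows_nonzero[OF sp] by (simp add: sgn_zero_iff)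
    ultimately show ?thesis by simp
  qed
qed

section \<open>Behaviour under motions\<close>

lemma orthogonal_matrix_inner:
  fixes A :: "real^4^4"
  assumes "orthogonal_matrix A"
  shows "(A *v v) \<bullet> (A *v w) = v \<bullet> w"
  using assms orthogonal_transformation_matrix[of "(*v) A"]
  by (simp add: orthogonal_transformation_def)

lemma is_facet_normal_motion:
  assumes "orthogonal_matrix A" "vertices t \<subseteq> vertices s"
    and q': "\<And>u. u \<in> vertices s \<Longrightarrow> q' u = A *v q u + w"
    and n: "is_facet_normal q s t n"
  shows "is_facet_normal q' s t (A *v n)"
proof -
  have d: "q' u - q' v = A *v (q u - q v)" if "u \<in> vertices s" "v \<in> vertices s" for u v
    using q' that by (simp add: matrix_vector_mult_diff_distrib)
  have norm: "norm (A *v n) = norm n"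
    by (simp add: norm_eq_sqrt_inner orthogonal_matrix_inner[OF assms(1)])
  show ?thesis
    unfolding is_facet_normal_def
  proof (intro conjI ballI)
    show "norm (A *v n) = 1" using n norm by (simp add: is_facet_normal_def)
    fix u v assume "u \<in> vertices t" "v \<in> vertices t"
    then show "(A *v n) \<bullet> (q' u - q' v) = 0"
      using n assms(2) by (subst d) (auto simp: is_facet_normal_def orthogonal_matrix_inner[OF assms(1)])
  next
    fix u v assume "u \<in> vertices s - vertices t" "v \<in> vertices t"
    then show "(A *v n) \<bullet> (q' u - q' v) > 0"
      using n assms(2) by (subst d) (auto simp: is_facet_normal_def orthogonal_matrix_inner[OF assms(1)])
  qed
qed

lemma orth_motion:
  fixes A :: "real^4^4"
  assumes "orthogonal_matrix A"
  shows "orth (A *v z) (A *v u) = A *v orth z u"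
  by (simp add: orth_def orthogonal_matrix_inner[OF assms] matrix_vector_mult_diff_distrib matrix_vector_mult_scaleR)

lemma edge_term_motion:
  fixes A :: "real^4^4"
  assumes "orthogonal_matrix A"
  shows "edge_term (A *v x + w) (A *v y + w) (A *v z + w) (A *v d) = edge_term x y z d"
proof -
  have n: "norm (A *v v) = norm v" for v
    by (simp add: norm_eq_sqrt_inner orthogonal_matrix_inner[OF assms])
  have "dist (A *v y + w) (A *v z + w) = dist y z"
    unfolding dist_norm using n[of "y - z"] by (simp add: matrix_vector_mult_diff_distrib)
  moreover have "A *v z + w - (A *v y + w) = A *v (z - y)" "A *v x + w - (A *v y + w) = A *v (x - y)"
    by (simp_all add: matrix_vector_mult_diff_distrib)
  ultimately show ?thesis
    unfolding edge_term_def by (simp only: orth_motion[OF assms] sgn_div_norm n)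
       (simp add: orthogonal_matrix_inner[OF assms])
qed

text \<open>\<open>orth w\<close> ignores multiples of \<open>w\<close> added to its argument and
  the sign of \<open>w\<close>, so either end of the edge may serve as origin. This frees
  \<open>triangle_term\<close> from the arbitrary listing of the edge.\<close>

lemma edge_term_commute: "edge_term x y z d = edge_term x z y d"
proof -
  have 1: "orth (- w) u = orth w u" for w u :: 'a by (simp add: orth_def)
  have 2: "orth w (u + w) = orth w u" for w u :: 'a
    by (cases "w = 0") (simp_all add: orth_def inner_add_left add_divide_distrib scaleR_add_left)
  have "orth (z - y) (x - y) = orth (z - y) (x - z)"
    using 2[of "z - y" "x - z"] by simp
  also have "\<dots> = orth (y - z) (x - z)" using 1[of "z - y" "x - z"] by simp
  finally show ?thesis by (simp add: edge_term_def dist_commute)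
qed

lemma dist_motion:
  fixes A :: "real^4^4"
  assumes "orthogonal_matrix A" "\<And>u. u \<in> V \<Longrightarrow> q' u = A *v q u + w" "i \<in> V" "j \<in> V"
  shows "dist (q' i) (q' j) = dist (q i) (q j)"
proof -
  have "q' i - q' j = A *v (q i - q j)" using assms(2-4) by (simp add: matrix_vector_mult_diff_distrib)
  then show ?thesis by (simp add: dist_norm norm_eq_sqrt_inner orthogonal_matrix_inner[OF assms(1)])
qed

subsection \<open>Sums over the manifold\<close>

lemma is_listing_length: "is_listing xs A \<Longrightarrow> length xs = card A"
  unfolding is_listing_def using distinct_card by metis

text \<open>With two elements the cancellation is direct. With more, any \<open>u\<close> has two
  companions \<open>v\<close> and \<open>w\<close>, and \<open>g u = - g v = g w = - g u\<close>
  makes every term zero. So tetrahedra with any number of cofaces from two on are covered.\<close>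

lemma sum_pairwise_cancel:
  fixes g :: "'b \<Rightarrow> real"
  assumes fin: "finite S" and two: "\<And>s. s \<in> S \<Longrightarrow> \<exists>s'\<in>S. s' \<noteq> s"
    and cancel: "\<And>s s'. s \<in> S \<Longrightarrow> s' \<in> S \<Longrightarrow> s \<noteq> s' \<Longrightarrow> g s + g s' = 0"
  shows "sum g S = 0"
proof (cases "S = {}")
  case False
  then obtain s where s: "s \<in> S" by blast
  obtain s' where s': "s' \<in> S" "s' \<noteq> s" using two[OF s] by blast
  show ?thesis
  proof (cases "S = {s, s'}")
    case True
    then show ?thesis using cancel[OF s s'(1)] s'(2) by simp
  next
    case False
    then obtain r where r: "r \<in> S" "r \<noteq> s" "r \<noteq> s'" using s s' by blast
    have "g u = 0" if u: "u \<in> S" for u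
    proof -
      obtain v w where "v \<in> S" "w \<in> S" "u \<noteq> v" "u \<noteq> w" "v \<noteq> w"
        using s s' r u by metis
      then show ?thesis using cancel[of u v] cancel[of u w] cancel[of v w] u by simp
    qed
    then show ?thesis by simp
  qed
qed simp

lemma subsets_remove_1:
  assumes "distinct [x, y, z]" "{x, y, z} \<inter> B = {}" "finite B"
  shows "{W. B \<subseteq> W \<and> W \<subseteq> B \<union> {x, y, z} \<and> card W = card B + 2} = {B \<union> {y, z}, B \<union> {x, z}, B \<union> {x, y}}" (is "?L = ?R")
proof
  have c: "card (B \<union> {u, v}) = card B + 2" if "u \<noteq> v" "u \<notin> B" "v \<notin> B" for u v
    using that assms(3) by simp
  show "?R \<subseteq> ?L" using assms(1,2) c by auto
  show "?L \<subseteq> ?R"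
  proof
    fix W assume "W \<in> ?L"
    then have W: "B \<subseteq> W" "W \<subseteq> B \<union> {x, y, z}" "card W = card B + 2" by auto
    have "card (B \<union> {x, y, z}) = card B + 3" using assms by simp
    then have "card (B \<union> {x, y, z} - W) = 1" using W assms(3) by (subst card_Diff_subset) (auto intro: finite_subset)
    then obtain v where v: "B \<union> {x, y, z} - W = {v}" by (auto simp: card_1_singleton_iff)
    then have "v \<in> {x, y, z}" using W(1) by blast
    moreover have "W = B \<union> {x, y, z} - {v}" using v W(2) by blast
    ultimately show "W \<in> ?R" using assms(1,2) by auto
  qed
qed

lemma subsets_add_1:
  assumes "distinct [x, y, z]" "{x, y, z} \<inter> B = {}" "finite B"
  shows "{W. B \<subseteq> W \<and> W \<subseteq> B \<union> {x, y, z} \<and> card W = card B + 1} = {insert x B, insert y B, insert z B}" (is "?L = ?R")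
proof
  show "?R \<subseteq> ?L" using assms by auto
  show "?L \<subseteq> ?R"
  proof
    fix W assume "W \<in> ?L"
    then have W: "B \<subseteq> W" "W \<subseteq> B \<union> {x, y, z}" "card W = card B + 1" by auto
    then have "card (W - B) = 1" using assms(3) by (subst card_Diff_subset) auto
    then obtain v where v: "W - B = {v}" by (auto simp: card_1_singleton_iff)
    then have "v \<in> {x, y, z}" "W = insert v B" using W by auto
    then show "W \<in> ?R" by auto
  qed
qed

section \<open>The placed manifold and independence of the chosen lifts\<close>

locale placed_manifold =
  fixes K :: "'a::euclidean_space set set"
    and orient :: "'a list \<Rightarrow> int"
    and E :: "'e::real_normed_vector set"
    and p :: "'e \<Rightarrow> 'a"
    and \<rho> :: "('e \<Rightarrow> 'e) \<Rightarrow> real^4 \<Rightarrow> real^4"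
    and f :: "'e \<Rightarrow> real^4"
  assumes complex: "simplicial_complex K"
    and manifold: "closed_pl_4_manifold (\<Union>K)"
    and orientation: "orientation K orient"
    and cover: "universal_cover E p (\<Union>K)"
    and placement: "placement K E p \<rho> f"
begin

abbreviation "pos \<equiv> placed p f"
abbreviation "L \<equiv> squared_length E p f"
abbreviation "sgn_of \<equiv> simplex_sign orient E p f"

lemma cov: "covering_space E p (\<Union>K)" and sc: "simply_connected E"
  using cover by (simp_all add: universal_cover_def)

lemma lpc: "locally path_connected (\<Union>K)"
  by (rule locally_path_connected_if_charts[OF manifold])

lemmas simplexD = simplicesD[OF complex]

lemma some_lift: "s \<in> simplices K n \<Longrightarrow> some_lift E p s \<in> lifts E p s"
  by (rule some_lift_in_lifts[OF cov]) (simp_all add: simplexD)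

lemma lift_of_face:
  assumes "s \<in> simplices K n" "c \<in> lifts E p s" "t \<in> simplices K m" "t \<subseteq> s"
  shows "c \<inter> p -` t \<in> lifts E p t" and "u \<in> t \<Longrightarrow> pos (c \<inter> p -` t) u = pos c u"
proof -
  note S = simplexD[OF assms(1)] and T = simplexD[OF assms(3)]
  show "c \<inter> p -` t \<in> lifts E p t" by (rule lift_face[OF cov S(6,7) assms(2,4) T(6,8)])
  show "u \<in> t \<Longrightarrow> pos (c \<inter> p -` t) u = pos c u"
    unfolding placed_def using the_inv_into_face[OF cov S(6,7) assms(2,4)] by simp
qed

lemma coface_lift:
  assumes "s \<in> simplices K n" "t \<in> simplices K m" "t \<subseteq> s" "d \<in> lifts E p t"
  obtains c where "c \<in> lifts E p s" "c \<inter> p -` t = d"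
  using lift_coface[OF cov] simplexD[OF assms(1)] simplexD[OF assms(2)] assms(3,4) by metis

text \<open>Equivariance of the placement and of the deviations enters here. Two lifts differ by a
  deck transformation, which acts on positions by a proper motion and on deviations by its linear
  part.\<close>

lemma lifts_motion:
  assumes s: "s \<in> simplices K n" and c: "c \<in> lifts E p s" "c' \<in> lifts E p s"
  obtains A w where "orthogonal_matrix A" "det A = 1"
    "\<And>u. u \<in> vertices s \<Longrightarrow> pos c' u = A *v pos c u + w"
    "\<And>dv e. dv \<in> edge_deviations K E p \<rho> f \<Longrightarrow> e \<in> simplices K 1 \<Longrightarrow> e \<subseteq> s \<Longrightarrow> dv (c' \<inter> p -` e) = A *v dv (c \<inter> p -` e)"
proof -
  note S = simplexD[OF s]
  obtain g where g: "g \<in> carrier (deck_group E p)" "c' = g ` c"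
    "\<And>u. u \<in> s \<Longrightarrow> the_inv_into c' p u = g (the_inv_into c p u)"
    by (rule lifts_related[OF cov sc lpc S(6,7) c]) blast
  have hom: "\<rho> \<in> hom (deck_group E p) motion_group"
    and eqv: "\<And>x. x \<in> E \<Longrightarrow> {p x} \<in> K \<Longrightarrow> f (g x) = \<rho> g (f x)"
    using placement g(1) unfolding placement_def by blast+
  have "\<rho> g \<in> carrier motion_group" using hom g(1) by (auto simp: hom_def)
  then obtain A w where A: "rotation_matrix A" "\<rho> g = (\<lambda>x. A *v x + w)"
    unfolding motion_group_def by auto
  have cE: "c \<subseteq> E" "c \<subseteq> p -` s" using lifts_subset[OF cov c(1)] by auto
  note G = deck_groupD[OF cov g(1)]
  note sect = lift_section[OF cov S(6,7) c(1)]
  show ?thesis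
  proof (rule that[of A w])
    show "orthogonal_matrix A" "det A = 1" using A(1) by (simp_all add: rotation_matrix_def)
    fix u assume u: "u \<in> vertices s"
    then have us: "u \<in> s" using vertices_subset by blast
    have v: "the_inv_into c p u \<in> c" "p (the_inv_into c p u) = u"
      using sect us by (auto intro: the_inv_into_into f_the_inv_into_f)
    \<comment> \<open>\<open>placement\<close> demands equivariance only at points lying over
      vertices of \<open>K\<close>.\<close>
    have "{u} \<in> K" using vertex_in_complex[OF complex s u] .
    then show "pos c' u = A *v pos c u + w"
      unfolding placed_def g(3)[OF us] using eqv[of "the_inv_into c p u"] v cE(1) A(2) by auto
  next
    fix dv e assume dv: "dv \<in> edge_deviations K E p \<rho> f" and e: "e \<in> simplices K 1" "e \<subseteq> s"
    have pg: "p (g x) = p x" if "x \<in> c" for x using G(3) cE(1) that by blast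
    have eq: "c' \<inter> p -` e = g ` (c \<inter> p -` e)" unfolding g(2) using pg by auto
    have "dv (g ` (c \<inter> p -` e)) = \<rho> g (dv (c \<inter> p -` e)) - \<rho> g 0"
      using dv e(1) g(1) lift_of_face(1)[OF s c(1) e] unfolding edge_deviations_def by blast
    then show "dv (c' \<inter> p -` e) = A *v dv (c \<inter> p -` e)" unfolding eq A(2) by simp
  qed
qed

lemma deviation_orth:
  assumes "dv \<in> edge_deviations K E p \<rho> f" and s: "s \<in> simplices K n" "c \<in> lifts E p s"
    and e: "e \<in> simplices K 1" "e \<subseteq> s" "u \<in> vertices e" "v \<in> vertices e"
  shows "dv (c \<inter> p -` e) \<bullet> (pos c u - pos c v) = 0"
proof -
  have l: "c \<inter> p -` e \<in> lifts E p e" by (rule lift_of_face[OF s e(1,2)])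
  have "u \<in> e" "v \<in> e" using e vertices_subset by blast+
  then have "pos (c \<inter> p -` e) u = pos c u" "pos (c \<inter> p -` e) v = pos c v"
    using lift_of_face(2)[OF s e(1,2)] by blast+
  moreover have "dv (c \<inter> p -` e) \<bullet> (pos (c \<inter> p -` e) u - pos (c \<inter> p -` e) v) = 0"
    using assms(1) e l unfolding edge_deviations_def by blast
  ultimately show ?thesis by simp
qed

lemma placed_nondegenerate: "s \<in> simplices K 4 \<Longrightarrow> c \<in> lifts E p s \<Longrightarrow> nondegenerate (pos c) (vertices s)"
  using placement unfolding placement_def nondegenerate_def by blast

lemma edge_in_simplices:
  assumes "s \<in> simplices K n" "u \<in> vertices s" "w \<in> vertices s" "u \<noteq> w"
  shows "closed_segment u w \<in> simplices K 1" "vertices (closed_segment u w) = {u, w}" "closed_segment u w \<subseteq> s"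
  using convex_hull_in_simplices[OF complex assms(1), of "{u, w}" 1] assms by (simp_all add: segment_convex_hull)

lemma placed_realizes:
  assumes s: "s \<in> simplices K n" and c: "c \<in> lifts E p s"
  shows "realizes (pos c) s L"
  unfolding realizes_def
proof (intro ballI impI)
  fix u w assume uw: "u \<in> vertices s" "w \<in> vertices s" "u \<noteq> w"
  let ?e = "closed_segment u w"
  note e = edge_in_simplices[OF s uw]
  let ?d = "some_lift E p ?e"
  obtain A v where A: "orthogonal_matrix A" "\<And>u. u \<in> vertices ?e \<Longrightarrow> pos ?d u = A *v pos (c \<inter> p -` ?e) u + v"
    by (rule lifts_motion[OF e(1) lift_of_face(1)[OF s c e(1,3)] some_lift[OF e(1)]]) blast
  have "dist (pos ?d u) (pos ?d w) = dist (pos (c \<inter> p -` ?e) u) (pos (c \<inter> p -` ?e) w)"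
    by (rule dist_motion[where V="{u, w}", OF A(1)]) (use A(2) e(2) in auto)
  also have "\<dots> = dist (pos c u) (pos c w)"
    using lift_of_face(2)[OF s c e(1,3)] by simp
  finally have "dist (pos ?d u) (pos ?d w) = dist (pos c u) (pos c w)" .
  moreover have "listing {u, w} = [u, w] \<or> listing {u, w} = [w, u]" by (rule listing_doubleton[OF uw(3)])
  ultimately show "(dist (pos c u) (pos c w))\<^sup>2 = L ?e"
    unfolding squared_length_def Let_def e(2) by (auto simp: dist_commute)
qed

text \<open>Relisting the vertices multiplies both \<open>orient\<close> and the determinant by the
  sign of the permutation; another lift changes the placement by a motion of determinant 1, which
  preserves \<open>edge_det\<close>.\<close>

lemma simplex_sign_eq:
  assumes s: "s \<in> simplices K 4" and c: "c \<in> lifts E p s" and xs: "is_listing xs (vertices s)"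
  shows "sgn_of s = of_int (orient xs) * sgn (edge_det (\<lambda>i. pos c (xs ! i)))"
proof -
  note S = simplexD[OF s]
  let ?d = "some_lift E p s"
  let ?ys = "listing (vertices s)"
  have ys: "is_listing ?ys (vertices s)" by (rule is_listing_listing[OF S(3)])
  have len: "length xs = 5" "length ?ys = 5"
    using is_listing_length[OF xs] is_listing_length[OF ys] S(4) by simp_all
  obtain A w where A: "det A = 1" "\<And>u. u \<in> vertices s \<Longrightarrow> pos c u = A *v pos ?d u + w"
    by (rule lifts_motion[OF s some_lift[OF s] c]) blast
  have "mset xs = mset ?ys"
    using xs ys unfolding is_listing_def by (metis mset_set_set)
  then obtain \<pi> where \<pi>: "\<pi> permutes {..<length ?ys}" "permute_list \<pi> ?ys = xs"
    by (rule mset_eq_permutation)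
  have "edge_det (\<lambda>i. pos c (xs ! i)) = edge_det (\<lambda>i. pos ?d (xs ! i))"
  proof (rule edge_det_motion[OF A(1)])
    fix i :: nat assume "i < 5"
    then have "xs ! i \<in> set xs" using len(1) by (intro nth_mem) simp
    then have "xs ! i \<in> vertices s" using xs unfolding is_listing_def by simp
    then show "pos c (xs ! i) = A *v pos ?d (xs ! i) + w" by (rule A(2))
  qed
  also have "\<dots> = edge_det ((\<lambda>i. pos ?d (?ys ! i)) \<circ> \<pi>)"
    using \<pi> len by (intro edge_det_cong) (auto simp: permute_list_nth)
  also have "\<dots> = of_int (sign \<pi>) * edge_det (\<lambda>i. pos ?d (?ys ! i))"
    using \<pi>(1) len by (intro edge_det_permute) simp
  finally have ed: "edge_det (\<lambda>i. pos c (xs ! i)) = of_int (sign \<pi>) * edge_det (\<lambda>i. pos ?d (?ys ! i))" .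
  have "orient xs = sign \<pi> * orient ?ys"
    using orientation s ys \<pi> unfolding orientation_def by metis
  moreover have "sgn (of_int (sign \<pi>) :: real) = of_int (sign \<pi>)" by (simp add: sign_def)
  moreover have "of_int (sign \<pi>) * of_int (sign \<pi>) = (1 :: real)" by (simp add: sign_def)
  ultimately have "of_int (orient xs) * sgn (edge_det (\<lambda>i. pos c (xs ! i)))
     = of_int (orient ?ys) * sgn (edge_det (\<lambda>i. pos ?d (?ys ! i)))"
    unfolding ed by (simp add: sgn_mult mult.assoc mult.left_commute)
  then show ?thesis unfolding simplex_sign_def Let_def edge_det_def by simp
qed

text \<open>The component of the deviation of \<open>b\<close> along the normal of \<open>t\<close>
  pointing into \<open>s\<close>. It is written with the chosen lift of \<open>s\<close>;
  \<open>flux_lift\<close> shows that any lift gives the same number.\<close>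

definition flux :: "('e set \<Rightarrow> real^4) \<Rightarrow> 'a set \<Rightarrow> 'a set \<Rightarrow> 'a set \<Rightarrow> real" where
  "flux dv s t b = facet_normal (pos (some_lift E p s)) s t \<bullet> dv (some_lift E p s \<inter> p -` b)"

lemma facet_split:
  assumes s: "s \<in> simplices K 4" and t: "t \<in> simplices K 3" "t \<subseteq> s" and ys: "is_listing ys (vertices t)"
  obtains x y0 y1 y2 y3 where "ys = [y0, y1, y2, y3]" "vertices s = {x, y0, y1, y2, y3}"
    "distinct [x, y0, y1, y2, y3]" "vertices t = {y0, y1, y2, y3}" "is_listing (x # ys) (vertices s)"
proof -
  note S = simplexD[OF s] and T = simplexD[OF t(1)]
  have sub: "vertices t \<subseteq> vertices s" by (rule vertices_mono[OF complex s T(1) t(2)])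
  then have "card (vertices s - vertices t) = 1" using S(3,4) T(3,4) by (simp add: card_Diff_subset)
  then obtain x where x: "vertices s - vertices t = {x}" by (auto simp: card_1_singleton_iff)
  have "length ys = 4" using ys T(4) distinct_card unfolding is_listing_def by fastforce
  then obtain y0 y1 y2 y3 where y: "ys = [y0, y1, y2, y3]"
    by (auto simp: numeral_eq_Suc length_Suc_conv)
  have vt: "vertices t = {y0, y1, y2, y3}" "distinct ys" using ys y by (auto simp: is_listing_def)
  have vs: "vertices s = {x, y0, y1, y2, y3}" using x sub vt by auto
  have "x \<notin> vertices t" using x by blast
  then have d: "distinct [x, y0, y1, y2, y3]" using vt y by auto
  then have "is_listing (x # ys) (vertices s)" using vs y by (auto simp: is_listing_def)
  then show ?thesis using that y vs d vt(1) by blast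
qed

lemma flux_lift:
  assumes dv: "dv \<in> edge_deviations K E p \<rho> f" and s: "s \<in> simplices K 4" and c: "c \<in> lifts E p s"
    and t: "t \<in> simplices K 3" "t \<subseteq> s" and b: "b \<in> simplices K 1" "b \<subseteq> t"
  shows "flux dv s t b = facet_normal (pos c) s t \<bullet> dv (c \<inter> p -` b)"
proof -
  note T = simplexD[OF t(1)]
  let ?d = "some_lift E p s"
  obtain A w where A: "orthogonal_matrix A" "\<And>u. u \<in> vertices s \<Longrightarrow> pos c u = A *v pos ?d u + w"
    "dv (c \<inter> p -` b) = A *v dv (?d \<inter> p -` b)"
    by (rule lifts_motion[OF s some_lift[OF s] c]) (use dv b t in blast)
  obtain x y0 y1 y2 y3 where v: "vertices s = {x, y0, y1, y2, y3}"
    "distinct [x, y0, y1, y2, y3]" "vertices t = {y0, y1, y2, y3}"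
    by (rule facet_split[OF s t is_listing_listing[OF T(3)]])
  have "is_facet_normal (pos c) s t (A *v facet_normal (pos ?d) s t)"
    by (rule is_facet_normal_motion[OF A(1) _ A(2)])
      (use facet_normal_eq(1)[OF v placed_nondegenerate[OF s some_lift[OF s]]] v in auto)
  then have "facet_normal (pos c) s t = A *v facet_normal (pos ?d) s t"
    by (rule facet_normal_eq(3)[OF v placed_nondegenerate[OF s c]])
  then show ?thesis unfolding flux_def A(3) by (simp add: orthogonal_matrix_inner[OF A(1)])
qed

text \<open>Both 4-simplices are lifted so as to contain the same lift \<open>d\<close> of
  \<open>t\<close>. Each signed flux is then minus an orientation value times one number attached to
  \<open>d\<close>, and the orientation condition makes the two values opposite.\<close>

lemma flux_cancel_pair:
  assumes dv: "dv \<in> edge_deviations K E p \<rho> f"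
    and s: "s \<in> simplices K 4" "t \<subseteq> s" and s': "s' \<in> simplices K 4" "t \<subseteq> s'" and ne: "s \<noteq> s'"
    and t: "t \<in> simplices K 3" and b: "b \<in> simplices K 1" "b \<subseteq> t"
  shows "sgn_of s * flux dv s t b + sgn_of s' * flux dv s' t b = 0"
proof -
  note T = simplexD[OF t]
  define d where "d = some_lift E p t"
  have d: "d \<in> lifts E p t" unfolding d_def by (rule some_lift[OF t])
  define ys where "ys = listing (vertices t)"
  have ys: "is_listing ys (vertices t)" unfolding ys_def by (rule is_listing_listing[OF T(3)])
  \<comment> \<open>The vector \<open>m\<close> is built from the placed tetrahedron alone, so it is
    common to both 4-simplices.\<close>
  define m where "m = sgn (row_functional (pos d (ys ! 1) - pos d (ys ! 0)) (pos d (ys ! 2) - pos d (ys ! 0)) (pos d (ys ! 3) - pos d (ys ! 0)))"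
  have one: "\<exists>x. is_listing (x # ys) (vertices s) \<and> sgn_of s * flux dv s t b = - of_int (orient (x # ys)) * (m \<bullet> dv (d \<inter> p -` b))"
    if s: "s \<in> simplices K 4" "t \<subseteq> s" for s
  proof -
    obtain c where c: "c \<in> lifts E p s" "c \<inter> p -` t = d" by (rule coface_lift[OF s(1) t s(2) d])
    obtain x y0 y1 y2 y3 where v: "ys = [y0, y1, y2, y3]" "vertices s = {x, y0, y1, y2, y3}"
      "distinct [x, y0, y1, y2, y3]" "vertices t = {y0, y1, y2, y3}" "is_listing (x # ys) (vertices s)"
      by (rule facet_split[OF s(1) t s(2) ys])
    have pd: "pos c u = pos d u" if "u \<in> vertices t" for u
      using lift_of_face(2)[OF s(1) c(1) t s(2), of u] that vertices_subset c(2) by force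
    have db: "d \<inter> p -` b = c \<inter> p -` b" using c(2) b(2) by blast
    note n = facet_normal_eq[OF v(2-4) placed_nondegenerate[OF s(1) c(1)]]
    have "sgn (edge_det (\<lambda>i. pos c ((x # ys) ! i))) *\<^sub>R facet_normal (pos c) s t = - m"
      using n(2)[OF n(1)] unfolding m_def v(1) by (simp add: pd v(4))
    then have "sgn (edge_det (\<lambda>i. pos c ((x # ys) ! i))) * (facet_normal (pos c) s t \<bullet> dv (d \<inter> p -` b)) = - (m \<bullet> dv (d \<inter> p -` b))"
      by (metis inner_minus_left inner_scaleR_left)
    then have "sgn_of s * flux dv s t b = - of_int (orient (x # ys)) * (m \<bullet> dv (d \<inter> p -` b))"
      unfolding simplex_sign_eq[OF s(1) c(1) v(5)] flux_lift[OF dv s(1) c(1) t s(2) b] db[symmetric]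
      by (simp only: mult.assoc mult_minus_left mult_minus_right)
    then show ?thesis using v(5) by blast
  qed
  obtain x where x: "is_listing (x # ys) (vertices s)" "sgn_of s * flux dv s t b = - of_int (orient (x # ys)) * (m \<bullet> dv (d \<inter> p -` b))"
    using one[OF s] by blast
  obtain x' where x': "is_listing (x' # ys) (vertices s')" "sgn_of s' * flux dv s' t b = - of_int (orient (x' # ys)) * (m \<bullet> dv (d \<inter> p -` b))"
    using one[OF s'] by blast
  have "orient (x # ys) = - orient (x' # ys)"
    using orientation s(1) s'(1) ne x(1) x'(1) unfolding orientation_def by metis
  then show ?thesis unfolding x(2) x'(2) by simp
qed

lemma flux_cancel:
  assumes dv: "dv \<in> edge_deviations K E p \<rho> f" and t: "t \<in> simplices K 3" and b: "b \<in> simplices K 1" "b \<subseteq> t"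
  shows "(\<Sum>s\<in>{s \<in> simplices K 4. t \<subseteq> s}. sgn_of s * flux dv s t b) = 0"
proof (rule sum_pairwise_cancel)
  show "finite {s \<in> simplices K 4. t \<subseteq> s}" using finite_simplices[OF complex] by simp
  show "\<exists>s'\<in>{s \<in> simplices K 4. t \<subseteq> s}. s' \<noteq> s" if "s \<in> {s \<in> simplices K 4. t \<subseteq> s}" for s
    using no_boundary_face[OF complex manifold t, of s] that by blast
  show "sgn_of s * flux dv s t b + sgn_of s' * flux dv s' t b = 0"
    if "s \<in> {s \<in> simplices K 4. t \<subseteq> s}" "s' \<in> {s \<in> simplices K 4. t \<subseteq> s}" "s \<noteq> s'" for s s'
    using flux_cancel_pair[OF dv _ _ _ _ that(3) t b] that(1,2) by blast
qed

section \<open>The local identity around an edge of one 4-simplex\<close>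

lemma sum_faces:
  assumes s: "s \<in> simplices K n"
  shows "(\<Sum>i\<in>{i \<in> simplices K m. B \<subseteq> vertices i \<and> i \<subseteq> s}. h i)
    = (\<Sum>W\<in>{W. B \<subseteq> W \<and> W \<subseteq> vertices s \<and> card W = Suc m}. h (convex hull W))"
proof (rule sum.reindex_bij_witness[where j=vertices and i="\<lambda>W. convex hull W"])
  fix i assume i: "i \<in> {i \<in> simplices K m. B \<subseteq> vertices i \<and> i \<subseteq> s}"
  then have I: "i \<in> simplices K m" "i \<subseteq> s" by auto
  show "convex hull (vertices i) = i" by (rule simplexD(5)[OF I(1)])
  then show "h (convex hull (vertices i)) = h i" by simp
  show "vertices i \<in> {W. B \<subseteq> W \<and> W \<subseteq> vertices s \<and> card W = Suc m}"
    using i simplexD(4)[OF I(1)] vertices_mono[OF complex s simplexD(1)[OF I(1)] I(2)] by auto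
next
  fix W assume "W \<in> {W. B \<subseteq> W \<and> W \<subseteq> vertices s \<and> card W = Suc m}"
  then have W: "B \<subseteq> W" "W \<subseteq> vertices s" "card W = Suc m" by auto
  note H = convex_hull_in_simplices[OF complex s W(2,3)]
  show "vertices (convex hull W) = W" by (rule H(2))
  show "convex hull W \<in> {i \<in> simplices K m. B \<subseteq> vertices i \<and> i \<subseteq> s}" using H W by auto
qed

definition triangle_term :: "('e set \<Rightarrow> real^4) \<Rightarrow> 'e set \<Rightarrow> 'a set \<Rightarrow> 'a set \<Rightarrow> real" where
  "triangle_term dv c i b = edge_term (pos c (the_elem (vertices i - vertices b)))
     (pos c (listing (vertices b) ! 0)) (pos c (listing (vertices b) ! 1)) (dv (c \<inter> p -` b))"

lemma triangle_term_eq: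
  assumes "vertices i = {x, y, z}" "distinct [x, y, z]" "vertices b = {y, z}"
  shows "triangle_term dv c i b = edge_term (pos c x) (pos c y) (pos c z) (dv (c \<inter> p -` b))"
proof -
  have "vertices i - vertices b = {x}" using assms by auto
  moreover have "listing (vertices b) = [y, z] \<or> listing (vertices b) = [z, y]"
    unfolding assms(3) by (rule listing_doubleton) (use assms(2) in simp)
  ultimately show ?thesis unfolding triangle_term_def using edge_term_commute by auto
qed

lemma sum_triangle_edges:
  assumes i: "i \<in> simplices K 2" and v: "vertices i = {x, y, z}" "distinct [x, y, z]"
  shows "(\<Sum>b\<in>{b \<in> simplices K 1. b \<subseteq> i}. h b) = h (closed_segment y z) + h (closed_segment z x) + h (closed_segment x y)"
proof -
  have "(\<Sum>b\<in>{b \<in> simplices K 1. b \<subseteq> i}. h b) = (\<Sum>b\<in>{b \<in> simplices K 1. {} \<subseteq> vertices b \<and> b \<subseteq> i}. h b)" by simp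
  also have "\<dots> = (\<Sum>W\<in>{{y, z}, {x, z}, {x, y}}. h (convex hull W))"
    unfolding sum_faces[OF i] v(1) using subsets_remove_1[OF v(2), of "{}"] by (simp add: numeral_2_eq_2)
  also have "\<dots> = h (convex hull {y, z}) + h (convex hull {x, z}) + h (convex hull {x, y})"
  proof -
    have "{y, z} \<noteq> {x, z}" "{y, z} \<noteq> {x, y}" "{x, z} \<noteq> {x, y}" using v(2) by (auto simp: doubleton_eq_iff)
    then show ?thesis by (simp add: add.assoc)
  qed
  finally show ?thesis by (simp add: segment_convex_hull insert_commute)
qed

text \<open>\<open>area_map\<close> works in the chosen lift of the triangle. A motion relates that
  lift to the one cut out of \<open>c\<close> and leaves every edge term unchanged, so the area
  differential can be computed separately inside each 4-simplex containing the triangle.\<close>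

lemma area_map_eq:
  assumes dv: "dv \<in> edge_deviations K E p \<rho> f" and s: "s \<in> simplices K 4" and c: "c \<in> lifts E p s"
    and i: "i \<in> simplices K 2" "i \<subseteq> s"
  shows "area_map K E p f dv i = - (\<Sum>b\<in>{b \<in> simplices K 1. b \<subseteq> i}. triangle_term dv c i b)"
proof -
  note S = simplexD[OF s] and I = simplexD[OF i(1)]
  define d where "d = some_lift E p i"
  have d: "d \<in> lifts E p i" unfolding d_def by (rule some_lift[OF i(1)])
  have ci: "c \<inter> p -` i \<in> lifts E p i" by (rule lift_of_face[OF s c i])
  obtain M w where M: "orthogonal_matrix M" "\<And>u. u \<in> vertices i \<Longrightarrow> pos d u = M *v pos (c \<inter> p -` i) u + w"
    "\<And>e. e \<in> simplices K 1 \<Longrightarrow> e \<subseteq> i \<Longrightarrow> dv (d \<inter> p -` e) = M *v dv (c \<inter> p -` i \<inter> p -` e)"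
    by (rule lifts_motion[OF i(1) ci d]) (use dv in blast)
  have Mp: "pos d u = M *v pos c u + w" if "u \<in> vertices i" for u
  proof -
    have "u \<in> i" using that vertices_subset by blast
    then show ?thesis using M(2)[OF that] lift_of_face(2)[OF s c i] by simp
  qed
  have Md: "dv (d \<inter> p -` e) = M *v dv (c \<inter> p -` e)" if "e \<in> simplices K 1" "e \<subseteq> i" for e
  proof -
    have "c \<inter> p -` i \<inter> p -` e = c \<inter> p -` e" using that(2) by blast
    then show ?thesis using M(3)[OF that] by simp
  qed
  have lst: "is_listing (listing (vertices i)) (vertices i)" by (rule is_listing_listing[OF I(3)])
  then have "length (listing (vertices i)) = 3" using is_listing_length[OF lst] I(4) by simp
  then obtain x y z where xyz: "listing (vertices i) = [x, y, z]"
    by (auto simp: numeral_eq_Suc length_Suc_conv)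
  then have v: "vertices i = {x, y, z}" "distinct [x, y, z]" using lst by (auto simp: is_listing_def)
  have viv: "vertices i \<subseteq> vertices s" by (rule vertices_mono[OF complex s I(1) i(2)])
  have "card (vertices s - vertices i) = 2" using S(3,4) I(3,4) viv by (simp add: card_Diff_subset)
  then obtain t u where tu: "vertices s - vertices i = {t, u}" "t \<noteq> u" by (auto simp: card_2_iff)
  then have vs: "vertices s = {x, y, z, t, u}" "distinct [x, y, z, t, u]" using v viv by auto
  \<comment> \<open>The triangle inherits nondegeneracy from the 4-simplex; its positive Gram
    determinant is needed for differentiating the square root in the area.\<close>
  have ind4: "indep4 (pos c y - pos c x) (pos c z - pos c x) (pos c t - pos c x) (pos c u - pos c x)"
    using nondegenerate_frame(1)[OF _ vs(2)] placed_nondegenerate[OF s c] vs(1) by simp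
  have "indep3 (pos c y - pos c x) (pos c z - pos c x) (pos c t - pos c x)"
    unfolding indep3_def
  proof (intro allI impI)
    fix k l m assume "k *\<^sub>R (pos c y - pos c x) + l *\<^sub>R (pos c z - pos c x) + m *\<^sub>R (pos c t - pos c x) = 0"
    then have "k *\<^sub>R (pos c y - pos c x) + l *\<^sub>R (pos c z - pos c x) + m *\<^sub>R (pos c t - pos c x) + 0 *\<^sub>R (pos c u - pos c x) = 0" by simp
    from ind4[unfolded indep4_def, rule_format, OF this] show "k = 0 \<and> l = 0 \<and> m = 0" by blast
  qed
  then have "posdef3 (\<lambda>a b. (pos c a - pos c x) \<bullet> (pos c b - pos c x)) y z t"
    by (rule posdef3_inner[where f="\<lambda>a. pos c a - pos c x"])
  then have G: "((pos c y - pos c x) \<bullet> (pos c y - pos c x)) * ((pos c z - pos c x) \<bullet> (pos c z - pos c x))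
     - ((pos c y - pos c x) \<bullet> (pos c z - pos c x))\<^sup>2 > 0"
    by (simp only: posdef3_def det2_def)
  have diff: "pos d k - pos d l = M *v (pos c k - pos c l)" if "k \<in> vertices i" "l \<in> vertices i" for k l
    using that Mp by (simp add: matrix_vector_mult_diff_distrib)
  have G': "((pos d y - pos d x) \<bullet> (pos d y - pos d x)) * ((pos d z - pos d x) \<bullet> (pos d z - pos d x))
     - ((pos d y - pos d x) \<bullet> (pos d z - pos d x))\<^sup>2 > 0"
    using G v by (simp add: diff orthogonal_matrix_inner[OF M(1)])
  note e = edge_in_simplices[OF i(1)]
  have vv: "x \<in> vertices i" "y \<in> vertices i" "z \<in> vertices i" "x \<noteq> y" "y \<noteq> z" "z \<noteq> x" using v by auto
  have o: "dv (d \<inter> p -` closed_segment k l) \<bullet> (pos d l - pos d k) = 0" if "k \<in> vertices i" "l \<in> vertices i" "k \<noteq> l" for k l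
    by (rule deviation_orth[OF dv i(1) d e(1,3)[OF that]]) (simp_all add: e(2)[OF that])
  have "area_map K E p f dv i = frechet_derivative
     (\<lambda>(x', y', z'). 4 * triangle_area (midpoint (pos d y) (pos d z) + x') (midpoint (pos d z) (pos d x) + y') (midpoint (pos d x) (pos d y) + z')
         - triangle_area (pos d x) (pos d y) (pos d z)) (at 0)
     (dv (d \<inter> p -` closed_segment y z), dv (d \<inter> p -` closed_segment z x), dv (d \<inter> p -` closed_segment x y))"
    unfolding area_map_def Let_def d_def[symmetric] xyz using i(1) by simp
  also have "\<dots> = - (edge_term (pos d x) (pos d y) (pos d z) (dv (d \<inter> p -` closed_segment y z))
      + edge_term (pos d y) (pos d z) (pos d x) (dv (d \<inter> p -` closed_segment z x))
      + edge_term (pos d z) (pos d x) (pos d y) (dv (d \<inter> p -` closed_segment x y)))"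
    by (rule area_derivative[OF G' o[OF vv(2,3,5)] o[OF vv(3,1,6)] o[OF vv(1,2,4)]])
  also have "\<dots> = - (edge_term (pos c x) (pos c y) (pos c z) (dv (c \<inter> p -` closed_segment y z))
      + edge_term (pos c y) (pos c z) (pos c x) (dv (c \<inter> p -` closed_segment z x))
      + edge_term (pos c z) (pos c x) (pos c y) (dv (c \<inter> p -` closed_segment x y)))"
    unfolding Mp[OF vv(1)] Mp[OF vv(2)] Mp[OF vv(3)] Md[OF e(1,3)[OF vv(2,3,5)]] Md[OF e(1,3)[OF vv(3,1,6)]]
      Md[OF e(1,3)[OF vv(1,2,4)]] edge_term_motion[OF M(1)] ..
  also have "\<dots> = - (triangle_term dv c i (closed_segment y z) + triangle_term dv c i (closed_segment z x) + triangle_term dv c i (closed_segment x y))"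
  proof -
    have "vertices i = {y, z, x}" "vertices i = {z, x, y}" using v by auto
    then show ?thesis
      using triangle_term_eq[of i x y z "closed_segment y z"] triangle_term_eq[of i y z x "closed_segment z x"]
        triangle_term_eq[of i z x y "closed_segment x y"] v vv e(2) by simp
  qed
  finally show ?thesis unfolding sum_triangle_edges[OF i(1) v] .
qed

definition dihedral_deriv :: "'a set \<Rightarrow> 'a set \<Rightarrow> 'a set \<Rightarrow> real" where
  "dihedral_deriv a s i = deriv (\<lambda>l. dihedral_of_lengths s i (L(a := l))) (L a)"

text \<open>Only lengths occur, and no 4-simplex, so this factor can be taken out of the sum over
  the 4-simplices containing \<open>t\<close>. The length \<open>sqrt (L b)\<close> is the one that
  appears in \<open>edge_term\<close>.\<close>

definition edge_angle_deriv :: "'a set \<Rightarrow> 'a set \<Rightarrow> 'a set \<Rightarrow> real" where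
  "edge_angle_deriv a t b = sqrt (L b) *
     deriv (\<lambda>l. gram_angle (schur (listing (vertices b) ! 1) (gram (L(a := l)) (listing (vertices b) ! 0)))
       (listing (vertices t - vertices b) ! 0) (listing (vertices t - vertices b) ! 1)) (L a)"

text \<open>Among the three vertices of \<open>s\<close> off \<open>b\<close>, a triangle at
  \<open>b\<close> selects one and a tetrahedron at \<open>b\<close> omits one. The claim is
  \<open>edge_identity\<close> in the chosen lift of \<open>s\<close>, paired with the deviation of
  \<open>b\<close> and scaled by the length of \<open>b\<close>.\<close>

lemma edge_sum_eq:
  assumes dv: "dv \<in> edge_deviations K E p \<rho> f" and a: "a \<in> simplices K 1"
    and s: "s \<in> simplices K 4" and b: "b \<in> simplices K 1" "b \<subseteq> s"
  shows "(\<Sum>i\<in>{i \<in> simplices K 2. b \<subseteq> i \<and> i \<subseteq> s}. dihedral_deriv a s i * triangle_term dv (some_lift E p s) i b)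
    = (\<Sum>t\<in>{t \<in> simplices K 3. b \<subseteq> t \<and> t \<subseteq> s}. edge_angle_deriv a t b * flux dv s t b)"
proof -
  note S = simplexD[OF s] and Bd = simplexD[OF b(1)]
  define c where "c = some_lift E p s"
  have c: "c \<in> lifts E p s" unfolding c_def by (rule some_lift[OF s])
  define q where "q = pos c"
  define d where "d = dv (c \<inter> p -` b)"
  have r: "realizes q s L" unfolding q_def by (rule placed_realizes[OF s c])
  have nd: "nondegenerate q (vertices s)" unfolding q_def by (rule placed_nondegenerate[OF s c])
  have lst: "is_listing (listing (vertices b)) (vertices b)" by (rule is_listing_listing[OF Bd(3)])
  then have "length (listing (vertices b)) = 2" using is_listing_length[OF lst] Bd(4) by simp
  then obtain A B where AB: "listing (vertices b) = [A, B]"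
    by (auto simp: numeral_eq_Suc length_Suc_conv)
  then have vb: "vertices b = {A, B}" "A \<noteq> B" using lst by (auto simp: is_listing_def)
  have bs: "vertices b \<subseteq> vertices s" by (rule vertices_mono[OF complex s Bd(1) b(2)])
  have "card (vertices s - vertices b) = 3" using S(3,4) Bd(3,4) bs by (simp add: card_Diff_subset)
  then obtain x y z where xyz: "vertices s - vertices b = {x, y, z}" "x \<noteq> y" "y \<noteq> z" "x \<noteq> z"
    by (auto simp: card_3_iff)
  have vs: "vertices s = {A, B} \<union> {x, y, z}" using xyz(1) vb(1) bs by auto
  have dis: "distinct [x, y, z]" "{x, y, z} \<inter> {A, B} = {}" "distinct [A, B, x, y, z]"
    using xyz vb by auto
  have vs': "vertices s = {A, B, x, y, z}" using vs by auto
  have cAB: "card {A, B} = 2" using vb by simp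
  let ?H = "\<lambda>W. convex hull W"
  have tri: "(\<Sum>i\<in>{i \<in> simplices K 2. b \<subseteq> i \<and> i \<subseteq> s}. h i) = h (?H {A, B, x}) + h (?H {A, B, y}) + h (?H {A, B, z})" for h :: "'a set \<Rightarrow> real"
  proof -
    have eq: "{i \<in> simplices K 2. b \<subseteq> i \<and> i \<subseteq> s} = {i \<in> simplices K 2. {A, B} \<subseteq> vertices i \<and> i \<subseteq> s}"
      using subset_iff_vertices[OF complex _ b(1)] vb(1) by auto
    have "(\<Sum>i\<in>{i \<in> simplices K 2. b \<subseteq> i \<and> i \<subseteq> s}. h i) = (\<Sum>W\<in>{insert x {A, B}, insert y {A, B}, insert z {A, B}}. h (?H W))"
      unfolding eq sum_faces[OF s] vs using subsets_add_1[OF dis(1,2)] cAB by simp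
    also have "\<dots> = h (?H (insert x {A, B})) + h (?H (insert y {A, B})) + h (?H (insert z {A, B}))"
    proof -
      have "insert x {A, B} \<noteq> insert y {A, B}" "insert x {A, B} \<noteq> insert z {A, B}" "insert y {A, B} \<noteq> insert z {A, B}"
        using dis(3) by auto
      then show ?thesis by (simp add: add.assoc)
    qed
    finally show ?thesis by (simp add: insert_commute)
  qed
  have tet: "(\<Sum>i\<in>{i \<in> simplices K 3. b \<subseteq> i \<and> i \<subseteq> s}. h i) = h (?H {A, B, y, z}) + h (?H {A, B, x, z}) + h (?H {A, B, x, y})" for h :: "'a set \<Rightarrow> real"
  proof -
    have eq: "{i \<in> simplices K 3. b \<subseteq> i \<and> i \<subseteq> s} = {i \<in> simplices K 3. {A, B} \<subseteq> vertices i \<and> i \<subseteq> s}"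
      using subset_iff_vertices[OF complex _ b(1)] vb(1) by auto
    have "(\<Sum>i\<in>{i \<in> simplices K 3. b \<subseteq> i \<and> i \<subseteq> s}. h i) = (\<Sum>W\<in>{{A, B} \<union> {y, z}, {A, B} \<union> {x, z}, {A, B} \<union> {x, y}}. h (?H W))"
      unfolding eq sum_faces[OF s] vs using subsets_remove_1[OF dis(1,2)] cAB by simp
    also have "\<dots> = h (?H ({A, B} \<union> {y, z})) + h (?H ({A, B} \<union> {x, z})) + h (?H ({A, B} \<union> {x, y}))"
    proof -
      have "{A, B} \<union> {y, z} \<noteq> {A, B} \<union> {x, z}" "{A, B} \<union> {y, z} \<noteq> {A, B} \<union> {x, y}" "{A, B} \<union> {x, z} \<noteq> {A, B} \<union> {x, y}"
        using dis(3) by auto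
      then show ?thesis by (simp add: add.assoc)
    qed
    finally show ?thesis by (simp add: insert_commute)
  qed
  have H2: "?H {A, B, u} \<in> simplices K 2" "vertices (?H {A, B, u}) = {A, B, u}" if "u \<in> {x, y, z}" for u
    using convex_hull_in_simplices[OF complex s, of "{A, B, u}" 2] that vs' dis(3) by auto
  have H3: "?H {A, B, u, v} \<in> simplices K 3" "vertices (?H {A, B, u, v}) = {A, B, u, v}" "?H {A, B, u, v} \<subseteq> s"
     if "u \<in> {x, y, z}" "v \<in> {x, y, z}" "u \<noteq> v" for u v
  proof -
    have "A \<noteq> u" "A \<noteq> v" "B \<noteq> u" "B \<noteq> v" using that(1,2) dis(3) by auto
    then have "card {A, B, u, v} = Suc 3" using vb(2) that(3) by simp
    moreover have "{A, B, u, v} \<subseteq> vertices s" using that(1,2) vs' by auto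
    ultimately show "?H {A, B, u, v} \<in> simplices K 3" "vertices (?H {A, B, u, v}) = {A, B, u, v}" "?H {A, B, u, v} \<subseteq> s"
      by (rule convex_hull_in_simplices[OF complex s, rotated])+
  qed
  have Lb: "sqrt (L b) = dist (q A) (q B)"
  proof -
    have "b = closed_segment A B" using Bd(5) vb by (simp add: segment_convex_hull)
    moreover have "A \<in> vertices s" "B \<in> vertices s" using vb(1) bs by auto
    ultimately have "(dist (q A) (q B))\<^sup>2 = L b" using r vb(2) unfolding realizes_def by blast
    then show ?thesis by (rule real_sqrt_unique) simp
  qed
  have tt: "triangle_term dv c (?H {A, B, u}) b = dist (q A) (q B) * (sgn (orth (q B - q A) (q u - q A)) \<bullet> d)" if "u \<in> {x, y, z}" for u
  proof -
    have "vertices (?H {A, B, u}) = {u, A, B}" using H2(2)[OF that] by auto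
    then have "triangle_term dv c (?H {A, B, u}) b = edge_term (q u) (q A) (q B) d"
      unfolding q_def d_def using that dis(3) vb(1) by (intro triangle_term_eq) auto
    then show ?thesis by (simp only: edge_term_def)
  qed
  let ?g = "\<lambda>u v. deriv (\<lambda>l. gram_angle (schur B (gram (L(a := l)) A)) u v) (L a)"
  have gc: "?g u v = ?g v u" for u v
  proof -
    have "gram_angle (schur B (gram (L(a := l)) A)) u v = gram_angle (schur B (gram (L(a := l)) A)) v u" for l
      by (rule gram_angle_commute) (rule schur_commute, rule gram_commute)
    then show ?thesis by simp
  qed
  have ea: "edge_angle_deriv a (?H {A, B, u, v}) b = dist (q A) (q B) * ?g u v" if "u \<in> {x, y, z}" "v \<in> {x, y, z}" "u \<noteq> v" for u v
  proof -
    have "vertices (?H {A, B, u, v}) - vertices b = {u, v}" using H3(2)[OF that] vb that dis(3) by auto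
    moreover have "listing {u, v} = [u, v] \<or> listing {u, v} = [v, u]" by (rule listing_doubleton[OF that(3)])
    ultimately show ?thesis unfolding edge_angle_deriv_def AB Lb using gc[of u v] by auto
  qed
  define n where "n u v = facet_normal q s (?H {A, B, u, v})" for u v
  have fl: "flux dv s (?H {A, B, u, v}) b = n u v \<bullet> d" for u v
    unfolding flux_def n_def q_def d_def c_def ..
  have nn: "norm (n u v) = 1 \<and> n u v \<bullet> (q B - q A) = 0 \<and> n u v \<bullet> (q u - q A) = 0 \<and> n u v \<bullet> (q v - q A) = 0 \<and> n u v \<bullet> (q w - q A) > 0"
    if w: "distinct [w, u, v]" "{w, u, v} = {x, y, z}" for u v w
  proof -
    have uv: "u \<in> {x, y, z}" "v \<in> {x, y, z}" "u \<noteq> v" using w by auto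
    have V: "vertices s = {w, A, B, u, v}" using vs w(2) by auto
    have D: "distinct [w, A, B, u, v]" using dis(3) w by auto
    show ?thesis
      using facet_normal_eq(1)[OF V D H3(2)[OF uv] nd] unfolding n_def is_facet_normal_iff[OF V D H3(2)[OF uv]] .
  qed
  have n1: "norm (n y z) = 1 \<and> n y z \<bullet> (q B - q A) = 0 \<and> n y z \<bullet> (q y - q A) = 0 \<and> n y z \<bullet> (q z - q A) = 0 \<and> n y z \<bullet> (q x - q A) > 0"
    by (rule nn) (use xyz in auto)
  have n2: "norm (n x z) = 1 \<and> n x z \<bullet> (q B - q A) = 0 \<and> n x z \<bullet> (q x - q A) = 0 \<and> n x z \<bullet> (q z - q A) = 0 \<and> n x z \<bullet> (q y - q A) > 0"
    by (rule nn) (use xyz in auto)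
  have n3: "norm (n x y) = 1 \<and> n x y \<bullet> (q B - q A) = 0 \<and> n x y \<bullet> (q x - q A) = 0 \<and> n x y \<bullet> (q y - q A) = 0 \<and> n x y \<bullet> (q z - q A) > 0"
    by (rule nn) (use xyz in auto)
  obtain u0 w0 where a': "a = closed_segment u0 w0"
    using simplexD(4,5)[OF a] by (metis One_nat_def Suc_1 card_2_iff segment_convex_hull)
  have id: "dihedral_deriv a s (?H {A, B, x}) *\<^sub>R sgn (orth (q B - q A) (q x - q A))
     + dihedral_deriv a s (?H {A, B, y}) *\<^sub>R sgn (orth (q B - q A) (q y - q A))
     + dihedral_deriv a s (?H {A, B, z}) *\<^sub>R sgn (orth (q B - q A) (q z - q A))
     = ?g y z *\<^sub>R n y z + ?g x z *\<^sub>R n x z + ?g x y *\<^sub>R n x y"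
    unfolding dihedral_deriv_def
    by (rule edge_identity[OF r nd vs' dis(3) a' H2(2) H2(2) H2(2)]) (use n1 n2 n3 in auto)
  from arg_cong[OF this, of "\<lambda>v. dist (q A) (q B) * (v \<bullet> d)"]
  have "dist (q A) (q B) * (dihedral_deriv a s (?H {A, B, x}) * (sgn (orth (q B - q A) (q x - q A)) \<bullet> d)
     + dihedral_deriv a s (?H {A, B, y}) * (sgn (orth (q B - q A) (q y - q A)) \<bullet> d)
     + dihedral_deriv a s (?H {A, B, z}) * (sgn (orth (q B - q A) (q z - q A)) \<bullet> d))
     = dist (q A) (q B) * (?g y z * (n y z \<bullet> d) + ?g x z * (n x z \<bullet> d) + ?g x y * (n x y \<bullet> d))"
    by (simp only: inner_add_left inner_scaleR_left)
  then show ?thesis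
    unfolding tri tet c_def[symmetric] fl using xyz
    by (simp add: tt ea distrib_left mult_ac)
qed

text \<open>\<open>deriv\<close> distributes over the sum because every summand is differentiable,
  which follows from the nondegeneracy of the placed 4-simplices.\<close>

lemma deficit_matrix_eq:
  assumes a: "a \<in> simplices K 1" and i: "i \<in> simplices K 2"
  shows "deficit_matrix K orient E p f i a = - (\<Sum>s\<in>{s \<in> simplices K 4. i \<subseteq> s}. sgn_of s * dihedral_deriv a s i)"
proof -
  obtain u0 w0 where a': "a = closed_segment u0 w0"
    using simplexD(4,5)[OF a] by (metis One_nat_def Suc_1 card_2_iff segment_convex_hull)
  have D: "((\<lambda>l. dihedral_of_lengths s i (L(a := l))) has_real_derivative dihedral_deriv a s i) (at (L a))"
    if s: "s \<in> simplices K 4" "i \<subseteq> s" for s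
  proof -
    note S = simplexD[OF s(1)] and I = simplexD[OF i]
    define c where "c = some_lift E p s"
    have c: "c \<in> lifts E p s" unfolding c_def by (rule some_lift[OF s(1)])
    have "card (vertices i) = 3" using I(4) by simp
    then obtain A B x where v: "vertices i = {A, B, x}" "A \<noteq> B" "B \<noteq> x" "A \<noteq> x" by (auto simp: card_3_iff)
    have viv: "vertices i \<subseteq> vertices s" by (rule vertices_mono[OF complex s(1) I(1) s(2)])
    have "card (vertices s - vertices i) = 2" using S(3,4) I(3,4) viv by (simp add: card_Diff_subset)
    then obtain y z where yz: "vertices s - vertices i = {y, z}" "y \<noteq> z" by (auto simp: card_2_iff)
    have V: "vertices s = {A, B, x, y, z}" using v yz viv by auto
    have Dd: "distinct [A, B, x, y, z]" using v yz by auto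
    show ?thesis unfolding dihedral_deriv_def
      using differentiable_dihedral_of_lengths[OF placed_realizes[OF s(1) c] placed_nondegenerate[OF s(1) c] V Dd a' v(1)]
      by (simp add: DERIV_deriv_iff_field_differentiable)
  qed
  have "((\<lambda>l. deficit_angle K orient E p f i (L(a := l))) has_real_derivative
      - (\<Sum>s\<in>{s \<in> simplices K 4. i \<subseteq> s}. sgn_of s * dihedral_deriv a s i)) (at (L a))"
    unfolding deficit_angle_def by (intro DERIV_minus DERIV_sum DERIV_cmult D) auto
  then show ?thesis unfolding deficit_matrix_def Let_def by (rule DERIV_imp_deriv)
qed

text \<open>A double count. The sum runs over flags of an edge \<open>b\<close>, a triangle and a
  4-simplex; for fixed \<open>b\<close> and \<open>s\<close> the local identity trades triangles for
  tetrahedra, and for fixed \<open>b\<close> and tetrahedron the sum over \<open>s\<close>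
  cancels.\<close>

lemma edge_deficit_eq_0:
  assumes dv: "dv \<in> edge_deviations K E p \<rho> f" and a: "a \<in> simplices K 1"
  shows "(\<Sum>i\<in>simplices K 2. deficit_matrix K orient E p f i a * area_map K E p f dv i) = 0"
proof -
  have fin: "finite (simplices K n)" for n by (rule finite_simplices[OF complex])
  let ?c = "\<lambda>s. some_lift E p s"
  have "(\<Sum>i\<in>simplices K 2. deficit_matrix K orient E p f i a * area_map K E p f dv i)
    = (\<Sum>i\<in>simplices K 2. \<Sum>s\<in>{s \<in> simplices K 4. i \<subseteq> s}. \<Sum>b\<in>{b \<in> simplices K 1. b \<subseteq> i}.
        sgn_of s * (dihedral_deriv a s i * triangle_term dv (?c s) i b))"
  proof (rule sum.cong[OF refl])
    fix i assume i: "i \<in> simplices K 2"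
    have "sgn_of s * dihedral_deriv a s i * area_map K E p f dv i =
      - (\<Sum>b\<in>{b \<in> simplices K 1. b \<subseteq> i}. sgn_of s * (dihedral_deriv a s i * triangle_term dv (?c s) i b))"
      if "s \<in> {s \<in> simplices K 4. i \<subseteq> s}" for s
    proof -
      have s: "s \<in> simplices K 4" "i \<subseteq> s" using that by auto
      show ?thesis unfolding area_map_eq[OF dv s(1) some_lift[OF s(1)] i s(2)]
        by (simp add: sum_distrib_left mult.assoc)
    qed
    then show "deficit_matrix K orient E p f i a * area_map K E p f dv i
      = (\<Sum>s\<in>{s \<in> simplices K 4. i \<subseteq> s}. \<Sum>b\<in>{b \<in> simplices K 1. b \<subseteq> i}. sgn_of s * (dihedral_deriv a s i * triangle_term dv (?c s) i b))"
      unfolding deficit_matrix_eq[OF a i] by (simp add: sum_distrib_right sum_negf)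
  qed
  \<comment> \<open>Incidences become conditionals, so that all index sets are independent and the
    sums can be interchanged.\<close>
  also have "\<dots> = (\<Sum>i\<in>simplices K 2. \<Sum>s\<in>simplices K 4. \<Sum>b\<in>simplices K 1.
        if b \<subseteq> i \<and> i \<subseteq> s then sgn_of s * (dihedral_deriv a s i * triangle_term dv (?c s) i b) else 0)"
    by (simp add: sum.inter_filter fin) (intro sum.cong refl, simp)
  also have "\<dots> = (\<Sum>s\<in>simplices K 4. \<Sum>b\<in>simplices K 1. \<Sum>i\<in>simplices K 2.
        if b \<subseteq> i \<and> i \<subseteq> s then sgn_of s * (dihedral_deriv a s i * triangle_term dv (?c s) i b) else 0)"
    by (subst sum.swap) (intro sum.cong refl sum.swap)
  also have "\<dots> = (\<Sum>s\<in>simplices K 4. \<Sum>b\<in>simplices K 1. sgn_of s *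
        (\<Sum>i\<in>{i \<in> simplices K 2. b \<subseteq> i \<and> i \<subseteq> s}. dihedral_deriv a s i * triangle_term dv (?c s) i b))"
    by (simp add: sum.inter_filter fin sum_distrib_left if_distrib[of "(*) _"] cong: if_cong)
  also have "\<dots> = (\<Sum>s\<in>simplices K 4. \<Sum>b\<in>simplices K 1. sgn_of s *
        (\<Sum>t\<in>{t \<in> simplices K 3. b \<subseteq> t \<and> t \<subseteq> s}. edge_angle_deriv a t b * flux dv s t b))"
  proof (intro sum.cong refl)
    fix s b assume s: "s \<in> simplices K 4" and b: "b \<in> simplices K 1"
    show "sgn_of s * (\<Sum>i\<in>{i \<in> simplices K 2. b \<subseteq> i \<and> i \<subseteq> s}. dihedral_deriv a s i * triangle_term dv (?c s) i b)
      = sgn_of s * (\<Sum>t\<in>{t \<in> simplices K 3. b \<subseteq> t \<and> t \<subseteq> s}. edge_angle_deriv a t b * flux dv s t b)"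
    proof (cases "b \<subseteq> s")
      case True
      then show ?thesis using edge_sum_eq[OF dv a s b] by simp
    next
      case False
      then have "{i \<in> simplices K 2. b \<subseteq> i \<and> i \<subseteq> s} = {}" "{t \<in> simplices K 3. b \<subseteq> t \<and> t \<subseteq> s} = {}" by auto
      then show ?thesis by (simp only: sum.empty)
    qed
  qed
  also have "\<dots> = (\<Sum>s\<in>simplices K 4. \<Sum>b\<in>simplices K 1. \<Sum>t\<in>simplices K 3.
        if b \<subseteq> t \<and> t \<subseteq> s then edge_angle_deriv a t b * (sgn_of s * flux dv s t b) else 0)"
    by (simp add: sum.inter_filter fin sum_distrib_left if_distrib[of "(*) _"] mult.left_commute cong: if_cong)
  also have "\<dots> = (\<Sum>b\<in>simplices K 1. \<Sum>t\<in>simplices K 3. \<Sum>s\<in>simplices K 4.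
        if b \<subseteq> t \<and> t \<subseteq> s then edge_angle_deriv a t b * (sgn_of s * flux dv s t b) else 0)"
    by (subst sum.swap) (intro sum.cong refl sum.swap)
  \<comment> \<open>The angle derivative does not depend on \<open>s\<close> and is factored out;
    the inner sum is the one in \<open>flux_cancel\<close>.\<close>
  also have "\<dots> = (\<Sum>b\<in>simplices K 1. \<Sum>t\<in>simplices K 3.
        if b \<subseteq> t then edge_angle_deriv a t b * (\<Sum>s\<in>{s \<in> simplices K 4. t \<subseteq> s}. sgn_of s * flux dv s t b) else 0)"
    by (intro sum.cong refl) (simp add: sum.inter_filter fin sum_distrib_left if_distrib[of "(*) _"] cong: if_cong)
  also have "\<dots> = 0"
    by (intro sum.neutral ballI) (simp add: flux_cancel[OF dv])
  finally show ?thesis .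
qed

end

theorem theorem2:
  fixes K :: "'a::euclidean_space set set"
    and orient :: "'a list \<Rightarrow> int"
    and E :: "'e::real_normed_vector set"
    and p :: "'e \<Rightarrow> 'a"
    and \<rho> :: "('e \<Rightarrow> 'e) \<Rightarrow> real^4 \<Rightarrow> real^4"
    and f :: "'e \<Rightarrow> real^4"
  assumes "simplicial_complex K"
    and "closed_pl_4_manifold (\<Union>K)"
    and "connected (\<Union>K)"
    and "orientation K orient"
    and "universal_cover E p (\<Union>K)"
    and "placement K E p \<rho> f"
  shows "area_map K E p f ` edge_deviations K E p \<rho> f
    \<subseteq> {dS \<in> face_columns K 2. edge_deficit_map K orient E p f dS = (\<lambda>a. 0)}"
proof -
  interpret placed_manifold K orient E p \<rho> f
    using assms by unfold_locales
  have "area_map K E p f dv \<in> face_columns K 2" for dv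
    by (simp add: face_columns_def area_map_def)
  moreover have "edge_deficit_map K orient E p f (area_map K E p f dv) = (\<lambda>a. 0)"
    if "dv \<in> edge_deviations K E p \<rho> f" for dv
    using edge_deficit_eq_0[OF that] by (auto simp: edge_deficit_map_def)
  ultimately show ?thesis by blast
qed

end
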